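(* Let $p,q\ge 2$ be integers and $f(z,w)=z^p+w^q$. There is a subset $\mathcal{B}\subset\mathbb{C}^2$, contained in the union of the zero sets of finitely many real-valued functions of the polar coordinates $(|a|,\arg a,|b|,\arg b)$ none of which vanishes identically, such that for every $(a,b)\in\mathbb{C}^2\setminus\mathcal{B}$ there exists a linear deformation $f_t$, $t\in[0,1]$, of $f$ with $f_1(z,w)=f(z,w)+a\bar z+b\bar w$ and such that $f_t:\mathbb{R}^4\to\mathbb{R}^2$ is an excellent map for every $t\in(0,1]$. Moreover, for every $t\in(0,1]$, every singular point of $f_t$ is either an indefinite fold or a cusp (in particular $f_t$ has no definite fold).
   Context: Complex polynomials in $(z,w)\in\mathbb{C}^2$ (possibly involving $\bar z,\bar w$) are regarded as smooth maps $\mathbb{R}^4\to\mathbb{R}^2$. A linear deformation of $f$ is a family $f_t(z,w)=f(z,w)+a_1(t)z+b_1(t)w+a_2(t)\bar z+b_2(t)\bar w$, $t\in[0,1]$, where $a_1,b_1,a_2,b_2$ are real-analytic complex-valued functions of $t$ vanishing at $t=0$. A smooth map $g:X^4\to Y^2$ between 4- and 2-dimensional manifolds is an excellent map if for every $x\in X$ there are local coordinates $(x_1,x_2,x_3,x_4)$ centered at $x$ and $(y_1,y_2)$ centered at $g(x)$ in which $g$ takes one of the forms: (1) $(x_1,x_2)$ (regular point); (2) $(x_1,x_2^2+x_3^2+x_4^2)$ (definite fold); (3) $(x_1,x_2^2+x_3^2-x_4^2)$ (indefinite fold); (4) $(x_1,x_2^2\pm x_3^2+x_1x_4+x_4^3)$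 (cusp). A singular point is a point where the real differential has rank $<2$. *)

theory Defs
  imports "HOL-Analysis.Analysis"
begin

definition real_analytic_fun_on :: "real set \<Rightarrow> (real \<Rightarrow> complex) \<Rightarrow> bool" where
  "real_analytic_fun_on U a \<longleftrightarrow>
     (\<forall>t0\<in>U. \<exists>r>0. \<exists>c::nat \<Rightarrow> complex. \<forall>t\<in>ball t0 r.
        ((\<lambda>n. c n * of_real ((t - t0) ^ n)) has_sum a t) UNIV)"

definition real_analytic_on_unit_interval :: "(real \<Rightarrow> complex) \<Rightarrow> bool" where
  "real_analytic_on_unit_interval a \<longleftrightarrow>
     (\<exists>U. open U \<and> {0..1} \<subseteq> U \<and> real_analytic_fun_on U a)"

definition real_analytic_multi_on :: "(real ^ 'n) set \<Rightarrow> (real ^ 'n \<Rightarrow> real) \<Rightarrow> bool" where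
  "real_analytic_multi_on U g \<longleftrightarrow>
     (\<forall>x\<in>U. \<exists>r>0. \<exists>c::('n \<Rightarrow> nat) \<Rightarrow> real. \<forall>y\<in>ball x r.
        ((\<lambda>\<alpha>. c \<alpha> * (\<Prod>i\<in>UNIV. (y $ i - x $ i) ^ \<alpha> i)) has_sum g y) UNIV)"

definition polar_coords :: "complex \<Rightarrow> complex \<Rightarrow> real ^ 4" where
  "polar_coords a b = vector [cmod a, Arg a, cmod b, Arg b]"

fun iter_dir_deriv :: "'a::real_normed_vector list \<Rightarrow> ('a \<Rightarrow> 'b::real_normed_vector) \<Rightarrow> 'a \<Rightarrow> 'b" where
  "iter_dir_deriv [] f = f"
| "iter_dir_deriv (v # vs) f = (\<lambda>x. frechet_derivative (iter_dir_deriv vs f) (at x) v)"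

definition smooth_on :: "'a::euclidean_space set \<Rightarrow> ('a \<Rightarrow> 'b::euclidean_space) \<Rightarrow> bool" where
  "smooth_on S f \<longleftrightarrow> open S \<and> (\<forall>vs. iter_dir_deriv vs f differentiable_on S)"

definition diffeo_between :: "('a::euclidean_space \<Rightarrow> 'b::euclidean_space) \<Rightarrow> 'a set \<Rightarrow> 'b set \<Rightarrow> bool" where
  "diffeo_between \<phi> U V \<longleftrightarrow> open U \<and> open V \<and> bij_betw \<phi> U V \<and> smooth_on U \<phi>
     \<and> smooth_on V (inv_into U \<phi>)"

text \<open>Maps R^4 \<rightarrow> R^2 are represented as maps C^2 \<rightarrow> C.
  g has local normal form N at x: there are local coordinates (x1,..,x4) centred at x
  and (y1,y2) centred at g x in which g equals N.\<close>
definition has_local_form :: "(complex \<times> complex \<Rightarrow> complex) \<Rightarrow> (real ^ 4 \<Rightarrow> real ^ 2)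
    \<Rightarrow> complex \<times> complex \<Rightarrow> bool" where
  "has_local_form g N x \<longleftrightarrow>
     (\<exists>U V \<phi> W W' \<psi>. x \<in> U \<and> diffeo_between (\<phi> :: complex \<times> complex \<Rightarrow> real ^ 4) U V \<and> \<phi> x = 0
        \<and> g x \<in> W \<and> diffeo_between (\<psi> :: complex \<Rightarrow> real ^ 2) W W' \<and> \<psi> (g x) = 0
        \<and> g ` U \<subseteq> W \<and> (\<forall>y\<in>U. \<psi> (g y) = N (\<phi> y)))"

definition regular_form :: "real ^ 4 \<Rightarrow> real ^ 2" where
  "regular_form x = vector [x$1, x$2]"

definition definite_fold_form :: "real ^ 4 \<Rightarrow> real ^ 2" where
  "definite_fold_form x = vector [x$1, (x$2)^2 + (x$3)^2 + (x$4)^2]"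

definition indefinite_fold_form :: "real ^ 4 \<Rightarrow> real ^ 2" where
  "indefinite_fold_form x = vector [x$1, (x$2)^2 + (x$3)^2 - (x$4)^2]"

definition cusp_plus_form :: "real ^ 4 \<Rightarrow> real ^ 2" where
  "cusp_plus_form x = vector [x$1, (x$2)^2 + (x$3)^2 + x$1 * x$4 + (x$4)^3]"

definition cusp_minus_form :: "real ^ 4 \<Rightarrow> real ^ 2" where
  "cusp_minus_form x = vector [x$1, (x$2)^2 - (x$3)^2 + x$1 * x$4 + (x$4)^3]"

definition is_cusp :: "(complex \<times> complex \<Rightarrow> complex) \<Rightarrow> complex \<times> complex \<Rightarrow> bool" where
  "is_cusp g x \<longleftrightarrow> has_local_form g cusp_plus_form x \<or> has_local_form g cusp_minus_form x"

definition excellent_map :: "(complex \<times> complex \<Rightarrow> complex) \<Rightarrow> bool" where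
  "excellent_map g \<longleftrightarrow> smooth_on UNIV g \<and>
     (\<forall>x. has_local_form g regular_form x \<or> has_local_form g definite_fold_form x
        \<or> has_local_form g indefinite_fold_form x \<or> is_cusp g x)"

definition singular_point :: "(complex \<times> complex \<Rightarrow> complex) \<Rightarrow> complex \<times> complex \<Rightarrow> bool" where
  "singular_point g x \<longleftrightarrow> dim (range (frechet_derivative g (at x))) < 2"

definition lin_deform ::
  "(complex \<times> complex \<Rightarrow> complex) \<Rightarrow> (real \<Rightarrow> complex) \<Rightarrow> (real \<Rightarrow> complex) \<Rightarrow> (real \<Rightarrow> complex)
    \<Rightarrow> (real \<Rightarrow> complex) \<Rightarrow> real \<Rightarrow> complex \<times> complex \<Rightarrow> complex" where
  "lin_deform f a1 b1 a2 b2 t = (\<lambda>(z, w). f (z, w) + a1 t * z + b1 t * w + a2 t * cnj z + b2 t * cnj w)"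

definition is_linear_deformation_coeffs :: "(real \<Rightarrow> complex) \<Rightarrow> bool" where
  "is_linear_deformation_coeffs a \<longleftrightarrow> real_analytic_on_unit_interval a \<and> a 0 = 0"

end

theory Submission
  imports Defs "HOL-Complex_Analysis.Complex_Analysis"
begin

text \<open>
  Put \<open>g = z\<^sup>p + w\<^sup>q + a \<cdot> cnj z + b \<cdot> cnj w\<close>. Scaling \<open>z\<close> and \<open>w\<close> by \<open>t\<^sup>q\<close> and \<open>t\<^sup>p\<close> shows that replacing \<open>(a, b)\<close> by
  \<open>(t\<^bsup>q(p-1)\<^esup> a, t\<^bsup>p(q-1)\<^esup> b)\<close> does not change the type of the singular points, so these coefficients give the
  deformation and it suffices to study \<open>g\<close> itself.

  At a singular point there is a unit \<open>c\<close> such that \<open>Re (c \<cdot> dg) = 0\<close>. For real \<open>s\<close> put \<open>C = c (1 + i s)\<close>. Then \<open>Re (C g)\<close>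
  is the real part of the holomorphic function \<open>C z\<^sup>p + cnj (C a) z\<close> plus the analogous function of \<open>w\<close>. The critical points
  of both are nondegenerate and explicit functions of \<open>s\<close>; the sum of the critical values is an explicit function \<open>K s\<close>,
  and the deviation from it is the real part of \<open>\<zeta>\<^sup>2 + \<omega>\<^sup>2\<close> for Morse coordinates \<open>\<zeta>\<close> of \<open>z\<close> and \<open>\<omega>\<close> of \<open>w\<close>. Choosing
  \<open>s\<close> as a function of \<open>w\<close> that makes \<open>Re (\<omega>\<^sup>2)\<close> vanish turns \<open>g\<close> into \<open>(\<eta>, s \<eta> + K s + X\<^sup>2 - Y\<^sup>2)\<close> with local coordinates
  \<open>(\<eta>, s, X, Y)\<close>. Dividing \<open>K\<close> by a monic polynomial of degree 2 or 3 with free coefficients, by means of Cauchy's formula,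
  yields the indefinite fold if \<open>K'' 0 \<noteq> 0\<close> and the cusp if \<open>K'' 0 = 0 \<noteq> K''' 0\<close>.

  If \<open>K'' 0 = K''' 0 = 0\<close> at some singular point, eliminating the point leaves a polynomial relation between the cosine of
  a combination of the arguments and a fractional power of the moduli of \<open>a\<close> and \<open>b\<close>; the product of its conjugates under
  roots of unity is analytic in the polar coordinates.
\<close>

section \<open>Smooth germs\<close>

primrec k_smooth :: "nat \<Rightarrow> 'a::euclidean_space set \<Rightarrow> ('a \<Rightarrow> 'b::euclidean_space) \<Rightarrow> bool" where
  "k_smooth 0 S f \<longleftrightarrow> continuous_on S f"
| "k_smooth (Suc k) S f \<longleftrightarrow> f differentiable_on S
     \<and> (\<forall>v. k_smooth k S (\<lambda>x. frechet_derivative f (at x) v))"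

lemma iter_dir_deriv_snoc:
  "iter_dir_deriv (us @ [v]) f = iter_dir_deriv us (\<lambda>x. frechet_derivative f (at x) v)"
  by (induction us) auto

lemma iter_dir_deriv_differentiable_imp_k_smooth:
  assumes "\<And>vs. iter_dir_deriv vs f differentiable_on S"
  shows "k_smooth k S f"
  using assms
proof (induction k arbitrary: f)
  case 0
  then show ?case
    using differentiable_imp_continuous_on[OF 0[of "[]"]] by simp
next
  case (Suc k)
  have "k_smooth k S (\<lambda>x. frechet_derivative f (at x) v)" for v
    by (rule Suc.IH) (metis Suc.prems iter_dir_deriv_snoc)
  then show ?case
    using Suc.prems[of "[]"] by simp
qed

lemma k_smooth_imp_iter_dir_deriv_differentiable:
  assumes "\<And>k. k_smooth k S f"
  shows "iter_dir_deriv vs f differentiable_on S"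
  using assms
proof (induction vs arbitrary: f rule: rev_induct)
  case Nil
  show ?case
    using Nil[of "Suc 0"] by simp
next
  case (snoc v vs)
  have "k_smooth k S (\<lambda>x. frechet_derivative f (at x) v)" for k
    using snoc.prems[of "Suc k"] by simp
  then show ?case
    by (simp add: iter_dir_deriv_snoc snoc.IH)
qed

lemma smooth_on_iff_k_smooth: "smooth_on S f \<longleftrightarrow> open S \<and> (\<forall>k. k_smooth k S f)"
  unfolding smooth_on_def
  using iter_dir_deriv_differentiable_imp_k_smooth k_smooth_imp_iter_dir_deriv_differentiable by blast

lemma k_smooth_SucD: "k_smooth (Suc k) S f \<Longrightarrow> k_smooth k S f"
  by (induction k arbitrary: f) (auto dest: differentiable_imp_continuous_on)

lemma k_smooth_imp_continuous_on: "k_smooth k S f \<Longrightarrow> continuous_on S f"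
  by (cases k) (auto dest: differentiable_imp_continuous_on)

lemma k_smooth_has_derivative:
  assumes "k_smooth (Suc k) S f" "open S" "x \<in> S"
  shows "(f has_derivative frechet_derivative f (at x)) (at x)"
  using assms by (simp add: differentiable_on_eq_differentiable_at frechet_derivative_works)

lemma k_smooth_cong:
  assumes "open S" "\<And>x. x \<in> S \<Longrightarrow> f x = g x" "k_smooth k S f"
  shows "k_smooth k S g"
  using assms(2,3)
proof (induction k arbitrary: f g)
  case 0
  then show ?case by (simp cong: continuous_on_cong)
next
  case (Suc k)
  have dg: "(g has_derivative frechet_derivative f (at x)) (at x)" if "x \<in> S" for x
    by (rule has_derivative_transform_within_open[OF
          k_smooth_has_derivative[OF Suc.prems(2) assms(1) that] assms(1) that Suc.prems(1)])
  then have "g differentiable_on S"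
    using assms(1) by (auto simp: differentiable_on_eq_differentiable_at differentiable_def)
  moreover have "k_smooth k S (\<lambda>x. frechet_derivative g (at x) v)" for v
    using Suc.IH[of "\<lambda>x. frechet_derivative f (at x) v"] Suc.prems(2) frechet_derivative_at[OF dg] by simp
  ultimately show ?case by simp
qed

lemma k_smooth_SucI:
  assumes "open S" "\<And>x. x \<in> S \<Longrightarrow> (f has_derivative f' x) (at x)"
    and "\<And>v. k_smooth k S (\<lambda>x. f' x v)"
  shows "k_smooth (Suc k) S f"
proof -
  have "frechet_derivative f (at x) = f' x" if "x \<in> S" for x
    using frechet_derivative_at[OF assms(2)[OF that]] by simp
  then have "k_smooth k S (\<lambda>x. frechet_derivative f (at x) v)" for v
    using k_smooth_cong[OF assms(1) _ assms(3)[of v]] by simp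
  moreover have "f differentiable_on S"
    using assms by (auto simp: differentiable_on_eq_differentiable_at differentiable_def)
  ultimately show ?thesis by simp
qed

lemma k_smooth_subset:
  assumes "k_smooth k S f" "T \<subseteq> S"
  shows "k_smooth k T f"
  using assms(1)
  by (induction k arbitrary: f)
     (auto intro: differentiable_on_subset[OF _ assms(2)] continuous_on_subset[OF _ assms(2)])

lemma k_smooth_local:
  assumes "open S" "\<And>x. x \<in> S \<Longrightarrow> \<exists>T. open T \<and> x \<in> T \<and> k_smooth k T f"
  shows "k_smooth k S f"
  using assms(2)
proof (induction k arbitrary: f)
  case 0
  then show ?case
    using assms(1) by (metis continuous_on_eq_continuous_at k_smooth.simps(1))
next
  case (Suc k)
  have "f differentiable_on S"
    unfolding differentiable_on_eq_differentiable_at[OF assms(1)]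
    using Suc.prems by (metis differentiable_on_eq_differentiable_at k_smooth.simps(2))
  moreover have "k_smooth k S (\<lambda>x. frechet_derivative f (at x) v)" for v
    by (rule Suc.IH) (use Suc.prems in fastforce)
  ultimately show ?case by simp
qed

lemma k_smooth_const: "open S \<Longrightarrow> k_smooth k S (\<lambda>x. c)"
proof (induction k arbitrary: c)
  case (Suc k)
  then show ?case by (intro k_smooth_SucI[where f'="\<lambda>_ _. 0"]) auto
qed auto

lemma k_smooth_linear:
  assumes "bounded_linear L" "open S"
  shows "k_smooth k S L"
proof (rule k_smooth_SucD, rule k_smooth_SucI[OF assms(2)])
  show "(L has_derivative L) (at x)" for x
    by (rule bounded_linear_imp_has_derivative[OF assms(1)])
  show "k_smooth k S (\<lambda>x. L v)" for v
    by (rule k_smooth_const[OF assms(2)])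
qed

lemma k_smooth_add:
  assumes "open S" "k_smooth k S f" "k_smooth k S g"
  shows "k_smooth k S (\<lambda>x. f x + g x)"
  using assms(2,3)
proof (induction k arbitrary: f g)
  case 0
  then show ?case by (auto intro: continuous_on_add)
next
  case (Suc k)
  show ?case
    by (rule k_smooth_SucI[OF assms(1) has_derivative_add[OF
          k_smooth_has_derivative[OF Suc.prems(1)] k_smooth_has_derivative[OF Suc.prems(2)]]])
       (use Suc assms(1) in auto)
qed

lemma k_smooth_sum:
  assumes "open S" "\<And>i. i \<in> I \<Longrightarrow> k_smooth k S (f i)"
  shows "k_smooth k S (\<lambda>x. \<Sum>i\<in>I. f i x)"
  using assms(2)
  by (induction I rule: infinite_finite_induct) (simp_all add: k_smooth_const k_smooth_add assms(1))

lemma k_smooth_bilinear: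
  assumes "bounded_bilinear B" "open S" "k_smooth k S f" "k_smooth k S g"
  shows "k_smooth k S (\<lambda>x. B (f x) (g x))"
  using assms(3,4)
proof (induction k arbitrary: f g)
  case 0
  then show ?case using bounded_bilinear.continuous_on[OF assms(1)] by simp
next
  case (Suc k)
  show ?case
  proof (rule k_smooth_SucI[OF assms(2) bounded_bilinear.FDERIV[OF assms(1)
          k_smooth_has_derivative[OF Suc.prems(1) assms(2)] k_smooth_has_derivative[OF Suc.prems(2) assms(2)]]])
    fix v
    have "k_smooth k S (\<lambda>x. frechet_derivative f (at x) v)" "k_smooth k S (\<lambda>x. frechet_derivative g (at x) v)"
      using Suc.prems by auto
    then show "k_smooth k S (\<lambda>x. B (f x) (frechet_derivative g (at x) v) + B (frechet_derivative f (at x) v) (g x))"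
      by (intro k_smooth_add assms(2) Suc.IH Suc.prems[THEN k_smooth_SucD])
  qed
qed

lemma linear_Basis_expansion:
  fixes L :: "'a::euclidean_space \<Rightarrow> 'b::real_vector"
  assumes "linear L"
  shows "(\<Sum>b\<in>Basis. (v \<bullet> b) *\<^sub>R L b) = L v"
  using linear_sum[OF assms, of "\<lambda>b. (v \<bullet> b) *\<^sub>R b" Basis]
  by (simp add: linear_scale[OF assms] euclidean_representation)

lemma k_smooth_apply_operator:
  fixes A :: "'c::euclidean_space \<Rightarrow> 'a::euclidean_space \<Rightarrow> 'b::euclidean_space"
  assumes "open S" "\<And>x. x \<in> S \<Longrightarrow> linear (A x)" "\<And>b. k_smooth k S (\<lambda>x. A x b)" "k_smooth k S u"
  shows "k_smooth k S (\<lambda>x. A x (u x))"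
proof (rule k_smooth_cong[OF assms(1)])
  show "k_smooth k S (\<lambda>x. \<Sum>b\<in>Basis. (u x \<bullet> b) *\<^sub>R A x b)"
    by (intro k_smooth_sum k_smooth_bilinear[OF bounded_bilinear_scaleR]
        k_smooth_bilinear[OF bounded_bilinear_inner] k_smooth_const assms)
qed (use linear_Basis_expansion assms(2) in blast)

lemma k_smooth_compose:
  fixes f :: "'a::euclidean_space \<Rightarrow> 'b::euclidean_space" and g :: "'b \<Rightarrow> 'c::euclidean_space"
  assumes "open S" "open T" "f ` S \<subseteq> T" "k_smooth k S f" "k_smooth k T g"
  shows "k_smooth k S (\<lambda>x. g (f x))"
  using assms(4,5)
proof (induction k arbitrary: g)
  case 0
  then show ?case using continuous_on_compose2[of T g S f] assms(3) by simp
next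
  case (Suc k)
  have dg: "(g has_derivative frechet_derivative g (at (f x))) (at (f x))" if "x \<in> S" for x
    by (rule k_smooth_has_derivative[OF Suc.prems(2) assms(2)]) (use that assms(3) in auto)
  show ?case
  proof (rule k_smooth_SucI[OF assms(1) has_derivative_compose[OF k_smooth_has_derivative[OF Suc.prems(1) assms(1)] dg]])
    fix v
    show "k_smooth k S (\<lambda>x. frechet_derivative g (at (f x)) (frechet_derivative f (at x) v))"
    proof (rule k_smooth_apply_operator[where A="\<lambda>x. frechet_derivative g (at (f x))", OF assms(1)])
      show "linear (frechet_derivative g (at (f x)))" if "x \<in> S" for x
        by (rule has_derivative_linear[OF dg[OF that]])
      show "k_smooth k S (\<lambda>x. frechet_derivative g (at (f x)) b)" for b
        by (rule Suc.IH) (use Suc.prems in \<open>auto intro: k_smooth_SucD\<close>)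
    qed (use Suc.prems in auto)
  qed
qed

lemma k_smooth_holomorphic:
  assumes "open S" "f holomorphic_on S"
  shows "k_smooth k S f"
  using assms(2)
proof (induction k arbitrary: f)
  case 0
  then show ?case by (simp add: holomorphic_on_imp_continuous_on)
next
  case (Suc k)
  show ?case
  proof (rule k_smooth_SucI[OF assms(1)])
    show "(f has_derivative (*) (deriv f x)) (at x)" if "x \<in> S" for x
      using holomorphic_derivI[OF Suc.prems assms(1) that] has_field_derivative_def by blast
    show "k_smooth k S (\<lambda>x. deriv f x * v)" for v
      by (intro k_smooth_bilinear[OF bounded_bilinear_mult] Suc.IH holomorphic_deriv Suc.prems k_smooth_const assms(1))
  qed
qed

definition smooth_at :: "'a::euclidean_space \<Rightarrow> ('a \<Rightarrow> 'b::euclidean_space) \<Rightarrow> bool" where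
  "smooth_at x f \<longleftrightarrow> (\<exists>U. x \<in> U \<and> smooth_on U f)"

lemma smooth_atE:
  assumes "smooth_at x f"
  obtains U where "x \<in> U" "open U" "\<And>k. k_smooth k U f"
  using assms unfolding smooth_at_def smooth_on_iff_k_smooth by blast

lemma smooth_atI:
  assumes "x \<in> U" "open U" "\<And>k. k_smooth k U f"
  shows "smooth_at x f"
  using assms unfolding smooth_at_def smooth_on_iff_k_smooth by blast

lemma smooth_on_iff_smooth_at: "smooth_on S f \<longleftrightarrow> open S \<and> (\<forall>x\<in>S. smooth_at x f)"
proof
  assume "open S \<and> (\<forall>x\<in>S. smooth_at x f)"
  then show "smooth_on S f"
    unfolding smooth_on_iff_k_smooth by (metis k_smooth_local smooth_atE)
qed (auto simp: smooth_on_def smooth_at_def)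

lemma smooth_at_eventually_cong:
  assumes "smooth_at x f" "\<forall>\<^sub>F y in nhds x. f y = g y"
  shows "smooth_at x g"
proof -
  obtain U where U: "x \<in> U" "open U" "\<And>k. k_smooth k U f" by (rule smooth_atE[OF assms(1)]) blast
  obtain V where V: "open V" "x \<in> V" "\<And>y. y \<in> V \<Longrightarrow> f y = g y"
    using assms(2) unfolding eventually_nhds by blast
  have UV: "open (U \<inter> V)" using U V by blast
  have "k_smooth k (U \<inter> V) g" for k
    by (rule k_smooth_cong[OF UV _ k_smooth_subset[OF U(3)]]) (use V(3) in auto)
  then show ?thesis using smooth_atI[OF _ UV] U(1) V(2) by blast
qed

lemma smooth_at_has_derivative:
  assumes "smooth_at x f"
  shows "(f has_derivative frechet_derivative f (at x)) (at x)"
  using assms k_smooth_has_derivative by (metis smooth_atE)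

lemma smooth_at_isCont: "smooth_at x f \<Longrightarrow> isCont f x"
  using smooth_at_has_derivative has_derivative_continuous by blast

lemma smooth_at_compose:
  assumes "smooth_at x f" "smooth_at (f x) g"
  shows "smooth_at x (\<lambda>y. g (f y))"
proof -
  obtain U where U: "x \<in> U" "open U" "\<And>k. k_smooth k U f" by (rule smooth_atE[OF assms(1)]) blast
  obtain V where V: "f x \<in> V" "open V" "\<And>k. k_smooth k V g" by (rule smooth_atE[OF assms(2)]) blast
  have UV: "open (U \<inter> f -` V)"
    by (rule continuous_open_preimage[OF k_smooth_imp_continuous_on[OF U(3)] U(2) V(2)])
  have "k_smooth k (U \<inter> f -` V) (\<lambda>y. g (f y))" for k
    by (rule k_smooth_compose[OF UV V(2) _ k_smooth_subset[OF U(3)] V(3)]) auto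
  then show ?thesis
    using smooth_atI[OF _ UV] U(1) V(1) by blast
qed

lemma smooth_at_const: "smooth_at x (\<lambda>y. c)"
  by (rule smooth_atI[OF UNIV_I open_UNIV k_smooth_const[OF open_UNIV]])

lemma smooth_at_linear: "bounded_linear L \<Longrightarrow> smooth_at x L"
  by (rule smooth_atI[OF UNIV_I open_UNIV k_smooth_linear[OF _ open_UNIV]])

lemma smooth_at_common_nhd:
  assumes "smooth_at x f" "smooth_at x g"
  obtains U where "x \<in> U" "open U" "\<And>k. k_smooth k U f" "\<And>k. k_smooth k U g"
proof -
  obtain U where U: "x \<in> U" "open U" "\<And>k. k_smooth k U f" by (rule smooth_atE[OF assms(1)]) blast
  obtain V where V: "x \<in> V" "open V" "\<And>k. k_smooth k V g" by (rule smooth_atE[OF assms(2)]) blast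
  show ?thesis
    by (rule that[OF _ _ k_smooth_subset[OF U(3)] k_smooth_subset[OF V(3)], of "U \<inter> V"]) (use U V in auto)
qed

lemma smooth_at_bilinear:
  assumes "bounded_bilinear B" "smooth_at x f" "smooth_at x g"
  shows "smooth_at x (\<lambda>y. B (f y) (g y))"
  by (rule smooth_at_common_nhd[OF assms(2,3)]) (rule smooth_atI, auto intro: k_smooth_bilinear[OF assms(1)])

lemma smooth_at_add:
  assumes "smooth_at x f" "smooth_at x g"
  shows "smooth_at x (\<lambda>y. f y + g y)"
  by (rule smooth_at_common_nhd[OF assms]) (rule smooth_atI, auto intro: k_smooth_add)

lemma smooth_at_linear_compose:
  "bounded_linear L \<Longrightarrow> smooth_at x f \<Longrightarrow> smooth_at x (\<lambda>y. L (f y))"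
  using smooth_at_compose smooth_at_linear by blast

lemma smooth_at_analytic_compose:
  fixes h :: "complex \<Rightarrow> complex"
  assumes "smooth_at x f" "h analytic_on {f x}"
  shows "smooth_at x (\<lambda>y. h (f y))"
proof (rule smooth_at_compose[OF assms(1)])
  show "smooth_at (f x) h"
    using assms(2) analytic_at[of h "f x"] k_smooth_holomorphic smooth_atI by metis
qed

named_theorems smooth_intros

lemmas [smooth_intros] = smooth_at_const smooth_at_add
  smooth_at_bilinear[OF bounded_bilinear_mult] smooth_at_bilinear[OF bounded_bilinear_scaleR]
  smooth_at_linear[OF bounded_linear_ident]
  smooth_at_linear_compose[OF bounded_linear_fst] smooth_at_linear_compose[OF bounded_linear_snd]
  smooth_at_linear_compose[OF bounded_linear_Re] smooth_at_linear_compose[OF bounded_linear_Im]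
  smooth_at_linear_compose[OF bounded_linear_cnj] smooth_at_linear_compose[OF bounded_linear_of_real]
  smooth_at_linear_compose[OF bounded_linear_vec_nth]

lemma smooth_at_minus [smooth_intros]: "smooth_at x f \<Longrightarrow> smooth_at x (\<lambda>y. - f y)"
  by (rule smooth_at_linear_compose[OF bounded_linear_minus[OF bounded_linear_ident]])

lemma smooth_at_diff [smooth_intros]:
  "smooth_at x f \<Longrightarrow> smooth_at x g \<Longrightarrow> smooth_at x (\<lambda>y. f y - g y)"
  using smooth_at_add[OF _ smooth_at_minus] by force

lemma smooth_at_sum [smooth_intros]:
  "(\<And>i. i \<in> I \<Longrightarrow> smooth_at x (f i)) \<Longrightarrow> smooth_at x (\<lambda>y. \<Sum>i\<in>I. f i y)"
  by (induction I rule: infinite_finite_induct) (auto intro: smooth_intros)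

lemma smooth_at_componentwise:
  assumes "\<And>b. b \<in> Basis \<Longrightarrow> smooth_at x (\<lambda>y. f y \<bullet> b)"
  shows "smooth_at x f"
proof -
  have "smooth_at x (\<lambda>y. \<Sum>b\<in>Basis. (f y \<bullet> b) *\<^sub>R b)"
    by (intro smooth_intros assms)
  then show ?thesis by (simp add: euclidean_representation)
qed

lemma smooth_at_Pair [smooth_intros]:
  assumes "smooth_at x f" "smooth_at x g"
  shows "smooth_at x (\<lambda>y. (f y, g y))"
proof -
  have "smooth_at x (\<lambda>y. (f y, 0) + (0, g y))"
    by (intro smooth_at_add smooth_at_linear_compose[OF bounded_linear_Pair[OF bounded_linear_ident bounded_linear_zero]]
       smooth_at_linear_compose[OF bounded_linear_Pair[OF bounded_linear_zero bounded_linear_ident]] assms)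
  then show ?thesis by simp
qed

lemma smooth_at_power [smooth_intros]:
  fixes f :: "'a::euclidean_space \<Rightarrow> 'b::{euclidean_space, real_normed_algebra_1}"
  shows "smooth_at x f \<Longrightarrow> smooth_at x (\<lambda>y. f y ^ n)"
  by (induction n) (auto intro: smooth_intros)

lemma smooth_at_complex_divide [smooth_intros]:
  fixes f g :: "'a::euclidean_space \<Rightarrow> complex"
  assumes "smooth_at x f" "smooth_at x g" "g x \<noteq> 0"
  shows "smooth_at x (\<lambda>y. f y / g y)"
proof -
  have "smooth_at x (\<lambda>y. inverse (g y))"
    by (rule smooth_at_analytic_compose[where h=inverse]) (use assms in \<open>auto intro: analytic_intros\<close>)
  then show ?thesis
    unfolding divide_inverse by (intro smooth_intros assms(1))
qed

lemma smooth_at_real_divide [smooth_intros]: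
  fixes f g :: "'a::euclidean_space \<Rightarrow> real"
  assumes "smooth_at x f" "smooth_at x g" "g x \<noteq> 0"
  shows "smooth_at x (\<lambda>y. f y / g y)"
proof -
  have "smooth_at x (\<lambda>y. Re (of_real (f y) / of_real (g y)))"
    by (intro smooth_intros assms) (use assms in auto)
  then show ?thesis by (simp flip: of_real_divide)
qed

lemma eventually_nhds_isCont:
  assumes "isCont f x" "\<forall>\<^sub>F y in nhds (f x). P y"
  shows "\<forall>\<^sub>F y in nhds x. P (f y)"
  using assms unfolding isCont_def tendsto_at_iff_tendsto_nhds
  by (rule filterlim_iff[THEN iffD1, rule_format])

lemma smooth_at_sqrt [smooth_intros]:
  fixes f :: "'a::euclidean_space \<Rightarrow> real"
  assumes "smooth_at x f" "f x > 0"
  shows "smooth_at x (\<lambda>y. sqrt (f y))"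
proof (rule smooth_at_eventually_cong)
  show "smooth_at x (\<lambda>y. Re (csqrt (of_real (f y))))"
    by (intro smooth_intros smooth_at_analytic_compose[of x "\<lambda>y. of_real (f y)" csqrt] assms)
       (use assms in \<open>auto intro!: analytic_intros\<close>)
  have "\<forall>\<^sub>F t in nhds (f x). 0 < t"
    using assms(2) eventually_nhds_in_open[of "{0<..}" "f x"] by simp
  then have "\<forall>\<^sub>F y in nhds x. 0 < f y"
    by (rule eventually_nhds_isCont[OF smooth_at_isCont[OF assms(1)]])
  then show "\<forall>\<^sub>F y in nhds x. Re (csqrt (of_real (f y))) = sqrt (f y)"
    by eventually_elim simp
qed

section \<open>Inverse and implicit functions\<close>

lemma linear_derivative_of_operator:
  fixes A :: "'c::euclidean_space \<Rightarrow> 'a::euclidean_space \<Rightarrow> 'b::euclidean_space"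
  assumes "open S" "x \<in> S" "\<And>y. y \<in> S \<Longrightarrow> linear (A y)"
    and dA: "\<And>u. ((\<lambda>y. A y u) has_derivative A' u) (at x)"
  shows "linear (\<lambda>u. A' u w)"
proof (rule linearI)
  fix u v :: 'a
  have "((\<lambda>y. A y (u + v)) has_derivative (\<lambda>w. A' u w + A' v w)) (at x)"
    by (rule has_derivative_transform_within_open[OF has_derivative_add[OF dA dA] assms(1,2)])
       (simp add: linear_add[OF assms(3)])
  then show "A' (u + v) w = A' u w + A' v w"
    using has_derivative_unique[OF dA] by metis
next
  fix r and u :: 'a
  have "((\<lambda>y. A y (r *\<^sub>R u)) has_derivative (\<lambda>w. r *\<^sub>R A' u w)) (at x)"
    by (rule has_derivative_transform_within_open[OF has_derivative_scaleR_right[OF dA] assms(1,2)])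
       (simp add: linear_scale[OF assms(3)])
  then show "A' (r *\<^sub>R u) w = r *\<^sub>R A' u w"
    using has_derivative_unique[OF dA] by metis
qed

lemma has_derivative_operator_apply:
  fixes A :: "'c::euclidean_space \<Rightarrow> 'a::euclidean_space \<Rightarrow> 'b::euclidean_space"
  assumes "open S" "x \<in> S" and lin: "\<And>y. y \<in> S \<Longrightarrow> linear (A y)"
    and dA: "\<And>u. ((\<lambda>y. A y u) has_derivative A' u) (at x)"
  shows "((\<lambda>p. A (fst p) (snd p)) has_derivative (\<lambda>h. A' u (fst h) + A x (snd h))) (at (x, u))"
proof (rule has_derivative_transform_within_open[of "\<lambda>p. \<Sum>b\<in>Basis. (snd p \<bullet> b) *\<^sub>R A (fst p) b"])
  have "((\<lambda>p. \<Sum>b\<in>Basis. (snd p \<bullet> b) *\<^sub>R A (fst p) b) has_derivative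
      (\<lambda>h. \<Sum>b\<in>Basis. (u \<bullet> b) *\<^sub>R A' b (fst h) + (snd h \<bullet> b) *\<^sub>R A x b)) (at (x, u))"
    by (auto intro!: derivative_eq_intros has_derivative_compose[OF has_derivative_fst[OF has_derivative_ident]] dA)
  moreover have "(\<Sum>b\<in>Basis. (u \<bullet> b) *\<^sub>R A' b w) = A' u w" for w
    by (rule linear_Basis_expansion[OF linear_derivative_of_operator[OF assms]])
  ultimately show "((\<lambda>p. \<Sum>b\<in>Basis. (snd p \<bullet> b) *\<^sub>R A (fst p) b) has_derivative
      (\<lambda>h. A' u (fst h) + A x (snd h))) (at (x, u))"
    by (simp add: sum.distrib linear_Basis_expansion[OF lin[OF assms(2)]])
  show "open (S \<times> (UNIV :: 'a set))"
    using assms(1) by (simp add: open_Times)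
qed (use assms(2) linear_Basis_expansion[OF lin] in auto)

text \<open>The inverse of the shear \<open>(x, u) \<mapsto> (x, A x u)\<close> is \<open>(x, v) \<mapsto> (x, A\<^sup>-\<^sup>1 x v)\<close>, which reduces the
  derivative of the inverse operators to that of an inverse function.\<close>

lemma has_derivative_inverse_operator:
  fixes A :: "'c::euclidean_space \<Rightarrow> 'a::euclidean_space \<Rightarrow> 'a"
  assumes S: "open S" "x \<in> S" and lin: "\<And>y. y \<in> S \<Longrightarrow> linear (A y)" and bij: "\<And>y. y \<in> S \<Longrightarrow> bij (A y)"
    and dA: "\<And>y u. y \<in> S \<Longrightarrow> ((\<lambda>y. A y u) has_derivative A' y u) (at y)"
  shows "((\<lambda>y. inv (A y) v) has_derivative (\<lambda>w. - inv (A x) (A' x (inv (A x) v) w))) (at x)"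
proof -
  define F where "F p = (fst p, A (fst p) (snd p))" for p
  define G where "G p = (fst p, inv (A (fst p)) (snd p))" for p
  define u where "u = inv (A x) v"
  have inv_apply: "inv (A y) (A y u) = u" "A y (inv (A y) u) = u" if "y \<in> S" for y u
    using bij[OF that] by (simp_all add: bij_is_inj bij_is_surj inv_f_f surj_f_inv_f)
  have lin_inv: "linear (inv (A x))"
    using inj_linear_imp_inv_linear[OF lin[OF S(2)]] bij[OF S(2)] by (simp add: bij_is_inj)
  have dF: "(F has_derivative (\<lambda>h. (fst h, A' (fst p) (snd p) (fst h) + A (fst p) (snd h)))) (at p)"
    if "fst p \<in> S" for p
    unfolding F_def using has_derivative_operator_apply[OF S(1) that lin dA[OF that], of "snd p"]
    by (auto intro!: derivative_intros)
  have "(G has_derivative (\<lambda>h. (fst h, inv (A x) (snd h - A' x u (fst h))))) (at (F (x, u)))"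
  proof (rule has_derivative_inverse_strong[where f=F and S="S \<times> UNIV"])
    show "continuous_on (S \<times> UNIV) F"
      by (intro continuous_at_imp_continuous_on ballI has_derivative_continuous[OF dF]) auto
    show "G (F p) = p" if "p \<in> S \<times> UNIV" for p
      using that by (auto simp: G_def F_def inv_apply)
    show "(F has_derivative (\<lambda>h. (fst h, A' x u (fst h) + A x (snd h)))) (at (x, u))"
      using dF[of "(x, u)"] S(2) by simp
  qed (use S inv_apply in \<open>auto simp: open_Times fun_eq_iff\<close>)
  moreover have "F (x, u) = (x, v)"
    by (simp add: F_def u_def inv_apply[OF S(2)])
  ultimately have "(G has_derivative (\<lambda>h. (fst h, inv (A x) (snd h - A' x u (fst h))))) (at (x, v))"
    by simp
  then have "((\<lambda>y. G (y, v)) has_derivative (\<lambda>w. (w, inv (A x) (0 - A' x u w)))) (at x)"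
    by (rule has_derivative_eq_rhs[OF has_derivative_compose[of "\<lambda>y. (y, v)", rotated]])
       (auto intro!: derivative_eq_intros)
  from has_derivative_snd[OF this] show ?thesis
    unfolding G_def u_def by (simp add: linear_neg[OF lin_inv])
qed

lemma k_smooth_linear_compose:
  assumes "open S" "bounded_linear L" "k_smooth k S f"
  shows "k_smooth k S (\<lambda>x. L (f x))"
  by (rule k_smooth_compose[OF assms(1) open_UNIV _ assms(3) k_smooth_linear[OF assms(2) open_UNIV]]) auto

lemma k_smooth_inverse_operator:
  fixes A :: "'c::euclidean_space \<Rightarrow> 'a::euclidean_space \<Rightarrow> 'a"
  assumes S: "open S" and lin: "\<And>y. y \<in> S \<Longrightarrow> linear (A y)" and bij: "\<And>y. y \<in> S \<Longrightarrow> bij (A y)"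
    and smooth: "\<And>k u. k_smooth k S (\<lambda>y. A y u)"
  shows "k_smooth k S (\<lambda>y. inv (A y) v)"
proof -
  define A' where "A' y u = frechet_derivative (\<lambda>y. A y u) (at y)" for y u
  have dA: "((\<lambda>y. A y u) has_derivative A' y u) (at y)" if "y \<in> S" for y u
    unfolding A'_def by (rule k_smooth_has_derivative[OF smooth S that])
  have smooth': "k_smooth k S (\<lambda>y. A' y u w)" for k u w
    using smooth[of "Suc k"] by (simp add: A'_def)
  have lin_inv: "linear (inv (A y))" if "y \<in> S" for y
    using inj_linear_imp_inv_linear[OF lin] bij that by (simp add: bij_is_inj)
  note d_inv = has_derivative_inverse_operator[OF S _ lin bij dA]
  show ?thesis
  proof (induction k arbitrary: v)
    case 0
    show ?case
      using S by (auto intro!: continuous_at_imp_continuous_on has_derivative_continuous d_inv)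
  next
    case (Suc k)
    show ?case
    proof (rule k_smooth_SucI[OF S d_inv])
      fix w
      have "k_smooth k S (\<lambda>x. A' x (inv (A x) v) w)"
        by (rule k_smooth_apply_operator[where A="\<lambda>x u. A' x u w", OF S
              linear_derivative_of_operator[OF S _ lin dA] smooth' Suc])
      then have "k_smooth k S (\<lambda>x. inv (A x) (A' x (inv (A x) v) w))"
        using k_smooth_apply_operator[where A="\<lambda>x. inv (A x)", OF S lin_inv Suc] by blast
      then show "k_smooth k S (\<lambda>x. - inv (A x) (A' x (inv (A x) v) w))"
        by (rule k_smooth_linear_compose[OF S bounded_linear_minus[OF bounded_linear_ident]])
    qed
  qed
qed

lemma k_smooth_inverse:
  fixes f g :: "'a::euclidean_space \<Rightarrow> 'a"
  assumes f: "open U" "\<And>k. k_smooth k U f" and bij: "\<And>x. x \<in> U \<Longrightarrow> bij (frechet_derivative f (at x))"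
    and g: "open V" "g ` V \<subseteq> U" "\<And>y. y \<in> V \<Longrightarrow> (g has_derivative inv (frechet_derivative f (at (g y)))) (at y)"
  shows "k_smooth k V g"
proof (induction k)
  case 0
  show ?case
    using g by (auto intro!: continuous_at_imp_continuous_on has_derivative_continuous)
next
  case (Suc k)
  have deriv_smooth: "k_smooth k U (\<lambda>x. inv (frechet_derivative f (at x)) v)" for v
  proof (rule k_smooth_inverse_operator[OF f(1) _ bij])
    show "linear (frechet_derivative f (at x))" if "x \<in> U" for x
      by (rule has_derivative_linear[OF k_smooth_has_derivative[OF f(2,1) that]])
    show "k_smooth k U (\<lambda>x. frechet_derivative f (at x) u)" for k u
      using f(2)[of "Suc k"] by simp
  qed
  show ?case
    by (rule k_smooth_SucI[OF g(1,3) k_smooth_compose[OF g(1) f(1) g(2) Suc deriv_smooth]])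
qed

lemma diffeo_between_iff_homeomorphism:
  "diffeo_between f U V \<longleftrightarrow> smooth_on U f \<and> (\<exists>g. smooth_on V g \<and> homeomorphism U V f g)"
proof
  assume "diffeo_between f U V"
  then have f: "bij_betw f U V" "smooth_on U f" "smooth_on V (inv_into U f)"
    by (auto simp: diffeo_between_def)
  then have "continuous_on U f" "continuous_on V (inv_into U f)"
    unfolding smooth_on_iff_k_smooth by (auto intro: k_smooth_imp_continuous_on)
  then have "homeomorphism U V f (inv_into U f)"
    using f(1) bij_betw_inv_into_left[OF f(1)] bij_betw_inv_into_right[OF f(1)] bij_betw_inv_into[OF f(1)]
    by (auto simp: homeomorphism_def bij_betw_def)
  then show "smooth_on U f \<and> (\<exists>g. smooth_on V g \<and> homeomorphism U V f g)"
    using f by blast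
next
  assume "smooth_on U f \<and> (\<exists>g. smooth_on V g \<and> homeomorphism U V f g)"
  then obtain g where f: "smooth_on U f" and g: "smooth_on V g" and fg: "homeomorphism U V f g"
    by blast
  have bij: "bij_betw f U V"
    using fg unfolding homeomorphism_def by (intro bij_betwI[where g=g]) auto
  have "g y = inv_into U f y" if "y \<in> V" for y
    using fg that bij_betw_inv_into_left[OF bij, of "g y"] by (auto simp: homeomorphism_def)
  then have "smooth_on V (inv_into U f)"
    using g k_smooth_cong unfolding smooth_on_iff_k_smooth by blast
  then show "diffeo_between f U V"
    using f g bij by (simp add: diffeo_between_def smooth_on_def)
qed

lemma smooth_on_subset: "smooth_on S f \<Longrightarrow> open T \<Longrightarrow> T \<subseteq> S \<Longrightarrow> smooth_on T f"
  unfolding smooth_on_iff_k_smooth using k_smooth_subset by blast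

lemma smooth_on_compose:
  "smooth_on U f \<Longrightarrow> smooth_on V g \<Longrightarrow> f ` U \<subseteq> V \<Longrightarrow> smooth_on U (\<lambda>x. g (f x))"
  unfolding smooth_on_iff_k_smooth using k_smooth_compose by blast

lemma diffeo_between_compose:
  assumes "diffeo_between f U V" "diffeo_between g V W"
  shows "diffeo_between (\<lambda>x. g (f x)) U W"
proof -
  obtain f' where f: "smooth_on U f" "smooth_on V f'" "homeomorphism U V f f'"
    using assms(1) by (auto simp: diffeo_between_iff_homeomorphism)
  obtain g' where g: "smooth_on V g" "smooth_on W g'" "homeomorphism V W g g'"
    using assms(2) by (auto simp: diffeo_between_iff_homeomorphism)
  have "f ` U \<subseteq> V" "g' ` W \<subseteq> V"
    using f(3) g(3) by (simp_all add: homeomorphism_def)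
  then have "smooth_on U (\<lambda>x. g (f x))" "smooth_on W (\<lambda>y. f' (g' y))"
    using smooth_on_compose f(1,2) g(1,2) by blast+
  moreover have "homeomorphism U W (\<lambda>x. g (f x)) (\<lambda>y. f' (g' y))"
    using homeomorphism_compose[OF f(3) g(3)] by (simp add: o_def)
  ultimately show ?thesis by (auto simp: diffeo_between_iff_homeomorphism)
qed

lemma diffeo_between_restrict:
  assumes "diffeo_between f U V" "open W"
  shows "diffeo_between f (U \<inter> W) (f ` (U \<inter> W))"
proof -
  obtain g where f: "smooth_on U f" and g: "smooth_on V g" and fg: "homeomorphism U V f g"
    using assms(1) by (auto simp: diffeo_between_iff_homeomorphism)
  have "f ` (U \<inter> W) = V \<inter> g -` W"
    using fg by (force simp: homeomorphism_def)
  then have "open (f ` (U \<inter> W))"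
    using continuous_open_preimage[OF homeomorphism_cont2[OF fg] _ assms(2)] g by (simp add: smooth_on_def)
  moreover have "open (U \<inter> W)"
    using f assms(2) by (auto simp: smooth_on_def)
  moreover have "homeomorphism (U \<inter> W) (f ` (U \<inter> W)) f g"
    by (rule homeomorphism_of_subsets[OF fg]) auto
  moreover have "f ` (U \<inter> W) \<subseteq> V"
    using fg by (auto simp: homeomorphism_def)
  ultimately show ?thesis
    unfolding diffeo_between_iff_homeomorphism using smooth_on_subset[OF f] smooth_on_subset[OF g] by blast
qed

theorem smooth_inverse_function:
  fixes f :: "'a::euclidean_space \<Rightarrow> 'a"
  assumes "smooth_at x f" "inj (frechet_derivative f (at x))"
  obtains U V where "x \<in> U" "diffeo_between f U V"
proof -
  obtain S where S: "x \<in> S" "open S" "\<And>k. k_smooth k S f" by (rule smooth_atE[OF assms(1)]) blast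
  define f' where "f' y = Blinfun (frechet_derivative f (at y))" for y
  have df: "(f has_derivative frechet_derivative f (at y)) (at y)" if "y \<in> S" for y
    by (rule k_smooth_has_derivative[OF S(3,2) that])
  have f': "blinfun_apply (f' y) = frechet_derivative f (at y)" if "y \<in> S" for y
    unfolding f'_def by (rule bounded_linear_Blinfun_apply[OF has_derivative_bounded_linear[OF df[OF that]]])
  have "continuous_on S (\<lambda>y. frechet_derivative f (at y) b)" for b
    using S(3)[of "Suc 0"] by simp
  then have "continuous_on S f'"
    by (intro continuous_on_blinfun_componentwise) (simp add: f' cong: continuous_on_cong)
  moreover obtain h where h: "linear h" "h \<circ> frechet_derivative f (at x) = id"
    using linear_injective_left_inverse[OF has_derivative_linear[OF df[OF S(1)]] assms(2)] by blast
  have "Blinfun h o\<^sub>L f' x = id_blinfun"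
    using h S(1) linear_conv_bounded_linear[of h]
    by (intro blinfun_eqI) (simp add: f' bounded_linear_Blinfun_apply fun_eq_iff)
  ultimately obtain U V g g' where U: "open U" "U \<subseteq> S" "x \<in> U" and V: "open V" and fg: "homeomorphism U V f g"
    and g': "\<And>y. y \<in> V \<Longrightarrow> (g has_derivative (g' y)) (at y)" "\<And>y. y \<in> V \<Longrightarrow> g' y = inv (blinfun_apply (f' (g y)))"
    and bij: "\<And>y. y \<in> V \<Longrightarrow> bij (blinfun_apply (f'(g y)))"
    using inverse_function_theorem[of S f f' x "Blinfun h"] df f' S(1,2) by metis
  have f_smooth: "k_smooth k U f" for k
    by (rule k_smooth_subset[OF S(3) U(2)])
  have "k_smooth k V g" for k
  proof (rule k_smooth_inverse[OF U(1) f_smooth _ V])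
    show "bij (frechet_derivative f (at y))" if "y \<in> U" for y
      using bij[of "f y"] U(2) fg that f'[of y] unfolding homeomorphism_def by auto
    show "g ` V \<subseteq> U" using fg by (simp add: homeomorphism_def)
    then show "(g has_derivative inv (frechet_derivative f (at (g y)))) (at y)" if "y \<in> V" for y
      using g'[OF that] f'[of "g y"] U(2) that by (simp add: image_subset_iff subset_iff)
  qed
  then show ?thesis
    using that[OF U(3)] f_smooth U(1) V fg unfolding diffeo_between_iff_homeomorphism smooth_on_iff_k_smooth by blast
qed

definition local_diffeo_at :: "'a::euclidean_space \<Rightarrow> ('a \<Rightarrow> 'b::euclidean_space) \<Rightarrow> bool" where
  "local_diffeo_at x f \<longleftrightarrow> smooth_at x f \<and> inj (frechet_derivative f (at x))"

lemma local_diffeo_atI: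
  assumes "smooth_at x f" "(f has_derivative f') (at x)" "\<And>h. f' h = 0 \<Longrightarrow> h = 0"
  shows "local_diffeo_at x f"
  unfolding local_diffeo_at_def
  using assms frechet_derivative_at[OF assms(2)] linear_injective_0[OF has_derivative_linear[OF assms(2)]]
  by metis

lemma local_diffeo_atE:
  assumes "local_diffeo_at x f"
  obtains f' where "smooth_at x f" "(f has_derivative f') (at x)" "\<And>h. f' h = 0 \<Longrightarrow> h = 0"
proof -
  have df: "(f has_derivative frechet_derivative f (at x)) (at x)"
    using assms smooth_at_has_derivative unfolding local_diffeo_at_def by blast
  then show ?thesis
    using that[OF _ df] assms linear_injective_0[OF has_derivative_linear[OF df]]
    unfolding local_diffeo_at_def by blast
qed

lemma local_diffeo_at_compose:
  assumes "local_diffeo_at x f" "local_diffeo_at (f x) g"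
  shows "local_diffeo_at x (\<lambda>y. g (f y))"
proof -
  obtain f' where f: "smooth_at x f" "(f has_derivative f') (at x)" "\<And>h. f' h = 0 \<Longrightarrow> h = 0"
    by (rule local_diffeo_atE[OF assms(1)]) blast
  obtain g' where g: "smooth_at (f x) g" "(g has_derivative g') (at (f x))" "\<And>h. g' h = 0 \<Longrightarrow> h = 0"
    by (rule local_diffeo_atE[OF assms(2)]) blast
  show ?thesis
    by (rule local_diffeo_atI[OF smooth_at_compose[OF f(1) g(1)] has_derivative_compose[OF f(2) g(2)]])
       (use f(3) g(3) in blast)
qed

lemma local_diffeo_at_linear:
  "bounded_linear L \<Longrightarrow> (\<And>h. L h = 0 \<Longrightarrow> h = 0) \<Longrightarrow> local_diffeo_at x L"
  using local_diffeo_atI[OF smooth_at_linear bounded_linear_imp_has_derivative] .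

lemma diffeo_between_linear_isomorphism:
  assumes L: "bounded_linear L" "bounded_linear L'" "\<And>x. L' (L x) = x" "\<And>y. L (L' y) = y" and "open V"
  shows "diffeo_between L V (L ` V)"
proof -
  have image: "L ` V = L' -` V"
    by (auto simp: L image_iff) (metis L(4))
  have "open (L' -` V)"
    using continuous_open_vimage[OF assms(5)] linear_continuous_at[OF L(2)] by blast
  then have "smooth_on V L" "smooth_on (L ` V) L'"
    using assms by (simp_all add: image smooth_on_iff_k_smooth k_smooth_linear)
  moreover have "homeomorphism V (L ` V) L L'"
    by (rule homeomorphismI) (use L in \<open>auto intro: linear_continuous_on\<close>)
  ultimately show ?thesis by (auto simp: diffeo_between_iff_homeomorphism)
qed

theorem local_diffeo_at_imp_diffeo_between:
  fixes f :: "'a::euclidean_space \<Rightarrow> 'b::euclidean_space"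
  assumes "local_diffeo_at x f" "DIM('a) = DIM('b)" "open W" "x \<in> W"
  obtains U V where "x \<in> U" "U \<subseteq> W" "diffeo_between f U V"
proof -
  obtain L :: "'b \<Rightarrow> 'a" and L' where "linear L" "linear L'" and inverse: "\<And>x. L' (L x) = x" "\<And>y. L (L' y) = y"
    by (rule isomorphisms_UNIV_UNIV[OF assms(2)[symmetric]]) metis
  then have L: "bounded_linear L" "bounded_linear L'"
    by (auto simp: linear_conv_bounded_linear)
  have "local_diffeo_at (f x) L"
    by (rule local_diffeo_at_linear[OF L(1)]) (metis inverse(1) \<open>linear L'\<close> linear_0)
  then have "local_diffeo_at x (\<lambda>y. L (f y))"
    by (rule local_diffeo_at_compose[OF assms(1)])
  then obtain U V where U: "x \<in> U" "diffeo_between (\<lambda>y. L (f y)) U V"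
    using smooth_inverse_function unfolding local_diffeo_at_def by blast
  then have "diffeo_between (\<lambda>y. L' (L (f y))) U (L' ` V)"
    using diffeo_between_compose diffeo_between_linear_isomorphism[OF L(2,1) inverse(2,1)]
    by (metis diffeo_between_def)
  then have "diffeo_between f (U \<inter> W) (f ` (U \<inter> W))"
    using diffeo_between_restrict[OF _ assms(3)] by (simp add: inverse)
  then show ?thesis
    using that[of "U \<inter> W"] U(1) assms(4) by blast
qed

theorem local_diffeo_at_inverse:
  fixes f :: "'a::euclidean_space \<Rightarrow> 'b::euclidean_space"
  assumes "local_diffeo_at x f" "(f has_derivative f') (at x)" "DIM('a) = DIM('b)"
  obtains g g' where "smooth_at (f x) g" "g (f x) = x" "(g has_derivative g') (at (f x))" "\<And>h. f' (g' h) = h"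
    "\<forall>\<^sub>F y in nhds (f x). f (g y) = y"
proof -
  obtain U V where U: "x \<in> U" "diffeo_between f U V"
    using local_diffeo_at_imp_diffeo_between[OF assms(1,3) open_UNIV UNIV_I] by metis
  obtain g where g: "smooth_on V g" and fg: "homeomorphism U V f g"
    using U(2) unfolding diffeo_between_iff_homeomorphism by blast
  have V: "open V" "f x \<in> V"
    using g fg U(1) by (auto simp: smooth_on_def homeomorphism_def)
  have left: "g (f x) = x" and right: "f (g y) = y" if "y \<in> V" for y
    using fg U(1) that by (auto simp: homeomorphism_def)
  have g_smooth: "smooth_at (f x) g"
    unfolding smooth_at_def using g V(2) by blast
  define g' where "g' = frechet_derivative g (at (f x))"
  have dg: "(g has_derivative g') (at (f x))"
    unfolding g'_def by (rule smooth_at_has_derivative[OF g_smooth])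
  have "((\<lambda>y. f (g y)) has_derivative (\<lambda>h. f' (g' h))) (at (f x))"
    using has_derivative_compose[OF dg, of f f'] assms(2) left[OF V(2)] by simp
  then have "((\<lambda>y. y) has_derivative (\<lambda>h. f' (g' h))) (at (f x))"
    by (rule has_derivative_transform_within_open[OF _ V]) (rule right)
  then have "(\<lambda>h. f' (g' h)) = (\<lambda>h. h)"
    using has_derivative_unique[OF _ has_derivative_ident] by blast
  moreover have "\<forall>\<^sub>F y in nhds (f x). f (g y) = y"
    using V right unfolding eventually_nhds by blast
  ultimately show ?thesis
    using that[OF g_smooth left[OF V(2)] dg] by meson
qed

theorem smooth_implicit_function:
  fixes F :: "'a::euclidean_space \<times> 'b::euclidean_space \<Rightarrow> 'a"
  assumes F: "smooth_at (s\<^sub>0, w\<^sub>0) F" "(F has_derivative F') (at (s\<^sub>0, w\<^sub>0))"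
    and partial: "\<And>s. F' (s, 0) = 0 \<Longrightarrow> s = 0"
  obtains S S' where "smooth_at w\<^sub>0 S" "S w\<^sub>0 = s\<^sub>0" "(S has_derivative S') (at w\<^sub>0)" "\<And>h. F' (S' h, h) = 0"
    "\<forall>\<^sub>F w in nhds w\<^sub>0. F (S w, w) = F (s\<^sub>0, w\<^sub>0)"
proof -
  define c where "c = F (s\<^sub>0, w\<^sub>0)"
  define G where "G y = (F y, snd y)" for y
  have dG: "(G has_derivative (\<lambda>h. (F' h, snd h))) (at (s\<^sub>0, w\<^sub>0))"
    unfolding G_def by (intro derivative_intros F)
  have G_diffeo: "local_diffeo_at (s\<^sub>0, w\<^sub>0) G"
  proof (rule local_diffeo_atI[OF _ dG])
    show "smooth_at (s\<^sub>0, w\<^sub>0) G"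
      unfolding G_def by (intro smooth_intros F)
  qed (use partial in \<open>auto simp: prod_eq_iff\<close>)
  obtain B B' where B: "smooth_at (c, w\<^sub>0) B" "B (c, w\<^sub>0) = (s\<^sub>0, w\<^sub>0)" "(B has_derivative B') (at (c, w\<^sub>0))"
    and GB': "\<And>h. (F' (B' h), snd (B' h)) = h" and GB: "\<forall>\<^sub>F y in nhds (c, w\<^sub>0). G (B y) = y"
    by (rule local_diffeo_at_inverse[OF G_diffeo dG refl]) (auto simp: G_def c_def)
  show ?thesis
  proof
    show "smooth_at w\<^sub>0 (\<lambda>w. fst (B (c, w)))"
      by (intro smooth_intros smooth_at_compose[where g=B and f="\<lambda>w. (c, w)"] B)
    show "((\<lambda>w. fst (B (c, w))) has_derivative (\<lambda>h. fst (B' (0, h)))) (at w\<^sub>0)"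
      by (rule has_derivative_fst, rule has_derivative_compose[of "\<lambda>w. (c, w)", OF _ B(3)])
         (auto intro!: derivative_eq_intros)
    show "F' (fst (B' (0, h)), h) = 0" for h
      using GB'[of "(0, h)"] by (metis prod.collapse prod.inject)
    have "\<forall>\<^sub>F w in nhds w\<^sub>0. G (B (c, w)) = (c, w)"
      by (rule eventually_nhds_isCont[where f="\<lambda>w. (c, w)"]) (use GB in \<open>auto intro!: continuous_intros\<close>)
    then show "\<forall>\<^sub>F w in nhds w\<^sub>0. F (fst (B (c, w)), w) = F (s\<^sub>0, w\<^sub>0)"
      by eventually_elim (metis G_def c_def prod.collapse prod.inject)
  qed (simp add: B(2))
qed

text \<open>\<open>germ_equiv g x h y\<close>: the germs of \<open>g\<close> at \<open>x\<close> and of \<open>h\<close> at \<open>y\<close> are right-left equivalent.\<close>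

definition germ_equiv :: "('a::euclidean_space \<Rightarrow> 'b::euclidean_space) \<Rightarrow> 'a
    \<Rightarrow> ('c::euclidean_space \<Rightarrow> 'd::euclidean_space) \<Rightarrow> 'c \<Rightarrow> bool" where
  "germ_equiv g x h y \<longleftrightarrow> (\<exists>\<phi> \<psi>. local_diffeo_at x \<phi> \<and> \<phi> x = y \<and> local_diffeo_at (g x) \<psi>
     \<and> (\<forall>\<^sub>F x' in nhds x. \<psi> (g x') = h (\<phi> x')))"

lemma germ_equivI:
  assumes "local_diffeo_at x \<phi>" "\<phi> x = y" "local_diffeo_at (g x) \<psi>" "\<forall>\<^sub>F x' in nhds x. \<psi> (g x') = h (\<phi> x')"
  shows "germ_equiv g x h y"
  unfolding germ_equiv_def using assms by blast

lemma germ_equiv_trans: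
  assumes "germ_equiv g x h y" "germ_equiv h y k z"
  shows "germ_equiv g x k z"
proof -
  obtain \<phi> \<psi> where gh: "local_diffeo_at x \<phi>" "\<phi> x = y" "local_diffeo_at (g x) \<psi>"
      "\<forall>\<^sub>F x' in nhds x. \<psi> (g x') = h (\<phi> x')"
    using assms(1) unfolding germ_equiv_def by blast
  obtain \<phi>' \<psi>' where hk: "local_diffeo_at y \<phi>'" "\<phi>' y = z" "local_diffeo_at (h y) \<psi>'"
      "\<forall>\<^sub>F y' in nhds y. \<psi>' (h y') = k (\<phi>' y')"
    using assms(2) unfolding germ_equiv_def by blast
  have hy: "\<psi> (g x) = h y"
    using eventually_nhds_x_imp_x[OF gh(4)] gh(2) by simp
  have "isCont \<phi> x"
    using gh(1) smooth_at_isCont unfolding local_diffeo_at_def by blast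
  then have "\<forall>\<^sub>F x' in nhds x. \<psi>' (h (\<phi> x')) = k (\<phi>' (\<phi> x'))"
    by (rule eventually_nhds_isCont) (simp add: gh(2) hk(4))
  with gh(4) have "\<forall>\<^sub>F x' in nhds x. \<psi>' (\<psi> (g x')) = k (\<phi>' (\<phi> x'))"
    by eventually_elim simp
  then show ?thesis
    by (rule germ_equivI[rotated 3]) (use gh hk hy in \<open>simp_all add: local_diffeo_at_compose\<close>)
qed

lemma has_local_form_if_germ_equiv:
  assumes "germ_equiv g x N 0" "N 0 = 0" "isCont g x"
  shows "has_local_form g N x"
proof -
  obtain \<phi> \<psi> where \<phi>: "local_diffeo_at x \<phi>" "\<phi> x = 0" and \<psi>: "local_diffeo_at (g x) \<psi>"
    and eq: "\<forall>\<^sub>F y in nhds x. \<psi> (g y) = N (\<phi> y)"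
    using assms(1) unfolding germ_equiv_def by blast
  obtain W W' where W: "g x \<in> W" "diffeo_between \<psi> W W'"
    using local_diffeo_at_imp_diffeo_between[OF \<psi> _ open_UNIV UNIV_I] by auto
  then have "\<forall>\<^sub>F y in nhds (g x). y \<in> W"
    by (intro eventually_nhds_in_open) (auto simp: diffeo_between_def)
  then have "\<forall>\<^sub>F y in nhds x. g y \<in> W"
    by (rule eventually_nhds_isCont[OF assms(3)])
  with eq have "\<forall>\<^sub>F y in nhds x. g y \<in> W \<and> \<psi> (g y) = N (\<phi> y)" by eventually_elim blast
  then obtain X where X: "open X" "x \<in> X" "\<And>y. y \<in> X \<Longrightarrow> g y \<in> W \<and> \<psi> (g y) = N (\<phi> y)"
    unfolding eventually_nhds by blast
  obtain U V where "x \<in> U" "U \<subseteq> X" "diffeo_between \<phi> U V"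
    using local_diffeo_at_imp_diffeo_between[OF \<phi>(1) _ X(1,2)] by auto
  then show ?thesis
    unfolding has_local_form_def using W \<phi>(2) assms(2) X(2,3)
    by (intro exI[of _ U] exI[of _ V] exI[of _ \<phi>] exI[of _ W] exI[of _ W'] exI[of _ \<psi>]) auto
qed

section \<open>Parameter integrals\<close>

lemma has_derivative_integral_parameter:
  fixes f :: "'a::euclidean_space \<Rightarrow> 'n::euclidean_space \<Rightarrow> 'b::euclidean_space"
  assumes U: "open U" "x \<in> U"
    and df: "\<And>y t. y \<in> U \<Longrightarrow> t \<in> cbox a b \<Longrightarrow> ((\<lambda>y. f y t) has_derivative D y t) (at y)"
    and cont_f: "\<And>y. y \<in> U \<Longrightarrow> continuous_on (cbox a b) (f y)"
    and cont_D: "\<And>v. continuous_on (U \<times> cbox a b) (\<lambda>p. D (fst p) (snd p) v)"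
  shows "((\<lambda>y. integral (cbox a b) (f y)) has_derivative (\<lambda>v. integral (cbox a b) (\<lambda>t. D x t v))) (at x)"
proof -
  obtain e where e: "e > 0" "ball x e \<subseteq> U" using U by (meson openE)
  define D' where "D' y t = Blinfun (D y t)" for y t
  have D': "blinfun_apply (D' y t) = D y t" if "y \<in> U" "t \<in> cbox a b" for y t
    unfolding D'_def by (rule bounded_linear_Blinfun_apply[OF has_derivative_bounded_linear[OF df[OF that]]])
  have cont_D': "continuous_on (U \<times> cbox a b) (\<lambda>(y, t). D' y t)"
    by (rule continuous_on_blinfun_componentwise, rule continuous_on_eq[OF cont_D]) (auto simp: D')
  have "((\<lambda>y. integral (cbox a b) (f y)) has_derivative integral (cbox a b) (D' x)) (at x within ball x e)"
  proof (rule leibniz_rule)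
    show "((\<lambda>y. f y t) has_derivative blinfun_apply (D' y t)) (at y within ball x e)"
      if "y \<in> ball x e" "t \<in> cbox a b" for y t
      using has_derivative_at_withinI[OF df[of y t]] D'[of y t] subsetD[OF e(2)] that by simp
    show "continuous_on (ball x e \<times> cbox a b) (\<lambda>(y, t). D' y t)"
      by (rule continuous_on_subset[OF cont_D']) (use e(2) in auto)
  qed (use e cont_f in \<open>auto intro!: integrable_continuous\<close>)
  then have "((\<lambda>y. integral (cbox a b) (f y)) has_derivative integral (cbox a b) (D' x)) (at x)"
    using e(1) by (simp add: at_within_open_NO_MATCH)
  moreover have "blinfun_apply (integral (cbox a b) (D' x)) v = integral (cbox a b) (\<lambda>t. D x t v)" for v
  proof -
    have "continuous_on (cbox a b) (\<lambda>t. case (x, t) of (y, t) \<Rightarrow> D' y t)"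
      by (rule continuous_on_compose2[OF cont_D']) (use U(2) in \<open>auto intro!: continuous_intros\<close>)
    then have "D' x integrable_on cbox a b"
      by (simp add: integrable_continuous)
    from integral_linear[OF this blinfun.bounded_linear_left[of v]]
    have "blinfun_apply (integral (cbox a b) (D' x)) v = integral (cbox a b) (\<lambda>t. blinfun_apply (D' x t) v)"
      by (simp add: o_def)
    also have "\<dots> = integral (cbox a b) (\<lambda>t. D x t v)"
      by (intro integral_cong) (simp add: D'[OF U(2)])
    finally show ?thesis .
  qed
  ultimately show ?thesis
    by (auto elim!: has_derivative_eq_rhs)
qed

lemma has_derivative_parametric_integral:
  fixes H :: "'a::euclidean_space \<times> 'n::euclidean_space \<Rightarrow> 'b::euclidean_space"
  assumes U: "open U" "open W" "U \<times> cbox a b \<subseteq> W" and H: "k_smooth (Suc 0) W H" and x: "x \<in> U"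
  shows "((\<lambda>x. integral (cbox a b) (\<lambda>t. H (x, t))) has_derivative
           (\<lambda>v. integral (cbox a b) (\<lambda>t. frechet_derivative H (at (x, t)) (v, 0)))) (at x)"
proof (rule has_derivative_integral_parameter[OF U(1) x])
  show "((\<lambda>y. H (y, t)) has_derivative (\<lambda>v. frechet_derivative H (at (y, t)) (v, 0))) (at y)"
    if "y \<in> U" "t \<in> cbox a b" for y t
    by (rule has_derivative_compose[of "\<lambda>y. (y, t)", OF _ k_smooth_has_derivative[OF H U(2)]])
       (use U(3) that in \<open>auto intro!: derivative_eq_intros\<close>)
  show "continuous_on (cbox a b) (\<lambda>t. H (y, t))" if "y \<in> U" for y
    by (rule continuous_on_compose2[OF k_smooth_imp_continuous_on[OF H]])
       (use U(3) that in \<open>auto intro!: continuous_intros\<close>)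
  have "continuous_on W (\<lambda>p. frechet_derivative H (at p) (v, 0))" for v
    using H by simp
  then show "continuous_on (U \<times> cbox a b) (\<lambda>p. frechet_derivative H (at (fst p, snd p)) (v, 0))" for v
    by (simp add: continuous_on_subset[OF _ U(3)])
qed

lemma k_smooth_parametric_integral:
  fixes H :: "'a::euclidean_space \<times> 'n::euclidean_space \<Rightarrow> 'b::euclidean_space"
  assumes "open U" "open W" "U \<times> cbox a b \<subseteq> W" "\<And>k. k_smooth k W H"
  shows "k_smooth k U (\<lambda>x. integral (cbox a b) (\<lambda>t. H (x, t)))"
  using assms(4)
proof (induction k arbitrary: H)
  case 0
  show ?case
    unfolding k_smooth.simps
    by (intro continuous_at_imp_continuous_on ballI
        has_derivative_continuous[OF has_derivative_parametric_integral[OF assms(1-3) 0]])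
next
  case (Suc k)
  show ?case
  proof (rule k_smooth_SucI[OF assms(1) has_derivative_parametric_integral[OF assms(1-3) Suc.prems]])
    show "k_smooth k U (\<lambda>x. integral (cbox a b) (\<lambda>t. frechet_derivative H (at (x, t)) (v, 0)))" for v
      by (rule Suc.IH) (metis Suc.prems k_smooth.simps(2))
  qed
qed

lemma smooth_at_parametric_integral:
  fixes H :: "'a::euclidean_space \<times> 'n::euclidean_space \<Rightarrow> 'b::euclidean_space"
  assumes "\<And>t. t \<in> cbox a b \<Longrightarrow> smooth_at (x, t) H"
  shows "smooth_at x (\<lambda>x. integral (cbox a b) (\<lambda>t. H (x, t)))"
proof -
  define W where "W = {p. smooth_at p H}"
  have "open W"
    unfolding W_def open_subopen[of "{p. smooth_at p H}"]
    by (auto simp: smooth_at_def smooth_on_iff_k_smooth)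
  then have "smooth_on W H"
    by (simp add: smooth_on_iff_smooth_at W_def)
  then have H: "k_smooth k W H" for k
    by (simp add: smooth_on_iff_k_smooth)
  obtain U where U: "x \<in> U" "open U" "U \<times> cbox a b \<subseteq> W"
    using Elementary_Topology.tube_lemma[OF compact_cbox \<open>open W\<close>, of x a b] assms by (auto simp: W_def)
  show ?thesis
    by (rule smooth_atI[OF U(1,2) k_smooth_parametric_integral[OF U(2) \<open>open W\<close> U(3) H]])
qed

definition circle_mean :: "real \<Rightarrow> (complex \<Rightarrow> complex) \<Rightarrow> complex" where
  "circle_mean r F = contour_integral (circlepath 0 r) F / (2 * of_real pi * \<i>)"

lemma has_contour_integral_circle_mean:
  assumes "r > 0" "continuous_on (sphere 0 r) F"
  shows "(F has_contour_integral 2 * of_real pi * \<i> * circle_mean r F) (circlepath 0 r)"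
  using contour_integrable_continuous_circlepath[of 0 r F] assms has_contour_integral_integral
  by (simp add: circle_mean_def)

lemma circle_mean_Cauchy:
  assumes "K holomorphic_on ball 0 R" "0 < r" "r < R" "norm x < r"
  shows "circle_mean r (\<lambda>w. K w / (w - x) ^ Suc k) = (deriv ^^ k) K x / fact k"
proof -
  have "contour_integral (circlepath 0 r) (\<lambda>w. K w / (w - x) ^ Suc k) = (2 * pi * \<i>) * (deriv ^^ k) K x / fact k"
    by (rule Cauchy_contour_integral_circlepath)
       (use assms in \<open>auto intro!: holomorphic_on_imp_continuous_on holomorphic_on_subset[OF assms(1)]\<close>)
  then show ?thesis
    by (simp add: circle_mean_def)
qed

lemma smooth_at_circle_mean:
  fixes H :: "'a::euclidean_space \<times> complex \<Rightarrow> complex"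
  assumes "r \<ge> 0" "\<And>w. w \<in> sphere 0 r \<Longrightarrow> smooth_at (y, w) H"
  shows "smooth_at y (\<lambda>y. circle_mean r (\<lambda>w. H (y, w)))"
proof -
  define c where "c t = of_real r * exp (2 * of_real pi * \<i> * of_real t)" for t
  have "smooth_at y (\<lambda>y. integral (cbox 0 1) (\<lambda>t. H (fst (y, t), c (snd (y, t))) * c (snd (y, t))))"
  proof (rule smooth_at_parametric_integral)
    fix t :: real
    have c: "smooth_at (y, t) (\<lambda>p. c (snd p))"
      unfolding c_def by (intro smooth_intros smooth_at_analytic_compose[where h=exp] analytic_intros)
    have "smooth_at (y, c t) H"
      using assms by (simp add: c_def norm_mult)
    then have "smooth_at (y, t) (\<lambda>p. H (fst p, c (snd p)))"
      by (intro smooth_at_compose[where g=H and f="\<lambda>p. (fst p, c (snd p))"] smooth_at_Pair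
          smooth_at_linear[OF bounded_linear_fst] c) simp
    then show "smooth_at (y, t) (\<lambda>p. H (fst p, c (snd p)) * c (snd p))"
      by (intro smooth_intros c)
  qed
  moreover have "circle_mean r F = integral {0..1} (\<lambda>t. F (c t) * c t)" for F
  proof -
    have "contour_integral (circlepath 0 r) F = integral {0..1} (\<lambda>t. 2 * of_real pi * \<i> * (F (c t) * c t))"
      unfolding contour_integral_integral vector_derivative_circlepath
      by (simp add: circlepath c_def mult_ac)
    then show ?thesis
      by (simp only: circle_mean_def integral_mult_right) simp
  qed
  ultimately show ?thesis by simp
qed

section \<open>Division by a monic polynomial\<close>

definition monic_poly :: "nat \<Rightarrow> (nat \<Rightarrow> real) \<Rightarrow> 'a::{real_algebra_1,comm_ring_1} \<Rightarrow> 'a" where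
  "monic_poly d a w = w ^ d - (\<Sum>i<d. of_real (a i) * w ^ i)"

lemma monic_poly_of_real: "monic_poly d a (complex_of_real x) = of_real (monic_poly d a x)"
  by (simp add: monic_poly_def)

lemma monic_poly_diff:
  fixes w x :: complex
  assumes "w \<noteq> 0"
  shows "monic_poly d a w - monic_poly d a x
    = (w - x) * (\<Sum>j<d. x ^ j * ((monic_poly d a w + (\<Sum>i\<le>j. of_real (a i) * w ^ i)) / w ^ Suc j))"
proof -
  define T where "T j = (monic_poly d a w + (\<Sum>i<j. of_real (a i) * w ^ i)) * (x / w) ^ j" for j
  have "(w - x) * (x ^ j * ((monic_poly d a w + (\<Sum>i\<le>j. of_real (a i) * w ^ i)) / w ^ Suc j))
      = of_real (a j) * x ^ j + (T j - T (Suc j))" for j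
    unfolding T_def lessThan_Suc_atMost[symmetric]
    using assms by (simp add: power_divide field_simps)
  then have "(w - x) * (\<Sum>j<d. x ^ j * ((monic_poly d a w + (\<Sum>i\<le>j. of_real (a i) * w ^ i)) / w ^ Suc j))
      = (\<Sum>j<d. of_real (a j) * x ^ j) + (T 0 - T d)"
    by (simp add: sum_distrib_left sum.distrib sum_lessThan_telescope' del: sum.atMost_Suc)
  also have "T 0 - T d = monic_poly d a w - x ^ d"
    using assms by (simp_all add: T_def monic_poly_def power_divide)
  finally show ?thesis
    by (simp add: monic_poly_def)
qed

lemma Cauchy_kernel_division:
  fixes w x :: complex
  assumes nz: "w \<noteq> 0" "w \<noteq> x" "monic_poly d a w \<noteq> 0"
  shows "k / (w - x) = monic_poly d a x * (k / (monic_poly d a w * (w - x)))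
    + (\<Sum>j<d. x ^ j * (k / w ^ Suc j + (\<Sum>i\<le>j. of_real (a i) * (k / (monic_poly d a w * w ^ Suc (j - i))))))"
proof -
  let ?P = "monic_poly d a :: complex \<Rightarrow> complex"
  let ?R = "\<Sum>j<d. x ^ j * (k / w ^ Suc j + (\<Sum>i\<le>j. of_real (a i) * (k / (?P w * w ^ Suc (j - i)))))"
  have "k / ?P w * ((?P w + (\<Sum>i\<le>j. of_real (a i) * w ^ i)) / w ^ Suc j)
      = k / w ^ Suc j + (\<Sum>i\<le>j. of_real (a i) * (k / (?P w * w ^ Suc (j - i))))" for j
  proof -
    have "of_real (a i) * (k / (?P w * w ^ Suc (j - i))) = k / ?P w * (of_real (a i) * w ^ i / w ^ Suc j)"
      if "i \<le> j" for i
    proof -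
      have "w ^ Suc j = w ^ Suc (j - i) * w ^ i"
        using that by (simp flip: power_add)
      then show ?thesis
        using nz by (simp add: field_simps)
    qed
    then have "(\<Sum>i\<le>j. of_real (a i) * (k / (?P w * w ^ Suc (j - i))))
        = k / ?P w * ((\<Sum>i\<le>j. of_real (a i) * w ^ i) / w ^ Suc j)"
      unfolding sum_divide_distrib sum_distrib_left by (intro sum.cong) simp_all
    then show ?thesis
      using nz(3) by (simp only: add_divide_distrib distrib_left) simp
  qed
  then have "?R = k / ?P w * (\<Sum>j<d. x ^ j * ((?P w + (\<Sum>i\<le>j. of_real (a i) * w ^ i)) / w ^ Suc j))"
    unfolding sum_distrib_left by (simp only: mult.left_commute)
  then have "k / ?P w * (?P w - ?P x) = (w - x) * ?R"
    unfolding monic_poly_diff[OF nz(1)] by (simp only: mult.left_commute)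
  moreover have "k / (w - x) - ?P x * (k / (?P w * (w - x))) = k / ?P w * (?P w - ?P x) / (w - x)"
    using nz(3) by (simp add: right_diff_distrib diff_divide_distrib mult.commute)
  ultimately have "k / (w - x) - ?P x * (k / (?P w * (w - x))) = (w - x) * ?R / (w - x)"
    by (simp only:)
  also have "\<dots> = ?R"
    using nz(2) by (intro nonzero_mult_div_cancel_left) simp
  finally show ?thesis
    by (simp only: diff_eq_eq add.commute)
qed

definition cauchy_quotient :: "(complex \<Rightarrow> complex) \<Rightarrow> real \<Rightarrow> nat \<Rightarrow> (nat \<Rightarrow> real) \<Rightarrow> nat \<Rightarrow> real \<Rightarrow> complex" where
  "cauchy_quotient K r d a j x = circle_mean r (\<lambda>w. K w / (monic_poly d a w * w ^ j * (w - of_real x)))"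

lemma smooth_at_cauchy_quotient:
  fixes a :: "'p::euclidean_space \<Rightarrow> nat \<Rightarrow> real" and x :: "'p \<Rightarrow> real"
  assumes K: "K holomorphic_on ball 0 R" and r: "0 < r" "r < R"
    and a: "\<And>i. smooth_at y (\<lambda>y. a y i)" and x: "smooth_at y x" "\<bar>x y\<bar> < r"
    and P: "\<And>w :: complex. w \<in> sphere 0 r \<Longrightarrow> monic_poly d (a y) w \<noteq> 0"
  shows "smooth_at y (\<lambda>y. cauchy_quotient K r d (a y) j (x y))"
proof -
  let ?H = "\<lambda>p. K (snd p) / (monic_poly d (a (fst p)) (snd p) * snd p ^ j * (snd p - of_real (x (fst p))))"
  have "smooth_at y (\<lambda>y. circle_mean r (\<lambda>w. ?H (y, w)))"
  proof (rule smooth_at_circle_mean)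
    fix w :: complex assume w: "w \<in> sphere 0 r"
    have "K analytic_on {w}"
      using w r(2) by (intro analytic_on_subset[OF analytic_on_open[THEN iffD2, OF open_ball K]]) auto
    then have K': "smooth_at (y, w) (\<lambda>p. K (snd p))"
      by (intro smooth_at_analytic_compose[where h=K]) (auto intro!: smooth_intros)
    have a': "smooth_at (y, w) (\<lambda>p. a (fst p) i)" for i
      by (rule smooth_at_compose[of _ fst "\<lambda>y. a y i"]) (auto intro!: smooth_intros a)
    have x': "smooth_at (y, w) (\<lambda>p. x (fst p))"
      by (rule smooth_at_compose[of _ fst x]) (auto intro!: smooth_intros x(1))
    have "w \<noteq> 0" "w \<noteq> of_real (x y)"
      using w r x(2) by auto
    then show "smooth_at (y, w) ?H"
      unfolding monic_poly_def
      by (intro smooth_intros K' a' x') (use P[OF w] in \<open>auto simp: monic_poly_def\<close>)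
  qed (use r in simp)
  then show ?thesis
    by (simp add: cauchy_quotient_def)
qed

definition division_remainder :: "(complex \<Rightarrow> complex) \<Rightarrow> real \<Rightarrow> nat \<Rightarrow> (nat \<Rightarrow> real) \<Rightarrow> nat \<Rightarrow> complex" where
  "division_remainder K r d a j =
     (deriv ^^ j) K 0 / fact j + (\<Sum>i\<le>j. of_real (a i) * cauchy_quotient K r d a (j - i) 0)"

lemma has_contour_integral_cauchy_quotient:
  assumes "continuous_on (sphere 0 r) K" "\<bar>x\<bar> < r"
    and "\<And>w :: complex. w \<in> sphere 0 r \<Longrightarrow> monic_poly d a w \<noteq> 0"
  shows "((\<lambda>w. K w / (monic_poly d a w * w ^ j * (w - of_real x)))
    has_contour_integral 2 * of_real pi * \<i> * cauchy_quotient K r d a j x) (circlepath 0 r)"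
  unfolding cauchy_quotient_def
proof (rule has_contour_integral_circle_mean)
  show "r > 0"
    using assms(2) by linarith
  then have "w \<noteq> 0" "w \<noteq> of_real x" if "w \<in> sphere 0 r" for w :: complex
    using that assms(2) by auto
  then show "continuous_on (sphere 0 r) (\<lambda>w. K w / (monic_poly d a w * w ^ j * (w - of_real x)))"
    by (intro continuous_intros assms(1)) (use assms(3) in \<open>auto intro!: continuous_intros simp: monic_poly_def\<close>)
qed

theorem monic_poly_division:
  assumes K: "K holomorphic_on ball 0 R" and r: "0 < r" "r < R" and x: "\<bar>x\<bar> < r"
    and P: "\<And>w :: complex. w \<in> sphere 0 r \<Longrightarrow> monic_poly d a w \<noteq> 0"
  shows "K (of_real x) = of_real (monic_poly d a x) * cauchy_quotient K r d a 0 x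
    + (\<Sum>j<d. of_real (x ^ j) * division_remainder K r d a j)"
proof -
  let ?P = "monic_poly d a :: complex \<Rightarrow> complex" and ?x = "complex_of_real x"
  define M where "M j y w = K w / (?P w * w ^ j * (w - of_real y))" for j y w
  define T where "T j w = K w / (w - 0) ^ Suc j" for j w
  define C where "C = 2 * complex_of_real pi * \<i>"
  have cont_K: "continuous_on (cball 0 r) K"
    by (intro holomorphic_on_imp_continuous_on holomorphic_on_subset[OF K]) (use r in auto)
  have M: "(M j y has_contour_integral C * cauchy_quotient K r d a j y) (circlepath 0 r)" if "\<bar>y\<bar> < r" for j y
    unfolding M_def C_def
    by (rule has_contour_integral_cauchy_quotient[OF continuous_on_subset[OF cont_K sphere_cball] that P])
  have hol_K: "K holomorphic_on ball 0 r"
    by (rule holomorphic_on_subset[OF K]) (use r in auto)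
  have Cauchy: "((\<lambda>w. K w / (w - y) ^ Suc j) has_contour_integral C * ((deriv ^^ j) K y / fact j)) (circlepath 0 r)"
    if "norm y < r" for j y
    using Cauchy_has_contour_integral_higher_derivative_circlepath[OF cont_K hol_K, of y j] that
    by (simp add: C_def)
  define F where "F w = ?P ?x * M 0 x w
      + (\<Sum>j<d. ?x ^ j * (T j w + (\<Sum>i\<le>j. of_real (a i) * M (j - i) 0 w)))" for w
  have "K w / (w - ?x) ^ Suc 0 = F w" if "w \<in> path_image (circlepath 0 r)" for w
  proof -
    have "w \<noteq> 0" "w \<noteq> ?x" "?P w \<noteq> 0"
      using that r x P by auto
    then show ?thesis
      using Cauchy_kernel_division[of w ?x d a "K w"] by (simp add: F_def M_def T_def mult_ac)
  qed
  then have "(F has_contour_integral C * ((deriv ^^ 0) K ?x / fact 0)) (circlepath 0 r)"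
    using has_contour_integral_eq[OF Cauchy[of ?x 0]] x by simp
  moreover have "(F has_contour_integral ?P ?x * (C * cauchy_quotient K r d a 0 x)
      + (\<Sum>j<d. ?x ^ j * (C * ((deriv ^^ j) K 0 / fact j)
          + (\<Sum>i\<le>j. of_real (a i) * (C * cauchy_quotient K r d a (j - i) 0))))) (circlepath 0 r)"
    unfolding F_def T_def
    by (intro has_contour_integral_add has_contour_integral_lmul has_contour_integral_sum M Cauchy) (use x r in auto)
  ultimately have "C * ((deriv ^^ 0) K ?x / fact 0) = ?P ?x * (C * cauchy_quotient K r d a 0 x)
      + (\<Sum>j<d. ?x ^ j * (C * ((deriv ^^ j) K 0 / fact j)
          + (\<Sum>i\<le>j. of_real (a i) * (C * cauchy_quotient K r d a (j - i) 0))))"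
    by (rule has_contour_integral_unique)
  also have "\<dots> = C * (?P ?x * cauchy_quotient K r d a 0 x + (\<Sum>j<d. ?x ^ j * division_remainder K r d a j))"
    by (simp add: division_remainder_def sum_distrib_left distrib_left mult_ac)
  finally show ?thesis
    by (simp add: C_def monic_poly_of_real)
qed

section \<open>Fold and cusp as polynomial unfoldings\<close>

lemma has_derivative_vec_lambda:
  fixes f :: "'a::real_normed_vector \<Rightarrow> 'n::finite \<Rightarrow> real"
  assumes "\<And>k. ((\<lambda>x. f x k) has_derivative (\<lambda>h. f' h k)) (at x)"
  shows "((\<lambda>x. \<chi> k. f x k) has_derivative (\<lambda>h. \<chi> k. f' h k)) (at x)"
  unfolding has_derivative_componentwise_within[of "\<lambda>x. \<chi> k. f x k"]
  using assms by (auto simp: Basis_vec_def inner_axis)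

lemma smooth_at_vec_lambda:
  fixes f :: "'a::euclidean_space \<Rightarrow> 'n::finite \<Rightarrow> real"
  assumes "\<And>k. smooth_at x (\<lambda>y. f y k)"
  shows "smooth_at x (\<lambda>y. \<chi> k. f y k)"
  by (rule smooth_at_componentwise) (use assms in \<open>auto simp: Basis_vec_def inner_axis\<close>)

lemma cauchy_quotient_0:
  assumes "K holomorphic_on ball 0 R" "0 < r" "r < R"
  shows "cauchy_quotient K r d (\<lambda>_. 0) 0 0 = (deriv ^^ d) K 0 / fact d"
  using circle_mean_Cauchy[OF assms, of 0 d] assms(2)
  by (simp add: cauchy_quotient_def monic_poly_def mult.commute)

lemma Re_monic_poly_division:
  assumes "K holomorphic_on ball 0 R" "0 < r" "r < R" "\<bar>x\<bar> < r"
    and "\<And>w :: complex. w \<in> sphere 0 r \<Longrightarrow> monic_poly d a w \<noteq> 0"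
  shows "Re (K (of_real x)) = monic_poly d a x * Re (cauchy_quotient K r d a 0 x)
    + (\<Sum>j<d. x ^ j * Re (division_remainder K r d a j))"
proof -
  have "K (of_real x) = of_real (monic_poly d a x) * cauchy_quotient K r d a 0 x
      + (\<Sum>j<d. of_real (x ^ j) * division_remainder K r d a j)"
    by (rule monic_poly_division[OF assms])
  then show ?thesis by (simp del: of_real_power)
qed

lemma Re_division_remainder:
  "Re (division_remainder K r d a j)
    = Re ((deriv ^^ j) K 0) / fact j + (\<Sum>i\<le>j. a i * Re (cauchy_quotient K r d a (j - i) 0))"
proof -
  have "Re ((deriv ^^ j) K 0 / fact j) = Re ((deriv ^^ j) K 0) / fact j"
    using Re_divide_of_real[of "(deriv ^^ j) K 0" "fact j"] by simp
  then show ?thesis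
    by (simp add: division_remainder_def)
qed

lemma division_remainder_germ:
  fixes a :: "'p::euclidean_space \<Rightarrow> nat \<Rightarrow> real"
  assumes K: "K holomorphic_on ball 0 R" "0 < r" "r < R"
    and a: "\<And>i. smooth_at y (\<lambda>y. a y i)" "\<And>i. ((\<lambda>y. a y i) has_derivative a' i) (at y)" "a y = (\<lambda>_. 0)"
  shows "smooth_at y (\<lambda>y. Re (division_remainder K r d (a y) j))"
    and "((\<lambda>y. Re (division_remainder K r d (a y) j)) has_derivative
      (\<lambda>h. \<Sum>i\<le>j. a' i h * Re (cauchy_quotient K r d (\<lambda>_. 0) (j - i) 0))) (at y)"
proof -
  define Q where "Q i y = Re (cauchy_quotient K r d (a y) i 0)" for i y
  have Q: "smooth_at y (Q i)" for i
    unfolding Q_def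
    by (intro smooth_intros smooth_at_cauchy_quotient[OF K a(1)]) (use K(2) a(3) in \<open>auto simp: monic_poly_def\<close>)
  show "smooth_at y (\<lambda>y. Re (division_remainder K r d (a y) j))"
    unfolding Re_division_remainder Q_def[symmetric] by (intro smooth_intros a Q)
  have "((\<lambda>y. Re ((deriv ^^ j) K 0) / fact j + (\<Sum>i\<le>j. a y i * Q (j - i) y)) has_derivative
      (\<lambda>h. \<Sum>i\<le>j. a' i h * Q (j - i) y)) (at y)"
    by (auto intro!: derivative_eq_intros a(2) smooth_at_has_derivative[OF Q] simp: a(3))
  then show "((\<lambda>y. Re (division_remainder K r d (a y) j)) has_derivative
      (\<lambda>h. \<Sum>i\<le>j. a' i h * Re (cauchy_quotient K r d (\<lambda>_. 0) (j - i) 0))) (at y)"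
    by (simp add: Re_division_remainder Q_def a(3))
qed

lemma triangular_convolution_eq_0:
  fixes x c :: "nat \<Rightarrow> real"
  assumes "c 0 \<noteq> 0" "\<And>j. j < d \<Longrightarrow> (\<Sum>i\<le>j. x i * c (j - i)) = 0" "j < d"
  shows "x j = 0"
  using assms(3)
proof (induction j rule: less_induct)
  case (less j)
  have "(\<Sum>i\<le>j. x i * c (j - i)) = x j * c 0 + (\<Sum>i<j. x i * c (j - i))"
    by (simp flip: lessThan_Suc_atMost)
  also have "(\<Sum>i<j. x i * c (j - i)) = 0"
    using less by (intro sum.neutral) simp
  finally show ?case
    using assms(1,2) less.prems by simp
qed

definition linear_target :: "nat \<Rightarrow> real \<times> real \<Rightarrow> real" where
  "linear_target j y = (if j = 0 then snd y else if j = 1 then - fst y else 0)"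

lemma vec_lambda_inv_into_eq_0_iff:
  fixes \<kappa> :: "nat \<Rightarrow> 'd::finite" and f :: "nat \<Rightarrow> real"
  assumes "bij_betw \<kappa> {..<d} UNIV"
  shows "(\<chi> k. f (inv_into {..<d} \<kappa> k)) = 0 \<longleftrightarrow> (\<forall>j<d. f j = 0)"
proof -
  have "(\<forall>j<d. f j = 0) \<longleftrightarrow> (\<forall>j\<in>range (inv_into {..<d} \<kappa>). f j = 0)"
    by (simp only: bij_betw_imp_surj_on[OF bij_betw_inv_into[OF assms]] Ball_def lessThan_iff)
  then show ?thesis
    by (simp add: vec_eq_iff)
qed

definition remainder_map :: "(complex \<Rightarrow> complex) \<Rightarrow> real \<Rightarrow> nat \<Rightarrow> (nat \<Rightarrow> 'd::finite)
    \<Rightarrow> (real ^ 'd) \<times> (real \<times> real) \<Rightarrow> real ^ 'd" where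
  "remainder_map K r d \<kappa> p = (\<chi> k. Re (division_remainder K r d (\<lambda>i. fst p $ \<kappa> i) (inv_into {..<d} \<kappa> k))
     - linear_target (inv_into {..<d} \<kappa> k) (snd p))"

definition remainder_map_deriv :: "(complex \<Rightarrow> complex) \<Rightarrow> real \<Rightarrow> nat \<Rightarrow> (nat \<Rightarrow> 'd::finite)
    \<Rightarrow> (real ^ 'd) \<times> (real \<times> real) \<Rightarrow> real ^ 'd" where
  "remainder_map_deriv K r d \<kappa> h = (\<chi> k.
     (\<Sum>i\<le>inv_into {..<d} \<kappa> k. fst h $ \<kappa> i * Re (cauchy_quotient K r d (\<lambda>_. 0) (inv_into {..<d} \<kappa> k - i) 0))
     - linear_target (inv_into {..<d} \<kappa> k) (snd h))"

lemma remainder_map_germ: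
  fixes \<kappa> :: "nat \<Rightarrow> 'd::finite"
  assumes K: "K holomorphic_on ball 0 R" "0 < r" "r < R"
  shows "smooth_at (0, 0) (remainder_map K r d \<kappa>)"
    and "(remainder_map K r d \<kappa> has_derivative remainder_map_deriv K r d \<kappa>) (at (0, 0))"
proof -
  have "smooth_at (0, 0) (\<lambda>p :: (real ^ 'd) \<times> (real \<times> real). fst p $ \<kappa> i)"
      "((\<lambda>p :: (real ^ 'd) \<times> (real \<times> real). fst p $ \<kappa> i) has_derivative (\<lambda>h. fst h $ \<kappa> i)) (at (0, 0))" for i
    by (auto intro!: smooth_intros bounded_linear_imp_has_derivative bounded_linear_compose[OF bounded_linear_vec_nth]
        bounded_linear_fst)
  note remainder = division_remainder_germ[OF K this, where d=d]
  have "bounded_linear (\<lambda>p :: (real ^ 'd) \<times> (real \<times> real). linear_target j (snd p))" for j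
    unfolding linear_conv_bounded_linear[symmetric]
    by (rule linearI) (auto simp: linear_target_def)
  note target = smooth_at_linear[OF this] bounded_linear_imp_has_derivative[OF this]
  show "smooth_at (0, 0) (remainder_map K r d \<kappa>)"
    unfolding remainder_map_def by (intro smooth_at_vec_lambda smooth_at_diff remainder target) simp
  show "(remainder_map K r d \<kappa> has_derivative remainder_map_deriv K r d \<kappa>) (at (0, 0))"
    unfolding remainder_map_def remainder_map_deriv_def
    by (intro has_derivative_vec_lambda has_derivative_diff remainder target) simp
qed

lemma remainder_map_eq_0_iff:
  assumes "bij_betw \<kappa> {..<d} UNIV"
  shows "remainder_map K r d \<kappa> (v, y) = 0
    \<longleftrightarrow> (\<forall>j<d. Re (division_remainder K r d (\<lambda>i. v $ \<kappa> i) j) = linear_target j y)"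
  using vec_lambda_inv_into_eq_0_iff[OF assms,
      of "\<lambda>j. Re (division_remainder K r d (\<lambda>i. v $ \<kappa> i) j) - linear_target j y"]
  by (simp add: remainder_map_def)

lemma remainder_map_deriv_eq_0_iff:
  assumes "bij_betw \<kappa> {..<d} UNIV"
  shows "remainder_map_deriv K r d \<kappa> (v, h) = 0
    \<longleftrightarrow> (\<forall>j<d. (\<Sum>i\<le>j. v $ \<kappa> i * Re (cauchy_quotient K r d (\<lambda>_. 0) (j - i) 0)) = linear_target j h)"
  using vec_lambda_inv_into_eq_0_iff[OF assms,
      of "\<lambda>j. (\<Sum>i\<le>j. v $ \<kappa> i * Re (cauchy_quotient K r d (\<lambda>_. 0) (j - i) 0)) - linear_target j h"]
  by (simp add: remainder_map_deriv_def)

lemma remainder_map_partial_deriv_injective: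
  assumes K: "K holomorphic_on ball 0 R" "0 < r" "r < R" and Kd: "Re ((deriv ^^ d) K 0) \<noteq> 0"
    and \<kappa>: "bij_betw \<kappa> {..<d} UNIV" and v: "remainder_map_deriv K r d \<kappa> (v, 0) = 0"
  shows "v = 0"
proof -
  define c where "c i = Re (cauchy_quotient K r d (\<lambda>_. 0) i 0)" for i
  have "c 0 \<noteq> 0"
    using Kd Re_divide_of_real[of "(deriv ^^ d) K 0" "fact d"] by (simp add: c_def cauchy_quotient_0[OF K])
  moreover have "(\<Sum>i\<le>j. v $ \<kappa> i * c (j - i)) = 0" if "j < d" for j
    using v that unfolding remainder_map_deriv_eq_0_iff[OF \<kappa>] c_def by (simp add: linear_target_def)
  ultimately have "v $ \<kappa> j = 0" if "j < d" for j
    by (rule triangular_convolution_eq_0) (use that in auto)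
  then show ?thesis
    using bij_betw_imp_surj_on[OF \<kappa>] by (metis UNIV_I imageE lessThan_iff vec_eq_iff zero_index)
qed

lemma unfolding_coefficients:
  fixes K :: "complex \<Rightarrow> complex"
  assumes K: "K holomorphic_on ball 0 R" "0 < r" "r < R"
    and K0: "\<And>j. j < d \<Longrightarrow> Re ((deriv ^^ j) K 0) = 0" and Kd: "Re ((deriv ^^ d) K 0) \<noteq> 0"
    and d: "CARD('d::finite) = d"
  obtains a :: "real \<times> real \<Rightarrow> nat \<Rightarrow> real" and a'
  where "\<And>i. smooth_at 0 (\<lambda>y. a y i)" "a 0 = (\<lambda>_. 0)" "\<And>i. ((\<lambda>y. a y i) has_derivative a' i) (at 0)"
    "\<And>j h. j < d \<Longrightarrow> (\<Sum>i\<le>j. a' i h * Re (cauchy_quotient K r d (\<lambda>_. 0) (j - i) 0)) = linear_target j h"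
    "\<forall>\<^sub>F y in nhds 0. \<forall>j<d. Re (division_remainder K r d (a y) j) = linear_target j y"
proof -
  obtain \<kappa> :: "nat \<Rightarrow> 'd" where \<kappa>: "bij_betw \<kappa> {..<d} UNIV"
    using ex_bij_betw_nat_finite[of "UNIV :: 'd set"] d by (auto simp: atLeast0LessThan)
  obtain S S' where S: "smooth_at 0 S" "S 0 = 0" "(S has_derivative S') (at 0)"
    and S': "\<And>h. remainder_map_deriv K r d \<kappa> (S' h, h) = 0"
    and root: "\<forall>\<^sub>F y in nhds 0. remainder_map K r d \<kappa> (S y, y) = remainder_map K r d \<kappa> (0, 0)"
    by (rule smooth_implicit_function[OF remainder_map_germ[OF K]])
       (erule remainder_map_partial_deriv_injective[OF K Kd \<kappa>], rule that)
  have "remainder_map K r d \<kappa> (0, 0) = 0"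
    unfolding remainder_map_eq_0_iff[OF \<kappa>] using K0 by (simp add: Re_division_remainder linear_target_def)
  with root have remainder: "\<forall>\<^sub>F y in nhds 0. \<forall>j<d. Re (division_remainder K r d (\<lambda>i. S y $ \<kappa> i) j) = linear_target j y"
    by (simp only: remainder_map_eq_0_iff[OF \<kappa>])
  show ?thesis
  proof (rule that[of "\<lambda>y i. S y $ \<kappa> i" "\<lambda>i h. S' h $ \<kappa> i"])
    show "smooth_at 0 (\<lambda>y. S y $ \<kappa> i)" for i by (intro smooth_intros S)
    show "((\<lambda>y. S y $ \<kappa> i) has_derivative (\<lambda>h. S' h $ \<kappa> i)) (at 0)" for i
      by (rule bounded_linear.has_derivative[OF bounded_linear_vec_nth S(3)])
    show "(\<Sum>i\<le>j. S' h $ \<kappa> i * Re (cauchy_quotient K r d (\<lambda>_. 0) (j - i) 0)) = linear_target j h" if "j < d" for j h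
      using S'[of h] that unfolding remainder_map_deriv_eq_0_iff[OF \<kappa>] by blast
  qed (simp_all add: S(2) remainder)
qed

lemma eventually_monic_poly_nonzero:
  fixes a :: "'p::t2_space \<Rightarrow> nat \<Rightarrow> real"
  assumes "\<And>i. isCont (\<lambda>y. a y i) y" "a y = (\<lambda>_. 0)" "r > 0"
  shows "\<forall>\<^sub>F y in nhds y. \<forall>w\<in>sphere 0 r. monic_poly d (a y) (w :: complex) \<noteq> 0"
proof -
  have "isCont (\<lambda>y. \<Sum>i<d. \<bar>a y i\<bar> * r ^ i) y"
    by (intro continuous_intros assms(1))
  moreover have "\<forall>\<^sub>F t in nhds (\<Sum>i<d. \<bar>a y i\<bar> * r ^ i). t < r ^ d"
    using eventually_nhds_in_open[of "{..<r ^ d}"] assms(2,3) by simp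
  ultimately have "\<forall>\<^sub>F y in nhds y. (\<Sum>i<d. \<bar>a y i\<bar> * r ^ i) < r ^ d"
    by (rule eventually_nhds_isCont)
  then show ?thesis
  proof eventually_elim
    case (elim y)
    have "norm (\<Sum>i<d. of_real (a y i) * w ^ i) < norm (w ^ d)" if "w \<in> sphere 0 r" for w :: complex
      using norm_sum[of "\<lambda>i. of_real (a y i) * w ^ i" "{..<d}"] elim that by (simp add: norm_mult norm_power)
    then show ?case
      unfolding monic_poly_def by (metis eq_iff_diff_eq_0 less_irrefl)
  qed
qed

locale polynomial_unfolding =
  fixes K :: "complex \<Rightarrow> complex" and d :: nat and a :: "real \<times> real \<Rightarrow> nat \<Rightarrow> real"
    and a' :: "nat \<Rightarrow> real \<times> real \<Rightarrow> real" and u :: "(real \<times> real) \<times> real \<Rightarrow> real"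
  assumes K: "K analytic_on {0}" "Re (K 0) = 0" "Re (deriv K 0) = 0"
    and a: "\<And>i. smooth_at 0 (\<lambda>y. a y i)" "a 0 = (\<lambda>_. 0)" "\<And>i. ((\<lambda>y. a y i) has_derivative a' i) (at 0)"
    and a'_0: "\<And>h. a' 0 h = 0 \<longleftrightarrow> snd h = 0" and a'_0_1: "\<And>h. a' 0 h = 0 \<Longrightarrow> a' 1 h = 0 \<Longrightarrow> h = 0"
    and u: "smooth_at 0 u" "u 0 \<noteq> 0"
    and division: "\<forall>\<^sub>F p in nhds 0. monic_poly d (a (fst p)) (snd p) * u p
      = Re (K (of_real (snd p))) + fst (fst p) * snd p - snd (fst p)"

lemma eventually_division_of_unfolding:
  fixes a :: "real \<times> real \<Rightarrow> nat \<Rightarrow> real"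
  assumes K: "K holomorphic_on ball 0 R" "0 < r" "r < R" and "d \<ge> 2"
    and a: "\<And>i. isCont (\<lambda>y. a y i) 0" "a 0 = (\<lambda>_. 0)"
    and remainder: "\<forall>\<^sub>F y in nhds 0. \<forall>j<d. Re (division_remainder K r d (a y) j) = linear_target j y"
  shows "\<forall>\<^sub>F p in nhds 0. monic_poly d (a (fst p)) (snd p) * Re (cauchy_quotient K r d (a (fst p)) 0 (snd p))
    = Re (K (of_real (snd p))) + fst (fst p) * snd p - snd (fst p)"
proof -
  have fst: "isCont fst (0 :: (real \<times> real) \<times> real)" and abs_snd: "isCont (\<lambda>p. \<bar>snd p\<bar>) (0 :: (real \<times> real) \<times> real)"
    by (intro continuous_intros)+
  have "\<forall>\<^sub>F p in nhds (0 :: (real \<times> real) \<times> real). \<bar>snd p\<bar> < r"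
    by (rule eventually_nhds_isCont[OF abs_snd]) (use eventually_nhds_in_open[of "{..<r}"] K(2) in simp)
  moreover have "\<forall>\<^sub>F p in nhds (0 :: (real \<times> real) \<times> real).
      \<forall>j<d. Re (division_remainder K r d (a (fst p)) j) = linear_target j (fst p)"
    by (rule eventually_nhds_isCont[OF fst]) (use remainder in simp)
  moreover have "\<forall>\<^sub>F p in nhds (0 :: (real \<times> real) \<times> real).
      \<forall>w\<in>sphere 0 r. monic_poly d (a (fst p)) (w :: complex) \<noteq> 0"
    by (rule eventually_nhds_isCont[OF fst]) (simp add: eventually_monic_poly_nonzero a K(2))
  ultimately show ?thesis
  proof eventually_elim
    case (elim p)
    have "(\<Sum>j<d. snd p ^ j * linear_target j (fst p)) = (\<Sum>j\<in>{0, 1}. snd p ^ j * linear_target j (fst p))"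
      by (rule sum.mono_neutral_right) (use \<open>d \<ge> 2\<close> in \<open>auto simp: linear_target_def\<close>)
    then have "(\<Sum>j<d. snd p ^ j * Re (division_remainder K r d (a (fst p)) j)) = snd (fst p) - fst (fst p) * snd p"
      using elim(2) by (simp add: linear_target_def)
    moreover have "Re (K (of_real (snd p)))
      = monic_poly d (a (fst p)) (snd p) * Re (cauchy_quotient K r d (a (fst p)) 0 (snd p))
        + (\<Sum>j<d. snd p ^ j * Re (division_remainder K r d (a (fst p)) j))"
      by (rule Re_monic_poly_division[OF K]) (use elim in auto)
    ultimately show ?case by simp
  qed
qed

theorem polynomial_unfolding_exists:
  fixes K :: "complex \<Rightarrow> complex"
  assumes K: "K analytic_on {0}" and K0: "\<And>j. j < d \<Longrightarrow> Re ((deriv ^^ j) K 0) = 0"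
    and Kd: "Re ((deriv ^^ d) K 0) \<noteq> 0" and d: "CARD('d::finite) = d" "d \<ge> 2"
  obtains a a' u where "polynomial_unfolding K d a a' u"
proof -
  obtain R where R: "R > 0" "K holomorphic_on ball 0 R"
    using K by (auto simp: analytic_on_def)
  define r where "r = R / 2"
  have r: "0 < r" "r < R" using R(1) by (auto simp: r_def)
  obtain a :: "real \<times> real \<Rightarrow> nat \<Rightarrow> real" and a'
    where a: "\<And>i. smooth_at 0 (\<lambda>y. a y i)" "a 0 = (\<lambda>_. 0)" "\<And>i. ((\<lambda>y. a y i) has_derivative a' i) (at 0)"
    and a': "\<And>j h. j < d \<Longrightarrow> (\<Sum>i\<le>j. a' i h * Re (cauchy_quotient K r d (\<lambda>_. 0) (j - i) 0)) = linear_target j h"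
    and remainder: "\<forall>\<^sub>F y in nhds 0. \<forall>j<d. Re (division_remainder K r d (a y) j) = linear_target j y"
    by (rule unfolding_coefficients[OF R(2) r _ Kd d(1)]) (erule K0, rule that)
  define u where "u p = Re (cauchy_quotient K r d (a (fst p)) 0 (snd p))" for p :: "(real \<times> real) \<times> real"
  have a_fst: "smooth_at 0 (\<lambda>p :: (real \<times> real) \<times> real. a (fst p) i)" for i
    by (rule smooth_at_compose[of _ fst "\<lambda>y. a y i"]) (auto intro!: smooth_intros a)
  have u: "smooth_at 0 u"
    unfolding u_def
    by (intro smooth_intros smooth_at_cauchy_quotient[OF R(2) r a_fst])
       (use r in \<open>auto simp: monic_poly_def a(2)\<close>)
  have u0: "u 0 \<noteq> 0"
    using Kd cauchy_quotient_0[OF R(2) r] Re_divide_of_real[of "(deriv ^^ d) K 0" "fact d"]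
    by (simp add: u_def a(2))
  have a'_0: "a' 0 h * u 0 = snd h" for h
    using a'[of 0 h] d(2) by (simp add: u_def a(2) linear_target_def)
  have a'_1: "a' 1 h * u 0 = - fst h" if "a' 0 h = 0" for h
    using a'[of 1 h] d(2) that by (simp add: u_def a(2) linear_target_def)
  show ?thesis
  proof (rule that[of a a' u], unfold_locales)
    show "Re (K 0) = 0" "Re (deriv K 0) = 0"
      using K0[of 0] K0[of 1] d(2) by simp_all
    show "a' 0 h = 0 \<longleftrightarrow> snd h = 0" for h
      using a'_0[of h] u0 by auto
    show "h = 0" if "a' 0 h = 0" "a' 1 h = 0" for h
      using a'_0[of h] a'_1[of h] that by (simp add: prod_eq_iff)
    show "\<forall>\<^sub>F p in nhds 0. monic_poly d (a (fst p)) (snd p) * u p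
        = Re (K (of_real (snd p))) + fst (fst p) * snd p - snd (fst p)"
      unfolding u_def by (rule eventually_division_of_unfolding[OF R(2) r d(2) smooth_at_isCont[OF a(1)] a(2) remainder])
  qed (fact K a u u0)+
qed

definition quad_map :: "(complex \<Rightarrow> complex) \<Rightarrow> real \<times> real \<times> real \<times> real \<Rightarrow> real \<times> real" where
  "quad_map K = (\<lambda>(\<eta>, s, X, Y). (\<eta>, s * \<eta> + Re (K (of_real s)) + X\<^sup>2 - Y\<^sup>2))"

lemma quad_map_eq: "quad_map K = (\<lambda>p. (fst p, fst (snd p) * fst p + Re (K (of_real (fst (snd p))))
   + (fst (snd (snd p)))\<^sup>2 - (snd (snd (snd p)))\<^sup>2))"
  by (auto simp: quad_map_def)

lemma fst_quad_map: "fst (quad_map K p) = fst p"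
  by (simp add: quad_map_eq)

lemma vector_4:
  "(vector [a, b, c, d] :: 'a::zero ^ 4) $ 1 = a" "(vector [a, b, c, d] :: 'a::zero ^ 4) $ 2 = b"
  "(vector [a, b, c, d] :: 'a::zero ^ 4) $ 3 = c" "(vector [a, b, c, d] :: 'a::zero ^ 4) $ 4 = d"
  unfolding vector_def by simp_all

definition vec4 :: "real \<times> real \<times> real \<times> real \<Rightarrow> real ^ 4" where
  "vec4 = (\<lambda>(a, b, c, d). vector [a, b, c, d])"

definition vec2 :: "real \<times> real \<Rightarrow> real ^ 2" where
  "vec2 = (\<lambda>(a, b). vector [a, b])"

lemma local_diffeo_at_vec4: "local_diffeo_at x vec4"
proof (rule local_diffeo_at_linear)
  show "bounded_linear vec4"
    unfolding linear_conv_bounded_linear[symmetric]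
    by (rule linearI) (auto simp: vec4_def vec_eq_iff forall_4 vector_4)
qed (auto simp: vec4_def vec_eq_iff forall_4 vector_4 prod_eq_iff)

lemma local_diffeo_at_vec2: "local_diffeo_at x vec2"
proof (rule local_diffeo_at_linear)
  show "bounded_linear vec2"
    unfolding linear_conv_bounded_linear[symmetric]
    by (rule linearI) (auto simp: vec2_def vec_eq_iff forall_2)
qed (auto simp: vec2_def vec_eq_iff forall_2 prod_eq_iff)

lemma germ_equiv_vecI:
  assumes "local_diffeo_at x \<phi>" "\<phi> x = 0" "local_diffeo_at (g x) \<psi>"
    and "\<forall>\<^sub>F x' in nhds x. vec2 (\<psi> (g x')) = N (vec4 (\<phi> x'))"
  shows "germ_equiv g x N 0"
proof (rule germ_equivI)
  show "local_diffeo_at x (\<lambda>x'. vec4 (\<phi> x'))" "local_diffeo_at (g x) (\<lambda>y. vec2 (\<psi> y))"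
    using assms local_diffeo_at_compose local_diffeo_at_vec4 local_diffeo_at_vec2 by blast+
qed (use assms in \<open>simp_all add: vec4_def vec_eq_iff forall_4 vector_4 zero_prod_def\<close>)

definition fold_target :: "(nat \<Rightarrow> real) \<Rightarrow> real" where
  "fold_target b = (b 1)\<^sup>2 / 4 + b 0"

definition cusp_parameter :: "(nat \<Rightarrow> real) \<Rightarrow> real" where
  "cusp_parameter b = - ((b 2)\<^sup>2 / 3 + b 1)"

definition cusp_target :: "(nat \<Rightarrow> real) \<Rightarrow> real" where
  "cusp_target b = 2 * (b 2 / 3) ^ 3 + b 1 * b 2 / 3 + b 0"

lemma monic_poly_2_complete_square: "monic_poly 2 b s = (s - b 1 / 2)\<^sup>2 - fold_target b" for s :: real
  by (simp add: monic_poly_def fold_target_def numeral_2_eq_2 field_simps)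

lemma monic_poly_3_complete_cube:
  "monic_poly 3 b s = (s - b 2 / 3) ^ 3 + cusp_parameter b * (s - b 2 / 3) - cusp_target b" for s :: real
proof -
  have "monic_poly 3 b s = s ^ 3 - b 2 * s\<^sup>2 - b 1 * s - b 0"
    by (simp add: monic_poly_def numeral_2_eq_2 numeral_3_eq_3)
  then show ?thesis
    by (simp add: cusp_parameter_def cusp_target_def power2_eq_square power3_eq_cube field_simps)
qed

context polynomial_unfolding
begin

lemma quad_map_0: "quad_map K 0 = 0"
  using K(2) by (simp add: quad_map_eq zero_prod_def)

lemma smooth_at_quad_map: "smooth_at 0 (quad_map K)"
  unfolding quad_map_eq
  by (intro smooth_intros smooth_at_analytic_compose[where h=K and f="\<lambda>p. of_real (fst (snd p))"]) (use K in auto)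

lemma has_derivative_quad_map: "(quad_map K has_derivative (\<lambda>h. (fst h, 0))) (at 0)"
proof -
  define \<sigma> :: "real \<times> real \<times> real \<times> real \<Rightarrow> complex" where "\<sigma> p = of_real (fst (snd p))" for p
  define k where "k p = Re (K (\<sigma> p))" for p
  have "(K has_field_derivative deriv K 0) (at 0)"
    using K(1) by (simp add: analytic_on_imp_differentiable_at DERIV_deriv_iff_field_differentiable)
  then have dK: "(K has_derivative (\<lambda>z. deriv K 0 * z)) (at (\<sigma> 0))"
    by (simp add: has_field_derivative_def \<sigma>_def)
  have d\<sigma>: "(\<sigma> has_derivative \<sigma>) (at 0)"
    unfolding \<sigma>_def by (auto intro!: derivative_eq_intros)
  have "((\<lambda>p. Re (K (\<sigma> p))) has_derivative (\<lambda>h. Re (deriv K 0 * \<sigma> h))) (at 0)"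
    by (rule has_derivative_Re[OF has_derivative_compose[OF d\<sigma> dK]])
  then have "(k has_derivative (\<lambda>h. 0)) (at 0)"
    by (simp add: k_def[abs_def] \<sigma>_def K(3))
  then show ?thesis
    unfolding quad_map_eq k_def[unfolded \<sigma>_def, symmetric] by (auto intro!: derivative_eq_intros)
qed

lemma smooth_at_coefficient: "smooth_at 0 (\<lambda>p. a (quad_map K p) i)"
  by (rule smooth_at_compose[OF smooth_at_quad_map, where g="\<lambda>y. a y i"]) (simp add: quad_map_0 a)

lemma has_derivative_coefficient: "((\<lambda>p. a (quad_map K p) i) has_derivative (\<lambda>h. a' i (fst h, 0))) (at 0)"
  by (rule has_derivative_compose[OF has_derivative_quad_map, where g="\<lambda>y. a y i"]) (simp add: quad_map_0 a)

lemma a'_zero: "a' i 0 = 0"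
  using has_derivative_linear[OF a(3)] linear_0 by blast

lemma eventually_division_quad_map:
  "\<forall>\<^sub>F p in nhds 0. monic_poly d (a (quad_map K p)) (fst (snd p)) * u (quad_map K p, fst (snd p))
    = (snd (snd (snd p)))\<^sup>2 - (fst (snd (snd p)))\<^sup>2"
proof -
  define Q where "Q p = (quad_map K p, fst (snd p))" for p
  have "isCont Q 0"
    unfolding Q_def by (intro continuous_intros smooth_at_isCont[OF smooth_at_quad_map])
  then have "\<forall>\<^sub>F p in nhds 0. monic_poly d (a (fst (Q p))) (snd (Q p)) * u (Q p)
      = Re (K (of_real (snd (Q p)))) + fst (fst (Q p)) * snd (Q p) - snd (fst (Q p))"
    by (rule eventually_nhds_isCont) (use division in \<open>simp add: Q_def quad_map_0 flip: zero_prod_def\<close>)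
  then show ?thesis
  proof eventually_elim
    case (elim p)
    have "Re (K (of_real (fst (snd p)))) + fst (quad_map K p) * fst (snd p) - snd (quad_map K p)
        = (snd (snd (snd p)))\<^sup>2 - (fst (snd (snd p)))\<^sup>2"
      by (simp add: quad_map_eq)
    then show ?case using elim by (simp add: Q_def)
  qed
qed

lemma scaled_hyperbolic_form:
  obtains w :: "real \<times> real \<times> real \<times> real \<Rightarrow> real"
  where "smooth_at 0 w" "w 0 \<noteq> 0"
    "\<forall>\<^sub>F p in nhds 0. monic_poly d (a (quad_map K p)) (fst (snd p))
      = sgn (u 0) * ((snd (snd (snd p)) * w p)\<^sup>2 - (fst (snd (snd p)) * w p)\<^sup>2)"
proof -
  define U where "U p = sgn (u 0) * u (quad_map K p, fst (snd p))" for p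
  define w where "w p = 1 / sqrt (U p)" for p
  have U: "smooth_at 0 U"
    unfolding U_def
    by (intro smooth_intros smooth_at_compose[where g=u and f="\<lambda>p. (quad_map K p, fst (snd p))"] smooth_at_quad_map)
       (simp add: quad_map_0 u flip: zero_prod_def)
  have U0: "U 0 > 0"
    using u(2) by (simp add: U_def quad_map_0 mult.commute[of "sgn _"] flip: zero_prod_def abs_sgn)
  have w: "smooth_at 0 w"
    unfolding w_def by (intro smooth_intros U) (use U0 in auto)
  have w0: "w 0 \<noteq> 0" using U0 by (simp add: w_def)
  have "\<forall>\<^sub>F p in nhds 0. U p > 0"
    by (rule eventually_nhds_isCont[OF smooth_at_isCont[OF U]])
       (use eventually_nhds_in_open[of "{0<..}" "U 0"] U0 in simp)
  with eventually_division_quad_map have "\<forall>\<^sub>F p in nhds 0. monic_poly d (a (quad_map K p)) (fst (snd p))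
      = sgn (u 0) * ((snd (snd (snd p)) * w p)\<^sup>2 - (fst (snd (snd p)) * w p)\<^sup>2)"
  proof eventually_elim
    case (elim p)
    have "monic_poly d (a (quad_map K p)) (fst (snd p)) * U p
        = sgn (u 0) * ((snd (snd (snd p)))\<^sup>2 - (fst (snd (snd p)))\<^sup>2)"
      using elim(1) by (simp add: U_def)
    then have "monic_poly d (a (quad_map K p)) (fst (snd p))
        = sgn (u 0) * ((snd (snd (snd p)))\<^sup>2 - (fst (snd (snd p)))\<^sup>2) / U p"
      using elim(2) by (simp only: nonzero_eq_divide_eq)
    moreover have "(w p)\<^sup>2 = 1 / U p"
      using elim(2) by (simp add: w_def power_divide)
    ultimately show ?case
      by (simp add: power_mult_distrib left_diff_distrib diff_divide_distrib right_diff_distrib)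
  qed
  with w w0 show ?thesis by (rule that)
qed

lemma quadratic_coordinates:
  obtains X Y :: "real \<times> real \<times> real \<times> real \<Rightarrow> real" and X' Y'
  where "smooth_at 0 X" "smooth_at 0 Y" "X 0 = 0" "Y 0 = 0"
    "(X has_derivative X') (at 0)" "(Y has_derivative Y') (at 0)"
    "\<And>h. X' h = 0 \<Longrightarrow> Y' h = 0 \<Longrightarrow> snd (snd h) = 0"
    "\<forall>\<^sub>F p in nhds 0. monic_poly d (a (quad_map K p)) (fst (snd p)) = (Y p)\<^sup>2 - (X p)\<^sup>2"
proof -
  obtain w where w: "smooth_at 0 w" "w 0 \<noteq> 0"
    and poly: "\<forall>\<^sub>F p in nhds 0. monic_poly d (a (quad_map K p)) (fst (snd p))
      = sgn (u 0) * ((snd (snd (snd p)) * w p)\<^sup>2 - (fst (snd (snd p)) * w p)\<^sup>2)"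
    by (rule scaled_hyperbolic_form)
  have dw: "(w has_derivative frechet_derivative w (at 0)) (at 0)"
    by (rule smooth_at_has_derivative[OF w(1)])
  have dX: "((\<lambda>p. fst (snd (snd p)) * w p) has_derivative (\<lambda>h. fst (snd (snd h)) * w 0)) (at 0)"
    and dY: "((\<lambda>p. snd (snd (snd p)) * w p) has_derivative (\<lambda>h. snd (snd (snd h)) * w 0)) (at 0)"
    by (auto intro!: derivative_eq_intros dw)
  have X: "smooth_at 0 (\<lambda>p. fst (snd (snd p)) * w p)" and Y: "smooth_at 0 (\<lambda>p. snd (snd (snd p)) * w p)"
    by (intro smooth_intros w(1))+
  show ?thesis
  proof (cases "u 0 > 0")
    case True
    show ?thesis
      by (rule that[OF X Y _ _ dX dY]) (use True w(2) poly in \<open>auto simp: prod_eq_iff\<close>)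
  next
    case False
    then have "sgn (u 0) = - 1" using u(2) by (simp add: sgn_if)
    then show ?thesis
      by (intro that[OF Y X _ _ dY dX]) (use w(2) poly in \<open>auto simp: prod_eq_iff\<close>)
  qed
qed

lemma local_diffeo_at_fold_target: "local_diffeo_at 0 (\<lambda>y. (fst y, fold_target (a y)))"
proof (rule local_diffeo_atI)
  show "smooth_at 0 (\<lambda>y. (fst y, fold_target (a y)))"
    unfolding fold_target_def by (intro smooth_intros a) auto
  show "((\<lambda>y. (fst y, fold_target (a y))) has_derivative (\<lambda>h. (fst h, a' 0 h))) (at 0)"
    unfolding fold_target_def by (auto intro!: derivative_eq_intros a(3) simp: a(2))
  show "h = 0" if "(fst h, a' 0 h) = 0" for h
    using a'_0[of h] that by (simp add: prod_eq_iff)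
qed

theorem germ_equiv_indefinite_fold:
  assumes "d = 2"
  shows "germ_equiv (quad_map K) 0 indefinite_fold_form 0"
proof -
  obtain X Y X' Y' where XY: "smooth_at 0 X" "smooth_at 0 Y" "X 0 = 0" "Y 0 = 0"
    "(X has_derivative X') (at 0)" "(Y has_derivative Y') (at 0)"
    "\<And>h. X' h = 0 \<Longrightarrow> Y' h = 0 \<Longrightarrow> snd (snd h) = 0"
    and poly: "\<forall>\<^sub>F p in nhds 0. monic_poly d (a (quad_map K p)) (fst (snd p)) = (Y p)\<^sup>2 - (X p)\<^sup>2"
    by (rule quadratic_coordinates) (rule that)
  define \<Phi> where "\<Phi> p = (fst p, fst (snd p) - a (quad_map K p) 1 / 2, X p, Y p)" for p
  show ?thesis
  proof (rule germ_equiv_vecI)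
    show "local_diffeo_at 0 \<Phi>"
    proof (rule local_diffeo_atI)
      show "smooth_at 0 \<Phi>"
        unfolding \<Phi>_def by (intro smooth_intros smooth_at_coefficient XY) auto
      show "(\<Phi> has_derivative (\<lambda>h. (fst h, fst (snd h) - a' 1 (fst h, 0) / 2, X' h, Y' h))) (at 0)"
        unfolding \<Phi>_def by (auto intro!: derivative_eq_intros has_derivative_coefficient XY)
      show "h = 0" if "(fst h, fst (snd h) - a' 1 (fst h, 0) / 2, X' h, Y' h) = 0" for h
      proof -
        have h: "fst h = 0" "fst (snd h) = a' 1 (fst h, 0) / 2" "X' h = 0" "Y' h = 0"
          using that by (simp_all add: prod_eq_iff)
        show ?thesis
          using XY(7)[OF h(3,4)] h(1,2) a'_zero[of 1] by (simp add: prod_eq_iff zero_prod_def)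
      qed
    qed
    show "local_diffeo_at (quad_map K 0) (\<lambda>y. (fst y, fold_target (a y)))"
      unfolding quad_map_0 by (rule local_diffeo_at_fold_target)
    show "\<forall>\<^sub>F p in nhds 0. vec2 (fst (quad_map K p), fold_target (a (quad_map K p))) = indefinite_fold_form (vec4 (\<Phi> p))"
      using poly
      by eventually_elim
        (simp add: assms monic_poly_2_complete_square \<Phi>_def indefinite_fold_form_def vec2_def vec4_def vector_4
          fst_quad_map algebra_simps)
  qed (simp add: \<Phi>_def quad_map_0 a XY prod_eq_iff)
qed

lemma local_diffeo_at_cusp_target: "local_diffeo_at 0 (\<lambda>y. (cusp_parameter (a y), cusp_target (a y)))"
proof (rule local_diffeo_atI)
  show "smooth_at 0 (\<lambda>y. (cusp_parameter (a y), cusp_target (a y)))"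
    unfolding cusp_parameter_def cusp_target_def by (intro smooth_intros a) auto
  show "((\<lambda>y. (cusp_parameter (a y), cusp_target (a y))) has_derivative (\<lambda>h. (- a' 1 h, a' 0 h))) (at 0)"
    unfolding cusp_parameter_def cusp_target_def by (auto intro!: derivative_eq_intros a(3) simp: a(2))
  show "h = 0" if "(- a' 1 h, a' 0 h) = 0" for h
    using a'_0_1[of h] that by (simp add: prod_eq_iff)
qed

theorem germ_equiv_cusp:
  assumes "d = 3"
  shows "germ_equiv (quad_map K) 0 cusp_minus_form 0"
proof -
  obtain X Y X' Y' where XY: "smooth_at 0 X" "smooth_at 0 Y" "X 0 = 0" "Y 0 = 0"
    "(X has_derivative X') (at 0)" "(Y has_derivative Y') (at 0)"
    "\<And>h. X' h = 0 \<Longrightarrow> Y' h = 0 \<Longrightarrow> snd (snd h) = 0"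
    and poly: "\<forall>\<^sub>F p in nhds 0. monic_poly d (a (quad_map K p)) (fst (snd p)) = (Y p)\<^sup>2 - (X p)\<^sup>2"
    by (rule quadratic_coordinates) (rule that)
  define \<Phi> where "\<Phi> p = (cusp_parameter (a (quad_map K p)), X p, Y p, fst (snd p) - a (quad_map K p) 2 / 3)" for p
  show ?thesis
  proof (rule germ_equiv_vecI)
    show "local_diffeo_at 0 \<Phi>"
    proof (rule local_diffeo_atI)
      show "smooth_at 0 \<Phi>"
        unfolding \<Phi>_def cusp_parameter_def by (intro smooth_intros smooth_at_coefficient XY) auto
      show "(\<Phi> has_derivative (\<lambda>h. (- a' 1 (fst h, 0), X' h, Y' h, fst (snd h) - a' 2 (fst h, 0) / 3))) (at 0)"
        unfolding \<Phi>_def cusp_parameter_def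
        by (auto intro!: derivative_eq_intros has_derivative_coefficient XY simp: quad_map_0 a(2))
      show "h = 0" if "(- a' 1 (fst h, 0), X' h, Y' h, fst (snd h) - a' 2 (fst h, 0) / 3) = 0" for h
      proof -
        have h: "a' 1 (fst h, 0) = 0" "X' h = 0" "Y' h = 0" "fst (snd h) = a' 2 (fst h, 0) / 3"
          using that by (simp_all add: prod_eq_iff)
        have "(fst h, 0 :: real) = 0"
          by (rule a'_0_1) (use h(1) a'_0 in auto)
        then show ?thesis
          using XY(7)[OF h(2,3)] h(4) a'_zero[of 2] by (simp add: prod_eq_iff zero_prod_def)
      qed
    qed
    show "local_diffeo_at (quad_map K 0) (\<lambda>y. (cusp_parameter (a y), cusp_target (a y)))"
      unfolding quad_map_0 by (rule local_diffeo_at_cusp_target)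
    show "\<forall>\<^sub>F p in nhds 0. vec2 (cusp_parameter (a (quad_map K p)), cusp_target (a (quad_map K p)))
        = cusp_minus_form (vec4 (\<Phi> p))"
      using poly
      by eventually_elim
        (simp add: assms monic_poly_3_complete_cube \<Phi>_def cusp_minus_form_def vec2_def vec4_def vector_4 algebra_simps)
  qed (simp add: \<Phi>_def cusp_parameter_def quad_map_0 a XY prod_eq_iff)
qed

end

theorem quad_map_indefinite_fold:
  assumes "K analytic_on {0}" "Re (K 0) = 0" "Re (deriv K 0) = 0" "Re ((deriv ^^ 2) K 0) \<noteq> 0"
  shows "germ_equiv (quad_map K) 0 indefinite_fold_form 0"
proof -
  have low: "Re ((deriv ^^ j) K 0) = 0" if "j < 2" for j
    using assms(2,3) that by (auto simp: less_2_cases_iff)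
  obtain a a' u where "polynomial_unfolding K 2 a a' u"
    by (rule polynomial_unfolding_exists[where 'd=2, OF assms(1) _ assms(4)]) (erule low, simp, simp, rule that)
  then show ?thesis
    by (rule polynomial_unfolding.germ_equiv_indefinite_fold) simp
qed

theorem quad_map_cusp:
  assumes "K analytic_on {0}" "Re (K 0) = 0" "Re (deriv K 0) = 0" "Re ((deriv ^^ 2) K 0) = 0"
    and "Re ((deriv ^^ 3) K 0) \<noteq> 0"
  shows "germ_equiv (quad_map K) 0 cusp_minus_form 0"
proof -
  have low: "Re ((deriv ^^ j) K 0) = 0" if "j < 3" for j
    using assms(2-4) that by (auto simp: numeral_3_eq_3 numeral_2_eq_2 less_Suc_eq)
  obtain a a' u where "polynomial_unfolding K 3 a a' u"
    by (rule polynomial_unfolding_exists[where 'd=3, OF assms(1) _ assms(5)]) (erule low, simp, simp, rule that)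
  then show ?thesis
    by (rule polynomial_unfolding.germ_equiv_cusp) simp
qed

section \<open>Morse coordinates for \<open>z\<^sup>p + a \<cdot> cnj z\<close>\<close>

definition cayley_root :: "nat \<Rightarrow> complex \<Rightarrow> complex" where
  "cayley_root n s = exp ((Ln (1 - \<i> * s) - Ln (1 + \<i> * s)) / of_nat n)"

definition crit_factor :: "nat \<Rightarrow> complex \<Rightarrow> complex" where
  "crit_factor n s = (1 - \<i> * s) * cayley_root n s"

lemma one_pm_i_times_ball:
  assumes "s \<in> ball 0 1"
  shows "1 + \<i> * s \<notin> \<real>\<^sub>\<le>\<^sub>0" "1 - \<i> * s \<notin> \<real>\<^sub>\<le>\<^sub>0" "1 + \<i> * s \<noteq> 0" "1 - \<i> * s \<noteq> 0"
proof -
  have "\<bar>Im s\<bar> < 1" using assms abs_Im_le_cmod[of s] by simp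
  then show "1 + \<i> * s \<notin> \<real>\<^sub>\<le>\<^sub>0" "1 - \<i> * s \<notin> \<real>\<^sub>\<le>\<^sub>0" "1 + \<i> * s \<noteq> 0" "1 - \<i> * s \<noteq> 0"
    by (auto simp: complex_nonpos_Reals_iff complex_eq_iff)
qed

lemma one_plus_square_ball:
  assumes "s \<in> ball 0 1"
  shows "1 + s\<^sup>2 \<noteq> (0 :: complex)"
proof -
  have "1 + s\<^sup>2 = (1 + \<i> * s) * (1 - \<i> * s)"
    by (simp add: algebra_simps power2_eq_square)
  then show ?thesis
    using one_pm_i_times_ball[OF assms] by simp
qed

lemma one_pm_i_times_of_real: "1 + \<i> * of_real s \<noteq> 0" "1 - \<i> * of_real s \<noteq> 0"
  by (auto simp: complex_eq_iff)

lemma cayley_root_0 [simp]: "cayley_root n 0 = 1" and crit_factor_0 [simp]: "crit_factor n 0 = 1"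
  by (simp_all add: cayley_root_def crit_factor_def)

lemma cayley_root_nonzero [simp]: "cayley_root n s \<noteq> 0"
  by (simp add: cayley_root_def)

lemma cayley_root_power:
  assumes "n > 0"
  shows "cayley_root n (of_real s) ^ n = (1 - \<i> * of_real s) / (1 + \<i> * of_real s)"
  using assms one_pm_i_times_of_real[of s] by (simp add: cayley_root_def exp_diff flip: exp_of_nat_mult)

lemma cayley_root_power_Suc:
  assumes "n > 0"
  shows "(1 + \<i> * of_real s) * cayley_root n (of_real s) ^ Suc n = crit_factor n (of_real s)"
  using one_pm_i_times_of_real[of s] by (simp add: cayley_root_power[OF assms] crit_factor_def)

lemma has_field_derivative_cayley_root:
  assumes "s \<in> ball 0 1"
  shows "(cayley_root n has_field_derivative - 2 * \<i> / of_nat n * cayley_root n s / (1 + s\<^sup>2)) (at s)"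
proof -
  note nz = one_pm_i_times_ball[OF assms]
  have "((\<lambda>s. Ln (1 - \<i> * s)) has_field_derivative - \<i> / (1 - \<i> * s)) (at s)"
    by (rule derivative_eq_intros refl | use nz in \<open>simp add: divide_inverse\<close>)+
  moreover have "((\<lambda>s. Ln (1 + \<i> * s)) has_field_derivative \<i> / (1 + \<i> * s)) (at s)"
    by (rule derivative_eq_intros refl | use nz in \<open>simp add: divide_inverse\<close>)+
  ultimately have "((\<lambda>s. (Ln (1 - \<i> * s) - Ln (1 + \<i> * s)) / of_nat n) has_field_derivative
      (- \<i> / (1 - \<i> * s) - \<i> / (1 + \<i> * s)) / of_nat n) (at s)"
    by (intro DERIV_cdivide DERIV_diff)
  also have "- \<i> / (1 - \<i> * s) - \<i> / (1 + \<i> * s) = - 2 * \<i> / (1 + s\<^sup>2)"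
    using nz one_plus_square_ball[OF assms] by (simp add: field_simps power2_eq_square)
  finally have "((\<lambda>s. (Ln (1 - \<i> * s) - Ln (1 + \<i> * s)) / of_nat n) has_field_derivative
      - 2 * \<i> / (1 + s\<^sup>2) / of_nat n) (at s)" .
  from DERIV_chain2[OF DERIV_exp this] show ?thesis
    unfolding cayley_root_def[abs_def] by (rule DERIV_cong) (simp add: mult_ac)
qed

lemma has_field_derivative_crit_factor:
  assumes "s \<in> ball 0 1"
  shows "(crit_factor n has_field_derivative (s - \<i> * (1 + 2 / of_nat n)) * crit_factor n s / (1 + s\<^sup>2)) (at s)"
proof -
  have "(crit_factor n has_field_derivative
      - \<i> * cayley_root n s + (1 - \<i> * s) * (- 2 * \<i> / of_nat n * cayley_root n s / (1 + s\<^sup>2))) (at s)"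
    unfolding crit_factor_def[abs_def]
    by (rule derivative_eq_intros has_field_derivative_cayley_root[OF assms] refl | simp)+
  also have "- \<i> * cayley_root n s = (s - \<i>) * crit_factor n s / (1 + s\<^sup>2)"
    using one_plus_square_ball[OF assms] by (simp add: crit_factor_def field_simps power2_eq_square)
  also have "(1 - \<i> * s) * (- 2 * \<i> / of_nat n * cayley_root n s / (1 + s\<^sup>2))
      = - 2 * \<i> / of_nat n * crit_factor n s / (1 + s\<^sup>2)"
    by (simp add: crit_factor_def mult_ac)
  also have "(s - \<i>) * crit_factor n s / (1 + s\<^sup>2) + - 2 * \<i> / of_nat n * crit_factor n s / (1 + s\<^sup>2)
      = (s - \<i> + - 2 * \<i> / of_nat n) * crit_factor n s / (1 + s\<^sup>2)"
    by (simp only: distrib_right add_divide_distrib)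
  also have "s - \<i> + - 2 * \<i> / of_nat n = s - \<i> * (1 + 2 / of_nat n)"
    by (simp add: algebra_simps)
  finally show ?thesis .
qed

lemma higher_deriv_crit_factor:
  fixes n :: nat
  defines "\<beta> \<equiv> 1 + 2 / complex_of_nat n"
  shows "deriv (crit_factor n) 0 = - \<i> * \<beta>" "(deriv ^^ 2) (crit_factor n) 0 = 1 - \<beta>\<^sup>2"
    "(deriv ^^ 3) (crit_factor n) 0 = - \<i> * \<beta> * (1 - \<beta>\<^sup>2)"
proof -
  define M where "M = crit_factor n"
  define M\<^sub>1 where "M\<^sub>1 s = (s - \<i> * \<beta>) * M s / (1 + s\<^sup>2)" for s
  define M\<^sub>2 where "M\<^sub>2 s = (1 - \<beta>\<^sup>2) * M s / (1 + s\<^sup>2)\<^sup>2" for s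
  have M: "(M has_field_derivative M\<^sub>1 s) (at s)" if "s \<in> ball 0 1" for s
    unfolding M_def M\<^sub>1_def \<beta>_def by (rule has_field_derivative_crit_factor[OF that])
  have M\<^sub>1: "(M\<^sub>1 has_field_derivative M\<^sub>2 s) (at s)" if s: "s \<in> ball 0 1" for s
  proof -
    have nz: "1 + s\<^sup>2 \<noteq> 0" by (rule one_plus_square_ball[OF s])
    have "(M\<^sub>1 has_field_derivative ((M s + (s - \<i> * \<beta>) * M\<^sub>1 s) * (1 + s\<^sup>2) - (s - \<i> * \<beta>) * M s * (2 * s))
        / ((1 + s\<^sup>2) * (1 + s\<^sup>2))) (at s)"
      unfolding M\<^sub>1_def[abs_def] by (rule derivative_eq_intros M[OF s, unfolded M\<^sub>1_def] refl nz | simp)+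
    moreover have "(M s + (s - \<i> * \<beta>) * M\<^sub>1 s) * (1 + s\<^sup>2) - (s - \<i> * \<beta>) * M s * (2 * s) = (1 - \<beta>\<^sup>2) * M s"
      using nz by (simp add: M\<^sub>1_def distrib_right) (simp add: algebra_simps power2_eq_square)
    ultimately show ?thesis
      by (simp add: M\<^sub>2_def power2_eq_square)
  qed
  have M\<^sub>2: "(M\<^sub>2 has_field_derivative (1 - \<beta>\<^sup>2) * M\<^sub>1 0) (at 0)"
    unfolding M\<^sub>2_def[abs_def] by (rule derivative_eq_intros M refl | simp)+
  have deriv_M: "deriv M s = M\<^sub>1 s" if "s \<in> ball 0 1" for s
    by (rule DERIV_imp_deriv[OF M[OF that]])
  have deriv2_M: "deriv (deriv M) s = M\<^sub>2 s" if "s \<in> ball 0 1" for s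
    by (rule DERIV_imp_deriv, rule has_field_derivative_transform_within_open[OF M\<^sub>1[OF that] open_ball that])
       (simp add: deriv_M)
  have deriv3_M: "deriv (deriv (deriv M)) 0 = (1 - \<beta>\<^sup>2) * M\<^sub>1 0"
    by (rule DERIV_imp_deriv, rule has_field_derivative_transform_within_open[OF M\<^sub>2 open_ball, of 0 1])
       (simp_all add: deriv2_M)
  have at_0: "M 0 = 1" "M\<^sub>1 0 = - \<i> * \<beta>" "M\<^sub>2 0 = 1 - \<beta>\<^sup>2"
    by (simp_all add: M_def M\<^sub>1_def M\<^sub>2_def)
  show "deriv (crit_factor n) 0 = - \<i> * \<beta>" "(deriv ^^ 2) (crit_factor n) 0 = 1 - \<beta>\<^sup>2"
    "(deriv ^^ 3) (crit_factor n) 0 = - \<i> * \<beta> * (1 - \<beta>\<^sup>2)"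
    using deriv_M[of 0] deriv2_M[of 0] deriv3_M unfolding at_0
    by (simp_all add: M_def numeral_2_eq_2 numeral_3_eq_3)
qed

lemma analytic_cayley_root: "cayley_root n analytic_on {0}"
  unfolding cayley_root_def divide_inverse by (intro analytic_intros) auto

lemma analytic_crit_factor: "crit_factor n analytic_on {0}"
  unfolding crit_factor_def by (intro analytic_intros analytic_cayley_root)

definition tangent_quotient :: "nat \<Rightarrow> complex \<Rightarrow> complex" where
  "tangent_quotient p Z = (\<Sum>k<p. \<Sum>j<k. Z ^ j)"

lemma power_eq_tangent_plus_quotient:
  "Z ^ p = 1 + of_nat p * (Z - 1) + (Z - 1)\<^sup>2 * tangent_quotient p Z"
proof -
  have "Z ^ p - 1 = (Z - 1) * (\<Sum>k<p. Z ^ k)"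
    by (rule power_diff_1_eq)
  also have "(\<Sum>k<p. Z ^ k) = (\<Sum>k<p. 1 + (Z - 1) * (\<Sum>j<k. Z ^ j))"
    by (simp add: power_diff_1_eq[symmetric])
  also have "(\<Sum>k<p. 1 + (Z - 1) * (\<Sum>j<k. Z ^ j)) = of_nat p + (Z - 1) * tangent_quotient p Z"
    by (simp add: sum.distrib tangent_quotient_def sum_distrib_left)
  finally show ?thesis
    by (simp add: algebra_simps power2_eq_square)
qed

lemma tangent_quotient_1: "tangent_quotient p 1 = of_nat (p * (p - 1)) / 2"
proof -
  have "2 * (\<Sum>k<p. k) = p * (p - 1)" by (induction p) (auto simp: algebra_simps)
  then have "2 * tangent_quotient p 1 = of_nat (p * (p - 1))"
    unfolding tangent_quotient_def by (simp flip: of_nat_sum of_nat_mult) (metis of_nat_mult of_nat_numeral)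
  then show ?thesis by (simp add: field_simps)
qed

lemma tangent_quotient_1_nonzero: "p \<ge> 2 \<Longrightarrow> tangent_quotient p 1 \<noteq> 0"
  by (auto simp: tangent_quotient_1)

definition normalized_coord :: "nat \<Rightarrow> complex \<Rightarrow> real \<times> complex \<Rightarrow> complex" where
  "normalized_coord p z\<^sub>0 y = snd y / (z\<^sub>0 * cayley_root (p - 1) (of_real (fst y)))"

definition morse_factor :: "nat \<Rightarrow> complex \<Rightarrow> real \<times> complex \<Rightarrow> complex" where
  "morse_factor p z\<^sub>0 y = csqrt (crit_factor (p - 1) (of_real (fst y))
     * tangent_quotient p (normalized_coord p z\<^sub>0 y) / tangent_quotient p 1)"

definition morse_coord :: "nat \<Rightarrow> complex \<Rightarrow> complex \<Rightarrow> real \<times> complex \<Rightarrow> complex" where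
  "morse_coord p z\<^sub>0 k y = k * (normalized_coord p z\<^sub>0 y - 1) * morse_factor p z\<^sub>0 y"

lemma morse_coord_0: "z\<^sub>0 \<noteq> 0 \<Longrightarrow> morse_coord p z\<^sub>0 k (0, z\<^sub>0) = 0"
  by (simp add: morse_coord_def normalized_coord_def)

lemma smooth_at_normalized_coord:
  assumes "z\<^sub>0 \<noteq> 0"
  shows "smooth_at (0, z\<^sub>0) (normalized_coord p z\<^sub>0)"
proof -
  have "smooth_at (0, z\<^sub>0) (\<lambda>y. cayley_root (p - 1) (of_real (fst y)))"
    by (intro smooth_at_analytic_compose[where h="cayley_root (p - 1)"] smooth_intros)
       (simp add: analytic_cayley_root)
  then show ?thesis
    unfolding normalized_coord_def by (intro smooth_intros) (use assms in auto)
qed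

lemma smooth_at_morse_factor:
  assumes "p \<ge> 2" "z\<^sub>0 \<noteq> 0"
  shows "smooth_at (0, z\<^sub>0) (morse_factor p z\<^sub>0)"
  unfolding morse_factor_def
proof (rule smooth_at_analytic_compose[where h=csqrt])
  have "smooth_at (0, z\<^sub>0) (\<lambda>y. crit_factor (p - 1) (of_real (fst y)))"
    by (intro smooth_at_analytic_compose[where h="crit_factor (p - 1)"] smooth_intros)
       (simp add: analytic_crit_factor)
  then show "smooth_at (0, z\<^sub>0) (\<lambda>y. crit_factor (p - 1) (of_real (fst y))
      * tangent_quotient p (normalized_coord p z\<^sub>0 y) / tangent_quotient p 1)"
    unfolding tangent_quotient_def[of p "normalized_coord p z\<^sub>0 _"]
    by (intro smooth_intros smooth_at_normalized_coord assms tangent_quotient_1_nonzero)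
qed (use assms in \<open>auto intro!: analytic_intros simp: normalized_coord_def tangent_quotient_1_nonzero\<close>)

lemma smooth_at_morse_coord:
  assumes "p \<ge> 2" "z\<^sub>0 \<noteq> 0"
  shows "smooth_at (0, z\<^sub>0) (morse_coord p z\<^sub>0 k)"
  unfolding morse_coord_def
  by (intro smooth_intros smooth_at_normalized_coord smooth_at_morse_factor assms)

lemma has_derivative_normalized_coord:
  assumes "z\<^sub>0 \<noteq> 0"
  shows "(normalized_coord p z\<^sub>0 has_derivative
     (\<lambda>h. snd h / z\<^sub>0 + 2 * \<i> / of_nat (p - 1) * of_real (fst h))) (at (0, z\<^sub>0))"
proof -
  let ?R = "\<lambda>y :: real \<times> complex. cayley_root (p - 1) (of_real (fst y))"
  have "(cayley_root (p - 1) has_derivative (*) (- 2 * \<i> / of_nat (p - 1))) (at (of_real (fst (0 :: real, z\<^sub>0))))"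
    using has_field_derivative_cayley_root[of 0 "p - 1"] by (simp add: has_field_derivative_def)
  then have dR: "(?R has_derivative (\<lambda>h. - 2 * \<i> / of_nat (p - 1) * of_real (fst h))) (at (0, z\<^sub>0))"
    by (rule has_derivative_compose[rotated]) (auto intro!: derivative_eq_intros)
  show ?thesis
    unfolding normalized_coord_def
    by (rule has_derivative_eq_rhs, (rule derivative_intros dR)+) (use assms in \<open>auto simp: fun_eq_iff field_simps\<close>)
qed

lemma has_derivative_morse_coord:
  assumes "p \<ge> 2" "z\<^sub>0 \<noteq> 0"
  shows "(morse_coord p z\<^sub>0 k has_derivative
     (\<lambda>h. k * (snd h / z\<^sub>0 + 2 * \<i> / of_nat (p - 1) * of_real (fst h)))) (at (0, z\<^sub>0))"
  unfolding morse_coord_def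
  by (rule has_derivative_eq_rhs, (rule has_derivative_mult has_derivative_diff has_derivative_const
        has_derivative_normalized_coord smooth_at_has_derivative[OF smooth_at_morse_factor] assms)+)
     (use assms in \<open>simp add: fun_eq_iff morse_factor_def normalized_coord_def tangent_quotient_1_nonzero\<close>)

definition harmonic_power :: "nat \<Rightarrow> complex \<Rightarrow> complex \<Rightarrow> complex" where
  "harmonic_power p a z = z ^ p + a * cnj z"

definition harmonic_deriv :: "nat \<Rightarrow> complex \<Rightarrow> complex \<Rightarrow> complex \<Rightarrow> complex" where
  "harmonic_deriv p a z h = of_nat p * z ^ (p - 1) * h + a * cnj h"

text \<open>The covector \<open>h \<mapsto> Re (c * h)\<close> annihilates the image of \<open>harmonic_deriv p a z\<close>.\<close>

definition conormal :: "nat \<Rightarrow> complex \<Rightarrow> complex \<Rightarrow> complex \<Rightarrow> bool" where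
  "conormal p a c z \<longleftrightarrow> c * of_nat p * z ^ (p - 1) = - cnj (c * a)"

lemma conormal_harmonic_deriv:
  assumes "conormal p a c z"
  shows "c * harmonic_deriv p a z h = 2 * \<i> * of_real (Im (c * of_nat p * z ^ (p - 1) * h))"
proof -
  define x where "x = c * of_nat p * z ^ (p - 1) * h"
  have "c * a * cnj h = - cnj x"
    using assms by (simp add: conormal_def x_def)
  then have "c * harmonic_deriv p a z h = x - cnj x"
    by (simp add: harmonic_deriv_def x_def distrib_left mult_ac)
  also have "\<dots> = 2 * \<i> * of_real (Im x)"
    by (simp add: complex_diff_cnj mult_ac)
  finally show ?thesis by (simp add: x_def)
qed

lemma conormal_harmonic_power:
  assumes "conormal p a c z" "p > 0"
  shows "c * harmonic_power p a z = c * z ^ p - of_nat p * cnj (c * z ^ p)"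
proof -
  have ca: "c * a = - cnj (c * of_nat p * z ^ (p - 1))"
    using assms(1) by (metis complex_cnj_cnj complex_cnj_minus conormal_def minus_minus)
  have "c * (a * cnj z) = - of_nat p * cnj (c * (z ^ (p - 1) * z))"
    unfolding mult.assoc[symmetric] ca by (simp add: mult_ac)
  also have "z ^ (p - 1) * z = z ^ p"
    by (rule power_minus_mult[OF assms(2)])
  finally show ?thesis
    by (simp add: harmonic_power_def distrib_left)
qed

lemma conormal_nonzero:
  assumes "conormal p a c z" "p \<ge> 2" "c \<noteq> 0" "a \<noteq> 0"
  shows "z \<noteq> 0"
  using assms by (auto simp: conormal_def power_0_left)

text \<open>The holomorphic function \<open>c (1 + i s) z\<^sup>p + cnj (c (1 + i s) a) z\<close> has a critical point at
  \<open>z\<^sub>0 * cayley_root (p - 1) s\<close>; \<open>critical_gap\<close> is the change of its critical value.\<close>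

definition critical_gap :: "nat \<Rightarrow> complex \<Rightarrow> complex \<Rightarrow> complex" where
  "critical_gap p A s = (1 - of_nat p) * A * crit_factor (p - 1) s - (1 + \<i> * s) * (A - of_nat p * cnj A)"

lemma conormal_cayley_root:
  assumes "conormal p a c z" "p \<ge> 2"
  shows "conormal p a (c * (1 + \<i> * of_real s)) (z * cayley_root (p - 1) (of_real s))"
proof -
  let ?R = "cayley_root (p - 1) (of_real s)"
  have "c * (1 + \<i> * of_real s) * of_nat p * (z * ?R) ^ (p - 1)
      = (c * of_nat p * z ^ (p - 1)) * ((1 + \<i> * of_real s) * ?R ^ (p - 1))"
    by (simp add: power_mult_distrib mult_ac)
  also have "(1 + \<i> * of_real s) * ?R ^ (p - 1) = 1 - \<i> * of_real s"
    using cayley_root_power[of "p - 1" s] assms(2) one_pm_i_times_of_real[of s] by simp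
  also have "c * of_nat p * z ^ (p - 1) = - cnj (c * a)"
    using assms(1) by (simp only: conormal_def)
  finally show ?thesis
    by (simp add: conormal_def)
qed

lemma Re_conormal_harmonic_power:
  assumes "conormal p a c z" "p > 0"
  shows "Re (c * harmonic_power p a (z * Z)) = Re (c * z ^ p * (Z ^ p - of_nat p * Z))"
proof -
  have "Re (c * (a * cnj (z * Z))) = Re (cnj (c * a) * (z * Z))"
    by (metis cnj.simps(1) complex_cnj_cnj complex_cnj_mult mult.assoc)
  also have "cnj (c * a) = - (c * of_nat p * z ^ (p - 1))"
    using assms(1) by (simp add: conormal_def)
  also have "- (c * of_nat p * z ^ (p - 1)) * (z * Z) = - (of_nat p * (c * (z ^ (p - 1) * z) * Z))"
    by (simp add: mult_ac)
  also have "z ^ (p - 1) * z = z ^ p"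
    by (rule power_minus_mult[OF assms(2)])
  finally show ?thesis
    by (simp add: harmonic_power_def power_mult_distrib algebra_simps)
qed

theorem harmonic_power_expansion:
  assumes p: "p \<ge> 2" and z0: "z\<^sub>0 \<noteq> 0" and con: "conormal p a c z\<^sub>0"
    and k: "j * k\<^sup>2 = c * z\<^sub>0 ^ p * tangent_quotient p 1"
  shows "Re (c * (1 + \<i> * of_real s) * (harmonic_power p a z - harmonic_power p a z\<^sub>0))
    = Re (critical_gap p (c * z\<^sub>0 ^ p) (of_real s)) + Re (j * (morse_coord p z\<^sub>0 k (s, z))\<^sup>2)"
proof -
  define z\<^sub>1 where "z\<^sub>1 = z\<^sub>0 * cayley_root (p - 1) (of_real s)"
  define Z where "Z = normalized_coord p z\<^sub>0 (s, z)"
  define C where "C = c * (1 + \<i> * of_real s)"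
  define M where "M = crit_factor (p - 1) (of_real s)"
  have z: "z = z\<^sub>1 * Z"
    using z0 by (simp add: Z_def normalized_coord_def z\<^sub>1_def)
  have crit_value: "C * z\<^sub>1 ^ p = c * z\<^sub>0 ^ p * M"
    using cayley_root_power_Suc[of "p - 1" s] p by (simp add: C_def z\<^sub>1_def M_def power_mult_distrib mult_ac)
  have "conormal p a C z\<^sub>1"
    unfolding C_def z\<^sub>1_def by (rule conormal_cayley_root[OF con p])
  then have "Re (C * harmonic_power p a z) = Re (C * z\<^sub>1 ^ p * (Z ^ p - of_nat p * Z))"
    unfolding z by (rule Re_conormal_harmonic_power) (use p in simp)
  also have "C * z\<^sub>1 ^ p * (Z ^ p - of_nat p * Z)
      = (1 - of_nat p) * (c * z\<^sub>0 ^ p) * M + (Z - 1)\<^sup>2 * (c * z\<^sub>0 ^ p * M * tangent_quotient p Z)"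
    unfolding crit_value power_eq_tangent_plus_quotient[of Z p] by (simp add: algebra_simps)
  also have "(Z - 1)\<^sup>2 * (c * z\<^sub>0 ^ p * M * tangent_quotient p Z) = j * (morse_coord p z\<^sub>0 k (s, z))\<^sup>2"
  proof -
    have "j * (morse_coord p z\<^sub>0 k (s, z))\<^sup>2 = (Z - 1)\<^sup>2 * (j * k\<^sup>2) * (M * tangent_quotient p Z / tangent_quotient p 1)"
      by (simp add: morse_coord_def morse_factor_def power_mult_distrib Z_def M_def)
    then show ?thesis
      unfolding k using tangent_quotient_1_nonzero[OF p] by (simp add: field_simps)
  qed
  finally have "Re (C * harmonic_power p a z)
      = Re ((1 - of_nat p) * (c * z\<^sub>0 ^ p) * M) + Re (j * (morse_coord p z\<^sub>0 k (s, z))\<^sup>2)"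
    by simp
  moreover have "C * harmonic_power p a z\<^sub>0 = (1 + \<i> * of_real s) * (c * z\<^sub>0 ^ p - of_nat p * cnj (c * z\<^sub>0 ^ p))"
    using conormal_harmonic_power[OF con] p by (simp add: C_def mult_ac)
  ultimately show ?thesis
    unfolding critical_gap_def C_def[symmetric] M_def[symmetric] right_diff_distrib by simp
qed

definition cusp_weight :: "nat \<Rightarrow> real" where
  "cusp_weight p = (real p + 1) / (real p - 1)"

definition hessian_value :: "nat \<Rightarrow> complex \<Rightarrow> complex" where
  "hessian_value p A = of_real (real p / (real p - 1)) * A"

lemma analytic_critical_gap: "critical_gap p A analytic_on {0}"
  unfolding critical_gap_def by (intro analytic_intros analytic_crit_factor)

lemma higher_deriv_critical_gap:
  "(deriv ^^ m) (critical_gap p A) 0 = (1 - of_nat p) * A * (deriv ^^ m) (crit_factor (p - 1)) 0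
    - (A - of_nat p * cnj A) * (if m = 0 then 1 else if m = 1 then \<i> else 0)"
proof -
  define G where "G = A - of_nat p * cnj A"
  define H where "H = (1 - of_nat p) * A"
  have "critical_gap p A = (\<lambda>s. H * crit_factor (p - 1) s - G * (1 + \<i> * s))"
    by (simp add: critical_gap_def G_def H_def mult.commute[of "1 + _"] fun_eq_iff)
  moreover have "(\<lambda>s. 1 + \<i> * s) analytic_on {0}"
    by (intro analytic_intros)
  ultimately have "(deriv ^^ m) (critical_gap p A) 0
      = H * (deriv ^^ m) (crit_factor (p - 1)) 0 - G * (deriv ^^ m) (\<lambda>s. 1 + \<i> * s) 0"
    using analytic_crit_factor[of "p - 1"]
    by (simp add: higher_deriv_diff_at higher_deriv_cmult' analytic_on_mult)
  also have "(deriv ^^ m) (\<lambda>s. 1 + \<i> * s) 0 = (if m = 0 then 1 else if m = 1 then \<i> else 0)"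
    by (subst higher_deriv_add_at) (auto intro!: analytic_intros)
  finally show ?thesis
    unfolding G_def H_def .
qed

theorem Re_higher_deriv_critical_gap:
  assumes p: "p \<ge> 2"
  shows "Re (critical_gap p A 0) = 0" "Re (deriv (critical_gap p A) 0) = 0"
    "Re ((deriv ^^ 2) (critical_gap p A) 0) = 4 * Re (hessian_value p A)"
    "Re ((deriv ^^ 3) (critical_gap p A) 0) = 4 * (cusp_weight p * Im (hessian_value p A))"
proof -
  define n where "n = real p - 1"
  have n: "n \<noteq> 0" "real p = n + 1" "complex_of_nat (p - 1) = of_real n" "complex_of_nat p = of_real n + 1"
    using p by (auto simp: n_def of_nat_diff)
  define \<beta> where "\<beta> = cusp_weight p"
  have \<beta>: "1 + 2 / complex_of_nat (p - 1) = of_real \<beta>"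
    using n by (simp add: \<beta>_def cusp_weight_def n_def[symmetric] field_simps)
  have n\<beta>: "n * \<beta> = n + 2" and n\<beta>2: "n * (1 - \<beta>\<^sup>2) = - 4 * (real p / n)"
    using n(1) by (auto simp: \<beta>_def cusp_weight_def n(2) power_divide field_simps power2_eq_square)
  note gap = higher_deriv_critical_gap[of _ p A] and crit = higher_deriv_crit_factor[of "p - 1", unfolded \<beta>]
  have "critical_gap p A 0 = of_nat p * (cnj A - A)"
    using gap[of 0] by (simp add: algebra_simps)
  then show "Re (critical_gap p A 0) = 0"
    by simp
  have "deriv (critical_gap p A) 0 = \<i> * (of_real (n * \<beta>) * A - (A - of_nat p * cnj A))"
    using gap[of 1] crit(1) by (simp add: n(4) algebra_simps)
  also have "of_real (n * \<beta>) * A - (A - of_nat p * cnj A) = of_real (real p) * (A + cnj A)"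
    unfolding n\<beta> by (simp add: n_def algebra_simps)
  finally show "Re (deriv (critical_gap p A) 0) = 0"
    by simp
  have "(deriv ^^ 2) (critical_gap p A) 0 = - of_real (n * (1 - \<beta>\<^sup>2)) * A"
    using gap[of 2] crit(2) by (simp add: n(4))
  then have second: "(deriv ^^ 2) (critical_gap p A) 0 = 4 * hessian_value p A"
    unfolding n\<beta>2 hessian_value_def n_def[symmetric] by simp
  then show "Re ((deriv ^^ 2) (critical_gap p A) 0) = 4 * Re (hessian_value p A)"
    by simp
  have "(deriv ^^ 3) (critical_gap p A) 0 = - \<i> * of_real \<beta> * (deriv ^^ 2) (critical_gap p A) 0"
    using gap[of 2] gap[of 3] crit(2,3) by simp
  then show "Re ((deriv ^^ 3) (critical_gap p A) 0) = 4 * (cusp_weight p * Im (hessian_value p A))"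
    unfolding second by (simp add: \<beta>_def)
qed

section \<open>The germ at a singular point\<close>

definition mixed_map :: "nat \<Rightarrow> nat \<Rightarrow> complex \<Rightarrow> complex \<Rightarrow> complex \<times> complex \<Rightarrow> complex" where
  "mixed_map p q a b y = harmonic_power p a (fst y) + harmonic_power q b (snd y)"

lemma has_derivative_mixed_map:
  "(mixed_map p q a b has_derivative
      (\<lambda>h. harmonic_deriv p a (fst y) (fst h) + harmonic_deriv q b (snd y) (snd h))) (at y)"
  unfolding mixed_map_def harmonic_power_def harmonic_deriv_def
  by (rule has_derivative_eq_rhs, (rule derivative_intros)+) (auto simp: fun_eq_iff algebra_simps)

lemma smooth_at_mixed_map: "smooth_at y (mixed_map p q a b)"
  unfolding mixed_map_def harmonic_power_def by (intro smooth_intros)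

lemma imaginary_times_square_root:
  assumes "x \<noteq> (0::complex)"
  obtains j k where "j = \<i> \<or> j = - \<i>" "j * k\<^sup>2 = x" "Im k \<noteq> 0"
proof -
  define k where "k = csqrt (x / \<i>)"
  have k: "\<i> * k\<^sup>2 = x" by (simp add: k_def)
  then have "k \<noteq> 0" using assms by auto
  show ?thesis
  proof (cases "Im k = 0")
    case False
    then show ?thesis using that[of \<i> k] k by simp
  next
    case True
    then have "Re k \<noteq> 0" using \<open>k \<noteq> 0\<close> by (simp add: complex_eq_iff)
    then show ?thesis using that[of "- \<i>" "\<i> * k"] k by (simp add: power_mult_distrib)
  qed
qed

lemma slope_function:
  assumes q: "q \<ge> 2" and w0: "w\<^sub>0 \<noteq> 0" and k: "Im k \<noteq> 0"
  obtains S S' where "smooth_at w\<^sub>0 S" "S w\<^sub>0 = (0::real)" "(S has_derivative S') (at w\<^sub>0)"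
    "\<And>h. Re (k * (h / w\<^sub>0 + 2 * \<i> / of_nat (q - 1) * of_real (S' h))) = 0"
    "\<forall>\<^sub>F w in nhds w\<^sub>0. Re (morse_coord q w\<^sub>0 k (S w, w)) = 0"
proof -
  define F' where "F' h = Re (k * (snd h / w\<^sub>0 + 2 * \<i> / of_nat (q - 1) * of_real (fst h)))" for h :: "real \<times> complex"
  have F: "smooth_at (0, w\<^sub>0) (\<lambda>y. Re (morse_coord q w\<^sub>0 k y))"
    by (intro smooth_intros smooth_at_morse_coord q w0)
  have dF: "((\<lambda>y. Re (morse_coord q w\<^sub>0 k y)) has_derivative F') (at (0, w\<^sub>0))"
    unfolding F'_def by (intro has_derivative_Re has_derivative_morse_coord q w0)
  have partial: "s = 0" if "F' (s, 0) = 0" for s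
  proof -
    have "F' (s, 0) = - (2 / real (q - 1) * s * Im k)"
      by (simp add: F'_def)
    then show ?thesis using that k q by simp
  qed
  obtain S S' where "smooth_at w\<^sub>0 S" "S w\<^sub>0 = (0::real)" "(S has_derivative S') (at w\<^sub>0)" "\<And>h. F' (S' h, h) = 0"
    "\<forall>\<^sub>F w in nhds w\<^sub>0. Re (morse_coord q w\<^sub>0 k (S w, w)) = Re (morse_coord q w\<^sub>0 k (0, w\<^sub>0))"
    by (rule smooth_implicit_function[OF F dF]) (erule partial, rule that)
  then show ?thesis
    using that by (simp add: F'_def morse_coord_0[OF w0])
qed

lemma conormal_direction_eq_0:
  assumes q: "q \<ge> 2" and w0: "w\<^sub>0 \<noteq> 0"
    and j: "j = \<i> \<or> j = - \<i>" and k: "j * k\<^sup>2 = c * w\<^sub>0 ^ q * tangent_quotient q 1" "Im k \<noteq> 0"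
    and h: "Im (c * of_nat q * w\<^sub>0 ^ (q - 1) * h) = 0" "Re (k * (h / w\<^sub>0)) = 0"
  shows "h = 0"
proof -
  define \<delta> where "\<delta> = h / w\<^sub>0"
  have h_eq: "h = w\<^sub>0 * \<delta>" using w0 by (simp add: \<delta>_def)
  have Im_of_real_mult: "Im (of_real r * x) = r * Im x" for r x
    by simp
  define t where "t = Im (k * \<delta>)"
  have k\<delta>: "k * \<delta> = \<i> * of_real t"
    using h(2) by (simp add: complex_eq_iff \<delta>_def t_def)
  have "of_nat (q - 1) * (c * of_nat q * w\<^sub>0 ^ (q - 1) * h) = of_nat (q * (q - 1)) * (c * (w\<^sub>0 ^ (q - 1) * w\<^sub>0)) * \<delta>"
    by (simp add: h_eq mult_ac)
  also have "w\<^sub>0 ^ (q - 1) * w\<^sub>0 = w\<^sub>0 ^ q"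
    by (rule power_minus_mult) (use q in simp)
  also have "of_nat (q * (q - 1)) * (c * w\<^sub>0 ^ q) * \<delta> = 2 * (j * k\<^sup>2) * \<delta>"
    unfolding k(1) tangent_quotient_1 by simp
  also have "\<dots> = of_real 2 * (j * k * (k * \<delta>))"
    by (simp add: power2_eq_square)
  finally have "real (q - 1) * Im (c * of_nat q * w\<^sub>0 ^ (q - 1) * h) = 2 * Im (j * k * (k * \<delta>))"
    by (metis Im_of_real_mult of_real_of_nat_eq)
  then have "Im (j * k * (\<i> * of_real t)) = 0"
    unfolding k\<delta> h(1) by simp
  then have "t = 0"
    using j k(2) by auto
  then have "\<delta> = 0"
    using k\<delta> k(2) by auto
  then show ?thesis
    by (simp add: h_eq)
qed

locale conormal_point =
  fixes p q :: nat and a b c z\<^sub>0 w\<^sub>0 :: complex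
  assumes p: "p \<ge> 2" and q: "q \<ge> 2" and nonzero: "c \<noteq> 0" "z\<^sub>0 \<noteq> 0" "w\<^sub>0 \<noteq> 0"
    and con: "conormal p a c z\<^sub>0" "conormal q b c w\<^sub>0"
begin

abbreviation g :: "complex \<times> complex \<Rightarrow> complex" where
  "g \<equiv> mixed_map p q a b"

definition K :: "complex \<Rightarrow> complex" where
  "K s = critical_gap p (c * z\<^sub>0 ^ p) s + critical_gap q (c * w\<^sub>0 ^ q) s"

definition target_coord :: "complex \<Rightarrow> real \<times> real" where
  "target_coord y = (Im (c * (y - g (z\<^sub>0, w\<^sub>0))), Re (c * (y - g (z\<^sub>0, w\<^sub>0))))"

lemma local_diffeo_at_target_coord: "local_diffeo_at y target_coord"
proof (rule local_diffeo_atI)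
  show "smooth_at y target_coord"
    unfolding target_coord_def by (intro smooth_intros)
  show "(target_coord has_derivative (\<lambda>h. (Im (c * h), Re (c * h)))) (at y)"
    unfolding target_coord_def by (rule has_derivative_eq_rhs, (rule derivative_intros)+) auto
  show "h = 0" if "(Im (c * h), Re (c * h)) = 0" for h
  proof -
    have "c * h = 0"
      using that by (simp only: complex_eq_iff prod_eq_iff fst_conv snd_conv fst_zero snd_zero zero_complex.sel)
    then show ?thesis using nonzero(1) by simp
  qed
qed

end

locale adapted_slope = conormal_point +
  fixes k\<^sub>z j k\<^sub>w :: complex and S :: "complex \<Rightarrow> real" and S' :: "complex \<Rightarrow> real"
  assumes k\<^sub>z: "1 * k\<^sub>z\<^sup>2 = c * z\<^sub>0 ^ p * tangent_quotient p 1"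
    and j: "j = \<i> \<or> j = - \<i>" and k\<^sub>w: "j * k\<^sub>w\<^sup>2 = c * w\<^sub>0 ^ q * tangent_quotient q 1" "Im k\<^sub>w \<noteq> 0"
    and S: "smooth_at w\<^sub>0 S" "S w\<^sub>0 = 0" "(S has_derivative S') (at w\<^sub>0)"
    and S'_slope: "\<And>h. Re (k\<^sub>w * (h / w\<^sub>0 + 2 * \<i> / of_nat (q - 1) * of_real (S' h))) = 0"
    and S_slope: "\<forall>\<^sub>F w in nhds w\<^sub>0. Re (morse_coord q w\<^sub>0 k\<^sub>w (S w, w)) = 0"
begin

definition \<zeta> :: "complex \<times> complex \<Rightarrow> complex" where
  "\<zeta> y = morse_coord p z\<^sub>0 k\<^sub>z (S (snd y), fst y)"

definition source_coord :: "complex \<times> complex \<Rightarrow> real \<times> real \<times> real \<times> real" where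
  "source_coord y = (Im (c * (g y - g (z\<^sub>0, w\<^sub>0))), S (snd y), Re (\<zeta> y), Im (\<zeta> y))"

lemma S_snd:
  "smooth_at (z\<^sub>0, w\<^sub>0) (\<lambda>y. S (snd y))"
  "((\<lambda>y. S (snd y)) has_derivative (\<lambda>h. S' (snd h))) (at (z\<^sub>0, w\<^sub>0))"
proof -
  show "smooth_at (z\<^sub>0, w\<^sub>0) (\<lambda>y. S (snd y))"
    by (rule smooth_at_compose[where g=S and f=snd]) (auto intro!: smooth_intros S)
  show "((\<lambda>y. S (snd y)) has_derivative (\<lambda>h. S' (snd h))) (at (z\<^sub>0, w\<^sub>0))"
    by (rule has_derivative_compose[where g=S and f=snd]) (auto intro!: derivative_eq_intros S)
qed

lemma smooth_at_\<zeta>: "smooth_at (z\<^sub>0, w\<^sub>0) \<zeta>"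
  unfolding \<zeta>_def
  by (rule smooth_at_compose[where g="morse_coord p z\<^sub>0 k\<^sub>z" and f="\<lambda>y. (S (snd y), fst y)"])
     (auto intro!: smooth_intros S_snd smooth_at_morse_coord p nonzero simp: S)

lemma has_derivative_\<zeta>:
  "(\<zeta> has_derivative (\<lambda>h. k\<^sub>z * (fst h / z\<^sub>0 + 2 * \<i> / of_nat (p - 1) * of_real (S' (snd h))))) (at (z\<^sub>0, w\<^sub>0))"
proof -
  have dS: "((\<lambda>y. (S (snd y), fst y)) has_derivative (\<lambda>h. (S' (snd h), fst h))) (at (z\<^sub>0, w\<^sub>0))"
    by (intro derivative_intros S_snd)
  have "(morse_coord p z\<^sub>0 k\<^sub>z has_derivative
      (\<lambda>h. k\<^sub>z * (snd h / z\<^sub>0 + 2 * \<i> / of_nat (p - 1) * of_real (fst h)))) (at (S (snd (z\<^sub>0, w\<^sub>0)), fst (z\<^sub>0, w\<^sub>0)))"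
    using has_derivative_morse_coord[OF p nonzero(2), of k\<^sub>z] by (simp only: S fst_conv snd_conv)
  from has_derivative_compose[OF dS this] show ?thesis
    unfolding \<zeta>_def[abs_def] by (simp only: fst_conv snd_conv)
qed

lemma source_coord_0: "source_coord (z\<^sub>0, w\<^sub>0) = 0"
  by (simp add: source_coord_def \<zeta>_def S(2) morse_coord_0 nonzero zero_prod_def)

lemma local_diffeo_at_source_coord: "local_diffeo_at (z\<^sub>0, w\<^sub>0) source_coord"
proof (rule local_diffeo_atI)
  define D where "D h = harmonic_deriv p a z\<^sub>0 (fst h) + harmonic_deriv q b w\<^sub>0 (snd h)" for h
  define \<zeta>' where "\<zeta>' h = k\<^sub>z * (fst h / z\<^sub>0 + 2 * \<i> / of_nat (p - 1) * of_real (S' (snd h)))" for h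
  have dg: "(g has_derivative D) (at (z\<^sub>0, w\<^sub>0))"
    unfolding D_def using has_derivative_mixed_map[of p q a b "(z\<^sub>0, w\<^sub>0)"] by simp
  have d\<zeta>: "(\<zeta> has_derivative \<zeta>') (at (z\<^sub>0, w\<^sub>0))"
    unfolding \<zeta>'_def by (rule has_derivative_\<zeta>)
  show "smooth_at (z\<^sub>0, w\<^sub>0) source_coord"
    unfolding source_coord_def by (intro smooth_intros S_snd smooth_at_\<zeta> smooth_at_mixed_map)
  show "(source_coord has_derivative (\<lambda>h. (Im (c * D h), S' (snd h), Re (\<zeta>' h), Im (\<zeta>' h)))) (at (z\<^sub>0, w\<^sub>0))"
    unfolding source_coord_def
    by (rule has_derivative_eq_rhs, (rule derivative_intros S_snd d\<zeta> dg)+) (auto simp: fun_eq_iff)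
  show "h = 0" if "(Im (c * D h), S' (snd h), Re (\<zeta>' h), Im (\<zeta>' h)) = 0" for h
  proof -
    have h: "Im (c * D h) = 0" "S' (snd h) = 0" "\<zeta>' h = 0"
      using that by (simp_all only: prod_eq_iff complex_eq_iff fst_conv snd_conv fst_zero snd_zero zero_complex.sel)
    have "k\<^sub>z \<noteq> 0"
      using k\<^sub>z nonzero tangent_quotient_1_nonzero[OF p] by auto
    then have fst_h: "fst h = 0"
      using h(2,3) nonzero(2) by (simp add: \<zeta>'_def)
    have "snd h = 0"
    proof (rule conormal_direction_eq_0[OF q nonzero(3) j k\<^sub>w])
      have "c * D h = 2 * \<i> * of_real (Im (c * of_nat q * w\<^sub>0 ^ (q - 1) * snd h))"
        using conormal_harmonic_deriv[OF con(2)] fst_h by (simp add: D_def harmonic_deriv_def)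
      then show "Im (c * of_nat q * w\<^sub>0 ^ (q - 1) * snd h) = 0"
        using h(1) by simp
      show "Re (k\<^sub>w * (snd h / w\<^sub>0)) = 0"
        using S'_slope[of "snd h"] h(2) by simp
    qed
    then show ?thesis
      using fst_h by (simp add: prod_eq_iff)
  qed
qed

lemma target_coord_eq_quad_map:
  assumes "Re (morse_coord q w\<^sub>0 k\<^sub>w (S (snd y), snd y)) = 0"
  shows "target_coord (g y) = quad_map K (source_coord y)"
proof -
  define s where "s = S (snd y)"
  define u where "u = c * (g y - g (z\<^sub>0, w\<^sub>0))"
  have "c * (1 + \<i> * of_real s) * (g y - g (z\<^sub>0, w\<^sub>0))
      = c * (1 + \<i> * of_real s) * (harmonic_power p a (fst y) - harmonic_power p a z\<^sub>0)
        + c * (1 + \<i> * of_real s) * (harmonic_power q b (snd y) - harmonic_power q b w\<^sub>0)"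
    by (simp add: mixed_map_def algebra_simps)
  then have "Re (c * (1 + \<i> * of_real s) * (g y - g (z\<^sub>0, w\<^sub>0)))
      = Re (c * (1 + \<i> * of_real s) * (harmonic_power p a (fst y) - harmonic_power p a z\<^sub>0))
        + Re (c * (1 + \<i> * of_real s) * (harmonic_power q b (snd y) - harmonic_power q b w\<^sub>0))"
    by (simp only: plus_complex.sel)
  also have "\<dots> = Re (K (of_real s)) + Re ((\<zeta> y)\<^sup>2) + Re (j * (morse_coord q w\<^sub>0 k\<^sub>w (s, snd y))\<^sup>2)"
    unfolding harmonic_power_expansion[OF p nonzero(2) con(1) k\<^sub>z] harmonic_power_expansion[OF q nonzero(3) con(2) k\<^sub>w(1)]
    by (simp add: K_def \<zeta>_def s_def)
  also have "Re (j * (morse_coord q w\<^sub>0 k\<^sub>w (s, snd y))\<^sup>2) = 0"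
    using assms j by (auto simp: power2_eq_square s_def)
  also have "c * (1 + \<i> * of_real s) * (g y - g (z\<^sub>0, w\<^sub>0)) = (1 + \<i> * of_real s) * u"
    by (simp add: u_def)
  finally have "Re u = s * Im u + Re (K (of_real s)) + (Re (\<zeta> y))\<^sup>2 - (Im (\<zeta> y))\<^sup>2"
    by (simp add: power2_eq_square)
  then show ?thesis
    by (simp add: target_coord_def source_coord_def quad_map_def u_def[symmetric] s_def)
qed

lemma germ_equiv_quad_map: "germ_equiv g (z\<^sub>0, w\<^sub>0) (quad_map K) 0"
proof (rule germ_equivI[OF local_diffeo_at_source_coord source_coord_0 local_diffeo_at_target_coord])
  have "isCont snd (z\<^sub>0, w\<^sub>0)" by (intro continuous_intros)
  then have "\<forall>\<^sub>F y in nhds (z\<^sub>0, w\<^sub>0). Re (morse_coord q w\<^sub>0 k\<^sub>w (S (snd y), snd y)) = 0"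
    by (rule eventually_nhds_isCont[where P="\<lambda>w. Re (morse_coord q w\<^sub>0 k\<^sub>w (S w, w)) = 0"]) (simp add: S_slope)
  then show "\<forall>\<^sub>F y in nhds (z\<^sub>0, w\<^sub>0). target_coord (g y) = quad_map K (source_coord y)"
    by eventually_elim (rule target_coord_eq_quad_map)
qed

end

context conormal_point
begin

theorem germ_equiv_quad_map: "germ_equiv g (z\<^sub>0, w\<^sub>0) (quad_map K) 0"
proof -
  have "c * w\<^sub>0 ^ q * tangent_quotient q 1 \<noteq> 0"
    using nonzero tangent_quotient_1_nonzero[OF q] by simp
  then obtain j k where j: "j = \<i> \<or> j = - \<i>" and k: "j * k\<^sup>2 = c * w\<^sub>0 ^ q * tangent_quotient q 1" "Im k \<noteq> 0"
    by (rule imaginary_times_square_root)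
  obtain S S' where "smooth_at w\<^sub>0 S" "S w\<^sub>0 = 0" "(S has_derivative S') (at w\<^sub>0)"
    "\<And>h. Re (k * (h / w\<^sub>0 + 2 * \<i> / of_nat (q - 1) * of_real (S' h))) = 0"
    "\<forall>\<^sub>F w in nhds w\<^sub>0. Re (morse_coord q w\<^sub>0 k (S w, w)) = 0"
    by (rule slope_function[OF q nonzero(3) k(2)]) (rule that)
  then interpret adapted_slope p q a b c z\<^sub>0 w\<^sub>0 "csqrt (c * z\<^sub>0 ^ p * tangent_quotient p 1)" j k S S'
    by unfold_locales (use j k in simp_all)
  show ?thesis by (rule germ_equiv_quad_map)
qed

lemma analytic_K: "K analytic_on {0}"
  unfolding K_def[abs_def] by (intro analytic_intros analytic_critical_gap)

lemma higher_deriv_K: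
  "Re (K 0) = 0" "Re (deriv K 0) = 0"
  "Re ((deriv ^^ 2) K 0) = 4 * (Re (hessian_value p (c * z\<^sub>0 ^ p)) + Re (hessian_value q (c * w\<^sub>0 ^ q)))"
  "Re ((deriv ^^ 3) K 0) = 4 * (cusp_weight p * Im (hessian_value p (c * z\<^sub>0 ^ p))
    + cusp_weight q * Im (hessian_value q (c * w\<^sub>0 ^ q)))"
proof -
  have K: "(deriv ^^ m) K 0 = (deriv ^^ m) (critical_gap p (c * z\<^sub>0 ^ p)) 0
      + (deriv ^^ m) (critical_gap q (c * w\<^sub>0 ^ q)) 0" for m
    unfolding K_def[abs_def] by (rule higher_deriv_add_at[OF analytic_critical_gap analytic_critical_gap])
  show "Re (K 0) = 0" "Re (deriv K 0) = 0"
    using K[of 0] K[of 1] Re_higher_deriv_critical_gap(1,2)[OF p] Re_higher_deriv_critical_gap(1,2)[OF q] by simp_all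
  show "Re ((deriv ^^ 2) K 0) = 4 * (Re (hessian_value p (c * z\<^sub>0 ^ p)) + Re (hessian_value q (c * w\<^sub>0 ^ q)))"
    by (simp add: K Re_higher_deriv_critical_gap(3) p q)
  show "Re ((deriv ^^ 3) K 0) = 4 * (cusp_weight p * Im (hessian_value p (c * z\<^sub>0 ^ p))
      + cusp_weight q * Im (hessian_value q (c * w\<^sub>0 ^ q)))"
    by (simp add: K Re_higher_deriv_critical_gap(4) p q)
qed

lemma isCont_g: "isCont g y"
  by (rule smooth_at_isCont[OF smooth_at_mixed_map])

theorem indefinite_fold:
  assumes "Re (hessian_value p (c * z\<^sub>0 ^ p)) + Re (hessian_value q (c * w\<^sub>0 ^ q)) \<noteq> 0"
  shows "has_local_form g indefinite_fold_form (z\<^sub>0, w\<^sub>0)"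
proof (rule has_local_form_if_germ_equiv[OF germ_equiv_trans[OF germ_equiv_quad_map] _ isCont_g])
  show "germ_equiv (quad_map K) 0 indefinite_fold_form 0"
    by (rule quad_map_indefinite_fold[OF analytic_K]) (use higher_deriv_K assms in simp_all)
qed (simp add: indefinite_fold_form_def vec_eq_iff forall_2)

theorem cusp:
  assumes "Re (hessian_value p (c * z\<^sub>0 ^ p)) + Re (hessian_value q (c * w\<^sub>0 ^ q)) = 0"
    and "cusp_weight p * Im (hessian_value p (c * z\<^sub>0 ^ p)) + cusp_weight q * Im (hessian_value q (c * w\<^sub>0 ^ q)) \<noteq> 0"
  shows "has_local_form g cusp_minus_form (z\<^sub>0, w\<^sub>0)"
proof (rule has_local_form_if_germ_equiv[OF germ_equiv_trans[OF germ_equiv_quad_map] _ isCont_g])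
  show "germ_equiv (quad_map K) 0 cusp_minus_form 0"
    by (rule quad_map_cusp[OF analytic_K]) (use higher_deriv_K assms in simp_all)
qed (simp add: cusp_minus_form_def vec_eq_iff forall_2)

end

section \<open>Excellence of the nondegenerate maps\<close>

lemma surjective_linear_complement_coordinates:
  fixes D :: "'a::euclidean_space \<Rightarrow> 'b::euclidean_space"
  assumes D: "linear D" "surj D" and dim: "DIM('a) = DIM('b) + DIM('c::euclidean_space)"
  obtains l :: "'a \<Rightarrow> 'c::euclidean_space" where "linear l" "\<And>h. D h = 0 \<Longrightarrow> l h = 0 \<Longrightarrow> h = 0"
proof -
  define N where "N = {h. D h = 0}"
  have N: "subspace N" unfolding N_def by (rule linear_subspace_kernel[OF D(1)])
  have adj: "linear (adjoint D)" by (rule adjoint_linear[OF D(1)])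
  have "inj (adjoint D)"
    unfolding linear_injective_0[OF adj]
  proof (intro allI impI)
    fix y assume "adjoint D y = 0"
    then have "D x \<bullet> y = 0" for x using adjoint_works[OF D(1), of x y] by simp
    then show "y = 0" using D(2) by (metis inner_eq_zero_iff surjD)
  qed
  then have "dim (range (adjoint D)) = DIM('b)"
    using dim_image_eq[OF adj, of UNIV] by simp
  moreover have "dim {y \<in> UNIV. \<forall>x \<in> range (adjoint D). orthogonal x y} + dim (range (adjoint D)) = dim (UNIV :: 'a set)"
    by (rule dim_subspace_orthogonal_to_vectors) (auto intro: linear_subspace_image[OF adj] subspace_UNIV)
  moreover have "{y \<in> UNIV. \<forall>x \<in> range (adjoint D). orthogonal x y} = N"
    unfolding N_def orthogonal_def
    by (auto simp: adjoint_clauses[OF D(1)]) (metis inner_eq_zero_iff)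
  ultimately have "dim N \<le> dim (UNIV :: 'c set)"
    using dim by simp
  then obtain l :: "'a \<Rightarrow> 'c" where l: "linear l" "\<And>x. x \<in> N \<Longrightarrow> norm (l x) = norm x"
    by (rule isometry_subset_subspace[OF N subspace_UNIV]) blast
  show ?thesis
    by (rule that[OF l(1)]) (use l(2) in \<open>force simp: N_def\<close>)
qed

lemma not_singular_point_imp_surj:
  assumes "(g has_derivative D) (at x)" "\<not> singular_point g x"
  shows "surj D"
proof -
  have "frechet_derivative g (at x) = D"
    by (rule frechet_derivative_at[OF assms(1), symmetric])
  then have "dim (range D) = DIM(complex)"
    using assms(2) dim_subset_UNIV[of "range D"] by (simp add: singular_point_def)
  then show ?thesis
    using dim_eq_full[of "range D"] linear_subspace_image[OF has_derivative_linear[OF assms(1)] subspace_UNIV] span_eq_iff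
    by metis
qed

theorem regular_point_normal_form:
  assumes smooth: "smooth_at x g" and regular: "\<not> singular_point g x"
  shows "has_local_form g regular_form x"
proof -
  define D where "D = frechet_derivative g (at x)"
  have dg: "(g has_derivative D) (at x)" unfolding D_def by (rule smooth_at_has_derivative[OF smooth])
  have D: "linear D" by (rule has_derivative_linear[OF dg])
  obtain l :: "complex \<times> complex \<Rightarrow> real \<times> real"
    where l: "linear l" "\<And>h. D h = 0 \<Longrightarrow> l h = 0 \<Longrightarrow> h = 0"
    by (rule surjective_linear_complement_coordinates[OF D not_singular_point_imp_surj[OF dg regular],
          where 'c="real \<times> real"]) auto
  have bounded_l: "bounded_linear l" using l(1) by (simp add: linear_conv_bounded_linear)
  define \<phi> where "\<phi> y = (Re (g y - g x), Im (g y - g x), l (y - x))" for y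
  define \<psi> where "\<psi> y = (Re (y - g x), Im (y - g x))" for y
  have "germ_equiv g x regular_form 0"
  proof (rule germ_equiv_vecI)
    show "local_diffeo_at x \<phi>"
    proof (rule local_diffeo_atI)
      show "smooth_at x \<phi>"
        unfolding \<phi>_def by (intro smooth_intros smooth smooth_at_linear_compose[OF bounded_l])
      show "(\<phi> has_derivative (\<lambda>h. (Re (D h), Im (D h), l h))) (at x)"
        unfolding \<phi>_def
        by (rule has_derivative_eq_rhs, (rule derivative_intros dg bounded_linear.has_derivative[OF bounded_l])+) auto
      show "h = 0" if "(Re (D h), Im (D h), l h) = 0" for h
        using that l(2)[of h] by (auto simp: prod_eq_iff complex_eq_iff)
    qed
    show "local_diffeo_at (g x) \<psi>"
    proof (rule local_diffeo_atI)
      show "smooth_at (g x) \<psi>" unfolding \<psi>_def by (intro smooth_intros)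
      show "(\<psi> has_derivative (\<lambda>h. (Re h, Im h))) (at (g x))"
        unfolding \<psi>_def by (rule has_derivative_eq_rhs, (rule derivative_intros)+) auto
    qed (auto simp: prod_eq_iff complex_eq_iff)
    show "\<phi> x = 0"
      using linear_0[OF l(1)] by (simp add: \<phi>_def zero_prod_def)
    show "\<forall>\<^sub>F y in nhds x. vec2 (\<psi> (g y)) = regular_form (vec4 (\<phi> y))"
      by (simp add: vec2_def vec4_def \<phi>_def \<psi>_def regular_form_def vector_4 split: prod.split)
  qed
  then show ?thesis
    by (rule has_local_form_if_germ_equiv)
       (simp_all add: regular_form_def vec_eq_iff forall_2 smooth_at_isCont[OF smooth])
qed

lemma Re_linear_form_eq_0:
  assumes "\<And>h. Re (u * h + v * cnj h) = 0"
  shows "u = - cnj v"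
  using assms[of 1] assms[of \<i>] by (simp add: complex_eq_iff)

lemma singular_point_mixed_map_conormal:
  assumes "singular_point (mixed_map p q a b) (z, w)"
  obtains c where "cmod c = 1" "conormal p a c z" "conormal q b c w"
proof -
  define D where "D h = harmonic_deriv p a z (fst h) + harmonic_deriv q b w (snd h)" for h
  have "(mixed_map p q a b has_derivative D) (at (z, w))"
    using has_derivative_mixed_map[of p q a b "(z, w)"] by (simp add: D_def[abs_def])
  then have "frechet_derivative (mixed_map p q a b) (at (z, w)) = D"
    by (rule frechet_derivative_at[symmetric])
  then have "dim (range D) < DIM(complex)" using assms by (simp add: singular_point_def)
  then obtain n where n: "n \<noteq> 0" "\<And>y. y \<in> span (range D) \<Longrightarrow> orthogonal n y"
    using orthogonal_to_subspace_exists by blast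
  define c where "c = cnj n / of_real (cmod n)"
  have "cmod c = 1" using n(1) by (simp add: c_def norm_divide)
  have cD: "Re (c * D h) = 0" for h
  proof -
    have "n \<bullet> D h = 0" using n(2)[of "D h"] span_base[of "D h" "range D"] by (simp add: orthogonal_def)
    moreover have "Re (c * D h) = (n \<bullet> D h) / cmod n"
      by (simp add: c_def inner_complex_def add_divide_distrib)
    ultimately show ?thesis by simp
  qed
  have "Re (c * of_nat p * z ^ (p - 1) * h + c * a * cnj h) = 0" for h
    using cD[of "(h, 0)"] by (simp add: D_def harmonic_deriv_def distrib_left mult.assoc)
  moreover have "Re (c * of_nat q * w ^ (q - 1) * h + c * b * cnj h) = 0" for h
    using cD[of "(0, h)"] by (simp add: D_def harmonic_deriv_def distrib_left mult.assoc)
  ultimately show ?thesis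
    using that[OF \<open>cmod c = 1\<close>] Re_linear_form_eq_0 unfolding conormal_def by blast
qed

definition degenerate_point :: "nat \<Rightarrow> nat \<Rightarrow> complex \<Rightarrow> complex \<Rightarrow> complex \<Rightarrow> complex \<Rightarrow> complex \<Rightarrow> bool" where
  "degenerate_point p q a b c z w \<longleftrightarrow> conormal p a c z \<and> conormal q b c w
     \<and> Re (hessian_value p (c * z ^ p)) + Re (hessian_value q (c * w ^ q)) = 0
     \<and> cusp_weight p * Im (hessian_value p (c * z ^ p)) + cusp_weight q * Im (hessian_value q (c * w ^ q)) = 0"

definition degenerate :: "nat \<Rightarrow> nat \<Rightarrow> complex \<Rightarrow> complex \<Rightarrow> bool" where
  "degenerate p q a b \<longleftrightarrow> (\<exists>c z w. cmod c = 1 \<and> degenerate_point p q a b c z w)"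

theorem singular_point_mixed_map_normal_form:
  assumes "p \<ge> 2" "q \<ge> 2" "a \<noteq> 0" "b \<noteq> 0" "\<not> degenerate p q a b" "singular_point (mixed_map p q a b) x"
  shows "has_local_form (mixed_map p q a b) indefinite_fold_form x \<or> is_cusp (mixed_map p q a b) x"
proof -
  obtain z w where x: "x = (z, w)" by (cases x)
  obtain c where c: "cmod c = 1" "conormal p a c z" "conormal q b c w"
    by (rule singular_point_mixed_map_conormal[OF assms(6)[unfolded x]])
  have "c \<noteq> 0" using c(1) by auto
  then interpret conormal_point p q a b c z w
    using assms(1-4) c(2,3) conormal_nonzero by unfold_locales blast+
  have "\<not> degenerate_point p q a b c z w"
    using assms(5) c(1) by (auto simp: degenerate_def)
  then show ?thesis
    using indefinite_fold cusp con unfolding degenerate_point_def is_cusp_def x by blast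
qed

theorem excellent_mixed_map:
  assumes "p \<ge> 2" "q \<ge> 2" "a \<noteq> 0" "b \<noteq> 0" "\<not> degenerate p q a b"
  shows "excellent_map (mixed_map p q a b)"
  unfolding excellent_map_def smooth_on_iff_smooth_at
  using regular_point_normal_form[OF smooth_at_mixed_map] singular_point_mixed_map_normal_form[OF assms]
    smooth_at_mixed_map open_UNIV by blast

lemma conormal_scale:
  assumes "s \<noteq> 0"
  shows "conormal p (of_real (s ^ (p - 1)) * a) c (of_real s * z) \<longleftrightarrow> conormal p a c z"
proof -
  have "of_real (s ^ (p - 1)) * (c * of_nat p * z ^ (p - 1)) = of_real (s ^ (p - 1)) * - cnj (c * a)
      \<longleftrightarrow> c * of_nat p * z ^ (p - 1) = - cnj (c * a)"
    using assms by (intro mult_left_cancel) simp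
  then show ?thesis
    by (simp add: conormal_def power_mult_distrib mult_ac)
qed

lemma hessian_value_scale: "hessian_value p (of_real r * A) = of_real r * hessian_value p A"
  by (simp add: hessian_value_def)

lemma degenerate_scale:
  assumes t: "t \<noteq> 0" and "degenerate p q (of_real ((t ^ q) ^ (p - 1)) * a) (of_real ((t ^ p) ^ (q - 1)) * b)"
  shows "degenerate p q a b"
proof -
  obtain c z w where c: "cmod c = 1"
    and dg: "degenerate_point p q (of_real ((t ^ q) ^ (p - 1)) * a) (of_real ((t ^ p) ^ (q - 1)) * b) c z w"
    using assms(2) by (auto simp: degenerate_def)
  define z' w' where "z' = z / of_real (t ^ q)" and "w' = w / of_real (t ^ p)"
  have z: "z = of_real (t ^ q) * z'" and w: "w = of_real (t ^ p) * w'"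
    using t by (auto simp: z'_def w'_def)
  define r where "r = t ^ (p * q)"
  have nonzero: "r \<noteq> 0" "t ^ q \<noteq> 0" "t ^ p \<noteq> 0"
    using t by (simp_all add: r_def)
  have "c * z ^ p = of_real r * (c * z' ^ p)" "c * w ^ q = of_real r * (c * w' ^ q)"
    by (simp_all add: z w r_def power_mult_distrib mult_ac flip: power_mult)
  then have H: "hessian_value p (c * z ^ p) = of_real r * hessian_value p (c * z' ^ p)"
      "hessian_value q (c * w ^ q) = of_real r * hessian_value q (c * w' ^ q)"
    by (simp_all only: hessian_value_scale)
  have "r * (Re (hessian_value p (c * z' ^ p)) + Re (hessian_value q (c * w' ^ q))) = 0"
    and "r * (cusp_weight p * Im (hessian_value p (c * z' ^ p)) + cusp_weight q * Im (hessian_value q (c * w' ^ q))) = 0"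
    using dg unfolding degenerate_point_def H by (simp_all add: algebra_simps)
  moreover have "conormal p a c z'" "conormal q b c w'"
    using dg unfolding degenerate_point_def z w conormal_scale[OF nonzero(2)] conormal_scale[OF nonzero(3)] by blast+
  ultimately have "degenerate_point p q a b c z' w'"
    using nonzero(1) unfolding degenerate_point_def by simp
  then show ?thesis
    using c by (auto simp: degenerate_def)
qed

lemma real_analytic_fun_on_monomial: "real_analytic_fun_on U (\<lambda>t. of_real (t ^ n) * a)"
  unfolding real_analytic_fun_on_def
proof (intro ballI exI[of _ "1::real"] conjI)
  fix t0 :: real
  define C where "C k = (if k \<le> n then of_real (real (n choose k) * t0 ^ (n - k)) * a else 0)" for k
  have "((\<lambda>k. C k * of_real ((t - t0) ^ k)) has_sum of_real (t ^ n) * a) UNIV" for t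
  proof (rule has_sum_finite_neutralI[where B="{..n}"])
    have "t ^ n = (\<Sum>k\<le>n. real (n choose k) * (t - t0) ^ k * t0 ^ (n - k))"
      using binomial_ring[of "t - t0" t0 n] by simp
    then show "of_real (t ^ n) * a = (\<Sum>k\<le>n. C k * of_real ((t - t0) ^ k))"
      by (simp add: C_def sum_distrib_left mult_ac)
  qed (auto simp: C_def)
  then show "\<exists>c. \<forall>t\<in>ball t0 1. ((\<lambda>k. c k * of_real ((t - t0) ^ k)) has_sum of_real (t ^ n) * a) UNIV"
    by blast
qed simp

lemma is_linear_deformation_coeffs_monomial:
  "n > 0 \<Longrightarrow> is_linear_deformation_coeffs (\<lambda>t. of_real (t ^ n) * a)"
  unfolding is_linear_deformation_coeffs_def real_analytic_on_unit_interval_def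
  using real_analytic_fun_on_monomial open_UNIV by (auto simp: power_0_left)

section \<open>Real-analytic functions of several variables\<close>

definition multi_monomial :: "real ^ 'n \<Rightarrow> ('n \<Rightarrow> nat) \<Rightarrow> real" where
  "multi_monomial h \<alpha> = (\<Prod>i\<in>UNIV. h $ i ^ \<alpha> i)"

lemma multi_monomial_add: "multi_monomial h (\<lambda>i. \<alpha> i + \<beta> i) = multi_monomial h \<alpha> * multi_monomial h \<beta>"
  by (simp add: multi_monomial_def power_add prod.distrib)

definition multi_expansion :: "(real ^ 'n \<Rightarrow> real) \<Rightarrow> real ^ 'n \<Rightarrow> real \<Rightarrow> (('n \<Rightarrow> nat) \<Rightarrow> real) \<Rightarrow> bool" where
  "multi_expansion g x r c \<longleftrightarrow> (\<forall>y\<in>ball x r. ((\<lambda>\<alpha>. c \<alpha> * multi_monomial (y - x) \<alpha>) has_sum g y) UNIV)"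

lemma real_analytic_multi_on_iff:
  "real_analytic_multi_on U g \<longleftrightarrow> (\<forall>x\<in>U. \<exists>r>0. \<exists>c. multi_expansion g x r c)"
  by (simp add: real_analytic_multi_on_def multi_expansion_def multi_monomial_def)

lemma real_analytic_multi_on_common_ball:
  assumes "real_analytic_multi_on U f" "real_analytic_multi_on U g" "x \<in> U"
  obtains r c d where "r > 0" "multi_expansion f x r c" "multi_expansion g x r d"
proof -
  obtain r\<^sub>1 c where f: "r\<^sub>1 > 0" "multi_expansion f x r\<^sub>1 c"
    using assms(1,3) unfolding real_analytic_multi_on_iff by blast
  obtain r\<^sub>2 d where g: "r\<^sub>2 > 0" "multi_expansion g x r\<^sub>2 d"
    using assms(2,3) unfolding real_analytic_multi_on_iff by blast
  show ?thesis
    by (rule that[of "min r\<^sub>1 r\<^sub>2" c d]) (use f g in \<open>auto simp: multi_expansion_def\<close>)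
qed

lemma real_analytic_multi_on_add:
  assumes "real_analytic_multi_on U f" "real_analytic_multi_on U g"
  shows "real_analytic_multi_on U (\<lambda>y. f y + g y)"
  unfolding real_analytic_multi_on_iff
proof
  fix x assume "x \<in> U"
  then obtain r c d where "r > 0" "multi_expansion f x r c" "multi_expansion g x r d"
    by (rule real_analytic_multi_on_common_ball[OF assms])
  moreover from this have "multi_expansion (\<lambda>y. f y + g y) x r (\<lambda>\<alpha>. c \<alpha> + d \<alpha>)"
    by (simp add: multi_expansion_def distrib_right has_sum_add)
  ultimately show "\<exists>r>0. \<exists>c. multi_expansion (\<lambda>y. f y + g y) x r c"
    by blast
qed

lemma has_sum_product_real:
  fixes x y :: "_ \<Rightarrow> real"
  assumes x: "(x has_sum X) A" and y: "(y has_sum Y) B"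
  shows "((\<lambda>(\<alpha>, \<beta>). x \<alpha> * y \<beta>) has_sum X * Y) (A \<times> B)"
proof (rule has_sum_SigmaI)
  show "((\<lambda>\<beta>. case (\<alpha>, \<beta>) of (\<alpha>, \<beta>) \<Rightarrow> x \<alpha> * y \<beta>) has_sum x \<alpha> * Y) B" for \<alpha>
    using has_sum_cmult_right[OF y] by simp
  show "((\<lambda>\<alpha>. x \<alpha> * Y) has_sum X * Y) A" by (rule has_sum_cmult_left[OF x])
  have abs_x: "(\<lambda>\<alpha>. \<bar>x \<alpha>\<bar>) summable_on A" and abs_y: "(\<lambda>\<beta>. \<bar>y \<beta>\<bar>) summable_on B"
    using x y summable_on_iff_abs_summable_on_real by (auto simp: summable_on_def)
  have "(\<lambda>(\<alpha>, \<beta>). \<bar>x \<alpha>\<bar> * \<bar>y \<beta>\<bar>) summable_on A \<times> B"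
  proof (rule summable_on_SigmaI)
    show "((\<lambda>\<beta>. case (\<alpha>, \<beta>) of (\<alpha>, \<beta>) \<Rightarrow> \<bar>x \<alpha>\<bar> * \<bar>y \<beta>\<bar>) has_sum \<bar>x \<alpha>\<bar> * infsum (\<lambda>\<beta>. \<bar>y \<beta>\<bar>) B) B" for \<alpha>
      using has_sum_cmult_right[OF has_sum_infsum[OF abs_y]] by simp
    show "(\<lambda>\<alpha>. \<bar>x \<alpha>\<bar> * infsum (\<lambda>\<beta>. \<bar>y \<beta>\<bar>) B) summable_on A"
      by (rule summable_on_cmult_left[OF abs_x])
  qed auto
  then have "(\<lambda>p. norm (case p of (\<alpha>, \<beta>) \<Rightarrow> x \<alpha> * y \<beta>)) summable_on A \<times> B"
    by (simp add: case_prod_unfold abs_mult)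
  then show "(\<lambda>(\<alpha>, \<beta>). x \<alpha> * y \<beta>) summable_on A \<times> B"
    by (rule abs_summable_summable)
qed

lemma finite_multi_index_splittings: "finite {(\<alpha>, \<beta>). (\<lambda>i. \<alpha> i + \<beta> i) = (\<gamma> :: 'n::finite \<Rightarrow> nat)}"
proof (rule finite_subset)
  have "{\<alpha>. \<forall>i. \<alpha> i \<le> \<gamma> i} = PiE UNIV (\<lambda>i. {..\<gamma> i})" by (auto simp: PiE_def Pi_def)
  then show "finite ({\<alpha>. \<forall>i. \<alpha> i \<le> \<gamma> i} \<times> {\<alpha>. \<forall>i. \<alpha> i \<le> \<gamma> i})" by (simp add: finite_PiE)
qed auto

lemma multi_expansion_mult:
  fixes f g :: "real ^ 'n \<Rightarrow> real"
  assumes f: "multi_expansion f x r c" and g: "multi_expansion g x r d"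
  shows "multi_expansion (\<lambda>y. f y * g y) x r
    (\<lambda>\<gamma>. \<Sum>(\<alpha>, \<beta>)\<in>{(\<alpha>, \<beta>). (\<lambda>i. \<alpha> i + \<beta> i) = \<gamma>}. c \<alpha> * d \<beta>)"
  unfolding multi_expansion_def
proof
  fix y assume y: "y \<in> ball x r"
  let ?m = "multi_monomial (y - x)"
  define F where "F \<gamma> = {(\<alpha>, \<beta>). (\<lambda>i. \<alpha> i + \<beta> i) = (\<gamma> :: 'n \<Rightarrow> nat)}" for \<gamma>
  have "((\<lambda>(\<alpha>, \<beta>). (c \<alpha> * ?m \<alpha>) * (d \<beta> * ?m \<beta>)) has_sum f y * g y) (UNIV \<times> UNIV)"
    using f g y unfolding multi_expansion_def by (intro has_sum_product_real) auto
  also have "?this \<longleftrightarrow> ((\<lambda>(\<gamma>, (\<alpha>, \<beta>)). (c \<alpha> * ?m \<alpha>) * (d \<beta> * ?m \<beta>)) has_sum f y * g y) (Sigma UNIV F)"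
    by (rule has_sum_reindex_bij_witness[where i=snd and j="\<lambda>p. (\<lambda>i. fst p i + snd p i, p)"])
       (auto simp: F_def)
  finally have "((\<lambda>\<gamma>. \<Sum>(\<alpha>, \<beta>)\<in>F \<gamma>. (c \<alpha> * ?m \<alpha>) * (d \<beta> * ?m \<beta>)) has_sum f y * g y) UNIV"
  proof (rule has_sum_SigmaD)
    show "((\<lambda>p. case (\<gamma>, p) of (\<gamma>, \<alpha>, \<beta>) \<Rightarrow> c \<alpha> * ?m \<alpha> * (d \<beta> * ?m \<beta>)) has_sum
        (\<Sum>(\<alpha>, \<beta>)\<in>F \<gamma>. c \<alpha> * ?m \<alpha> * (d \<beta> * ?m \<beta>))) (F \<gamma>)" for \<gamma>
      by (rule has_sum_finiteI) (auto simp: F_def finite_multi_index_splittings)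
  qed
  moreover have "(\<Sum>(\<alpha>, \<beta>)\<in>F \<gamma>. (c \<alpha> * ?m \<alpha>) * (d \<beta> * ?m \<beta>)) = (\<Sum>(\<alpha>, \<beta>)\<in>F \<gamma>. c \<alpha> * d \<beta>) * ?m \<gamma>" for \<gamma>
    unfolding sum_distrib_right by (rule sum.cong) (auto simp: F_def multi_monomial_add)
  ultimately show "((\<lambda>\<gamma>. (\<Sum>(\<alpha>, \<beta>)\<in>{(\<alpha>, \<beta>). (\<lambda>i. \<alpha> i + \<beta> i) = \<gamma>}. c \<alpha> * d \<beta>) * ?m \<gamma>) has_sum f y * g y) UNIV"
    unfolding F_def by simp
qed

lemma real_analytic_multi_on_mult:
  assumes "real_analytic_multi_on U f" "real_analytic_multi_on U g"
  shows "real_analytic_multi_on U (\<lambda>y. f y * g y)"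
  unfolding real_analytic_multi_on_iff
proof
  fix x assume "x \<in> U"
  then obtain r c d where "r > 0" "multi_expansion f x r c" "multi_expansion g x r d"
    by (rule real_analytic_multi_on_common_ball[OF assms])
  then show "\<exists>r>0. \<exists>c. multi_expansion (\<lambda>y. f y * g y) x r c"
    using multi_expansion_mult by blast
qed

lemma real_analytic_multi_on_component:
  fixes f :: "real \<Rightarrow> real" and i :: "'n::finite"
  assumes "\<And>t\<^sub>0. \<exists>r>0. \<exists>c. \<forall>t\<in>ball t\<^sub>0 r. ((\<lambda>n. c n * (t - t\<^sub>0) ^ n) has_sum f t) UNIV"
  shows "real_analytic_multi_on U (\<lambda>y :: real ^ 'n. f (y $ i))"
  unfolding real_analytic_multi_on_iff
proof
  fix x :: "real ^ 'n"
  obtain r c where r: "r > 0" and c: "\<And>t. t \<in> ball (x $ i) r \<Longrightarrow> ((\<lambda>n. c n * (t - x $ i) ^ n) has_sum f t) UNIV"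
    using assms by metis
  define e where "e n = (\<lambda>j. if j = i then n else (0::nat))" for n
  define c' where "c' \<alpha> = (if \<alpha> = e (\<alpha> i) then c (\<alpha> i) else 0)" for \<alpha>
  have e_i: "e n i = n" for n by (simp add: e_def)
  have monomial: "multi_monomial h (e n) = h $ i ^ n" for h n
  proof -
    have "multi_monomial h (e n) = (\<Prod>j\<in>UNIV. if j = i then h $ i ^ n else 1)"
      unfolding multi_monomial_def by (rule prod.cong) (auto simp: e_def)
    then show ?thesis by simp
  qed
  have "multi_expansion (\<lambda>y. f (y $ i)) x r c'"
    unfolding multi_expansion_def
  proof
    fix y assume "y \<in> ball x r"
    then have "y $ i \<in> ball (x $ i) r"
      using component_le_norm_cart[of "x - y" i] by (simp add: dist_norm)
    then have "((\<lambda>n. c n * (y - x) $ i ^ n) has_sum f (y $ i)) UNIV"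
      using c by simp
    also have "?this \<longleftrightarrow> ((\<lambda>\<alpha>. c' \<alpha> * multi_monomial (y - x) \<alpha>) has_sum f (y $ i)) (range e)"
      by (rule has_sum_reindex_bij_witness[where i="\<lambda>\<alpha>. \<alpha> i" and j=e]) (auto simp: e_i c'_def monomial)
    also have "\<dots> \<longleftrightarrow> ((\<lambda>\<alpha>. c' \<alpha> * multi_monomial (y - x) \<alpha>) has_sum f (y $ i)) UNIV"
      by (rule has_sum_cong_neutral) (auto simp: c'_def)
    finally show "((\<lambda>\<alpha>. c' \<alpha> * multi_monomial (y - x) \<alpha>) has_sum f (y $ i)) UNIV" .
  qed
  then show "\<exists>r>0. \<exists>c. multi_expansion (\<lambda>y. f (y $ i)) x r c"
    using r by blast
qed

lemma real_analytic_multi_on_const: "real_analytic_multi_on U (\<lambda>y :: real ^ 'n. k)"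
proof (rule real_analytic_multi_on_component[where f="\<lambda>_. k"])
  show "\<exists>r>0. \<exists>c. \<forall>t\<in>ball t\<^sub>0 r. ((\<lambda>n. c n * (t - t\<^sub>0) ^ n) has_sum k) UNIV" for t\<^sub>0 :: real
    by (intro exI[of _ 1] conjI exI[of _ "\<lambda>n. if n = 0 then k else 0"] ballI has_sum_finite_neutralI[where B="{0}"]) auto
qed

lemma real_analytic_multi_on_nth: "real_analytic_multi_on U (\<lambda>y :: real ^ 'n. y $ i)"
proof (rule real_analytic_multi_on_component[where f="\<lambda>t. t"])
  show "\<exists>r>0. \<exists>c. \<forall>t\<in>ball t\<^sub>0 r. ((\<lambda>n. c n * (t - t\<^sub>0) ^ n) has_sum t) UNIV" for t\<^sub>0 :: real
    by (intro exI[of _ 1] conjI exI[of _ "\<lambda>n. if n = 0 then t\<^sub>0 else if n = 1 then 1 else 0"] ballI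
        has_sum_finite_neutralI[where B="{0, 1}"]) auto
qed

lemma has_sum_cos_coeff: "((\<lambda>n. cos_coeff n * h ^ n) has_sum cos h) UNIV"
  and has_sum_sin_coeff: "((\<lambda>n. sin_coeff n * h ^ n) has_sum sin h) UNIV"
  using norm_summable_imp_has_sum[OF summable_norm_cos[of h] cos_converges[of h]]
    norm_summable_imp_has_sum[OF summable_norm_sin[of h] sin_converges[of h]] by simp_all

lemma real_analytic_multi_on_cos_affine:
  "real_analytic_multi_on U (\<lambda>y :: real ^ 'n. cos (k * y $ i + s))"
proof (rule real_analytic_multi_on_component[where f="\<lambda>t. cos (k * t + s)"])
  fix t\<^sub>0 :: real
  define \<theta> where "\<theta> = k * t\<^sub>0 + s"
  have "((\<lambda>n. (cos \<theta> * cos_coeff n + - sin \<theta> * sin_coeff n) * k ^ n * (t - t\<^sub>0) ^ n) has_sum cos (k * t + s)) UNIV" for t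
  proof -
    have "((\<lambda>n. cos \<theta> * (cos_coeff n * (k * (t - t\<^sub>0)) ^ n) + - sin \<theta> * (sin_coeff n * (k * (t - t\<^sub>0)) ^ n))
       has_sum cos \<theta> * cos (k * (t - t\<^sub>0)) + - sin \<theta> * sin (k * (t - t\<^sub>0))) UNIV"
      by (intro has_sum_add has_sum_cmult_right has_sum_cos_coeff has_sum_sin_coeff)
    moreover have "cos \<theta> * cos (k * (t - t\<^sub>0)) + - sin \<theta> * sin (k * (t - t\<^sub>0)) = cos (\<theta> + k * (t - t\<^sub>0))"
      by (simp add: cos_add)
    moreover have "\<theta> + k * (t - t\<^sub>0) = k * t + s"
      by (simp add: \<theta>_def algebra_simps)
    ultimately show ?thesis
      by (simp add: power_mult_distrib distrib_right left_diff_distrib mult.assoc)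
  qed
  then show "\<exists>r>0. \<exists>c. \<forall>t\<in>ball t\<^sub>0 r. ((\<lambda>n. c n * (t - t\<^sub>0) ^ n) has_sum cos (k * t + s)) UNIV"
    by (intro exI[of _ 1] conjI exI[of _ "\<lambda>n. (cos \<theta> * cos_coeff n + - sin \<theta> * sin_coeff n) * k ^ n"]) auto
qed

lemma real_analytic_multi_on_cos_sin:
  "real_analytic_multi_on U (\<lambda>y :: real ^ 'n. cos (k * y $ i))"
  "real_analytic_multi_on U (\<lambda>y :: real ^ 'n. sin (k * y $ i))"
  using real_analytic_multi_on_cos_affine[of U k i 0] real_analytic_multi_on_cos_affine[of U k i "- pi / 2"]
  by (simp_all add: cos_diff)

named_theorems real_analytic_intros

lemmas [real_analytic_intros] = real_analytic_multi_on_add real_analytic_multi_on_mult real_analytic_multi_on_const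
  real_analytic_multi_on_nth real_analytic_multi_on_cos_sin

lemma real_analytic_multi_on_diff [real_analytic_intros]:
  assumes "real_analytic_multi_on U f" "real_analytic_multi_on U g"
  shows "real_analytic_multi_on U (\<lambda>y. f y - g y)"
proof -
  have "real_analytic_multi_on U (\<lambda>y. f y + (- 1) * g y)"
    by (intro real_analytic_intros assms)
  then show ?thesis by simp
qed

lemma real_analytic_multi_on_power [real_analytic_intros]:
  "real_analytic_multi_on U f \<Longrightarrow> real_analytic_multi_on U (\<lambda>y. f y ^ n)"
  by (induction n) (auto intro: real_analytic_intros)

definition complex_analytic_multi_on :: "(real ^ 'n) set \<Rightarrow> (real ^ 'n \<Rightarrow> complex) \<Rightarrow> bool" where
  "complex_analytic_multi_on U f \<longleftrightarrow> real_analytic_multi_on U (\<lambda>y. Re (f y)) \<and> real_analytic_multi_on U (\<lambda>y. Im (f y))"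

lemma complex_analytic_multi_on_of_real:
  "real_analytic_multi_on U f \<Longrightarrow> complex_analytic_multi_on U (\<lambda>y. of_real (f y))"
  by (simp add: complex_analytic_multi_on_def real_analytic_multi_on_const)

lemma complex_analytic_multi_on_const: "complex_analytic_multi_on U (\<lambda>y. k)"
  by (simp add: complex_analytic_multi_on_def real_analytic_multi_on_const)

lemma complex_analytic_multi_on_add:
  "complex_analytic_multi_on U f \<Longrightarrow> complex_analytic_multi_on U g \<Longrightarrow> complex_analytic_multi_on U (\<lambda>y. f y + g y)"
  by (simp add: complex_analytic_multi_on_def real_analytic_intros)

lemma complex_analytic_multi_on_mult:
  "complex_analytic_multi_on U f \<Longrightarrow> complex_analytic_multi_on U g \<Longrightarrow> complex_analytic_multi_on U (\<lambda>y. f y * g y)"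
  by (simp add: complex_analytic_multi_on_def real_analytic_intros)

lemma complex_analytic_multi_on_sum:
  "(\<And>i. i \<in> I \<Longrightarrow> complex_analytic_multi_on U (f i)) \<Longrightarrow> complex_analytic_multi_on U (\<lambda>y. \<Sum>i\<in>I. f i y)"
  by (induction I rule: infinite_finite_induct)
     (auto intro: complex_analytic_multi_on_add complex_analytic_multi_on_const)

lemma complex_analytic_multi_on_poly:
  "complex_analytic_multi_on U f \<Longrightarrow> complex_analytic_multi_on U (\<lambda>y. poly P (f y))"
  by (induction P)
     (simp_all add: complex_analytic_multi_on_const complex_analytic_multi_on_add complex_analytic_multi_on_mult)

lemma complex_analytic_multi_on_power:
  "complex_analytic_multi_on U f \<Longrightarrow> complex_analytic_multi_on U (\<lambda>y. f y ^ n)"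
  by (induction n) (simp_all add: complex_analytic_multi_on_const complex_analytic_multi_on_mult)

lemma real_analytic_multi_on_cmod_square:
  "complex_analytic_multi_on U f \<Longrightarrow> real_analytic_multi_on U (\<lambda>y. (cmod (f y))\<^sup>2)"
  by (simp add: complex_analytic_multi_on_def cmod_power2 real_analytic_intros)

section \<open>Elimination of the singular point\<close>

fun chebyshev :: "nat \<Rightarrow> 'a::comm_ring_1 poly" where
  "chebyshev 0 = 1"
| "chebyshev (Suc 0) = [:0, 1:]"
| "chebyshev (Suc (Suc n)) = [:0, 2:] * chebyshev (Suc n) - chebyshev n"

lemma poly_chebyshev_Re:
  assumes "cmod u = 1"
  shows "poly (chebyshev n) (complex_of_real (Re u)) = of_real (Re (u ^ n))"
proof (induction n rule: chebyshev.induct)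
  case (3 n)
  have "u * cnj u = 1" using assms by (metis complex_norm_square of_real_1 one_power2)
  then have "u ^ Suc (Suc n) + u ^ n = (u + cnj u) * u ^ Suc n" by (simp add: algebra_simps)
  also have "\<dots> = of_real (2 * Re u) * u ^ Suc n" by (simp add: complex_add_cnj)
  finally have "Re (u ^ Suc (Suc n) + u ^ n) = 2 * Re u * Re (u ^ Suc n)" by simp
  then have "Re (u ^ Suc (Suc n)) = 2 * Re u * Re (u ^ Suc n) - Re (u ^ n)" by simp
  then show ?case
    using 3 by (simp del: power_Suc)
qed auto

lemma degree_chebyshev: "degree (chebyshev n :: complex poly) = n"
proof (induction n rule: chebyshev.induct)
  case (3 n)
  have "chebyshev (Suc n) \<noteq> (0 :: complex poly)" using 3(1) by auto
  then have "degree ([:0, 2:] * chebyshev (Suc n) :: complex poly) = Suc (Suc n)"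
    using 3(1) by (subst degree_mult_eq) auto
  then show ?case
    using 3(2) degree_add_eq_left[of "- chebyshev n :: complex poly" "[:0, 2:] * chebyshev (Suc n)"]
    by (simp del: mult_pCons_left)
qed auto

lemma poly_eq_poly_power:
  fixes P :: "'a::idom poly"
  assumes N: "N > 0" and \<zeta>: "\<And>i. \<zeta> ^ i = 1 \<longleftrightarrow> N dvd i" and P: "pcompose P [:0, \<zeta>:] = P"
  obtains H where "\<And>x. poly H (x ^ N) = poly P x"
proof -
  have coeff_0: "coeff P i = 0" if "\<not> N dvd i" for i
    using arg_cong[OF P, of "\<lambda>P. coeff P i"] \<zeta>[of i] that by (auto simp: coeff_pcompose_linear)
  define H where "H = (\<Sum>j\<le>degree P. monom (coeff P (N * j)) j)"
  have "poly H (x ^ N) = poly P x" for x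
  proof -
    have "poly H (x ^ N) = (\<Sum>j\<le>degree P. coeff P (N * j) * x ^ (N * j))"
      by (simp add: H_def poly_sum poly_monom power_mult)
    also have "\<dots> = (\<Sum>i\<in>(*) N ` {..degree P}. coeff P i * x ^ i)"
      by (subst sum.reindex) (use N in \<open>auto simp: inj_on_def\<close>)
    also have "\<dots> = (\<Sum>i\<in>(*) N ` {..degree P} \<union> {..degree P}. coeff P i * x ^ i)"
    proof (rule sum.mono_neutral_left)
      show "\<forall>i\<in>(*) N ` {..degree P} \<union> {..degree P} - (*) N ` {..degree P}. coeff P i * x ^ i = 0"
      proof
        fix i assume i: "i \<in> (*) N ` {..degree P} \<union> {..degree P} - (*) N ` {..degree P}"
        have "\<not> N dvd i"
        proof
          assume "N dvd i"
          then obtain j where j: "i = N * j" by (rule dvdE)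
          then have "j \<le> i" using N by simp
          then show False using i j by (metis DiffE UnE atMost_iff imageI order_trans)
        qed
        then show "coeff P i * x ^ i = 0" by (simp add: coeff_0)
      qed
    qed auto
    also have "\<dots> = (\<Sum>i\<le>degree P. coeff P i * x ^ i)"
      by (rule sum.mono_neutral_right) (auto simp: coeff_eq_0)
    finally show ?thesis by (simp add: poly_altdef)
  qed
  then show ?thesis by (rule that)
qed

lemma poly_prod_over_roots_of_unity:
  fixes F :: "'a::idom poly"
  assumes N: "N > 0" and \<zeta>: "\<And>i. \<zeta> ^ i = 1 \<longleftrightarrow> N dvd i"
  obtains H where "\<And>x. poly H (x ^ N) = (\<Prod>k<N. poly F (\<zeta> ^ k * x))"
proof -
  define P where "P = (\<Prod>k<N. pcompose F [:0, \<zeta> ^ k:])"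
  obtain M where M: "N = Suc M" using N by (cases N) auto
  have "pcompose P [:0, \<zeta>:] = (\<Prod>k<N. pcompose F [:0, \<zeta> ^ Suc k:])"
    unfolding P_def pcompose_prod by (simp flip: pcompose_assoc add: pcompose_pCons mult.commute)
  also have "\<dots> = pcompose F [:0, \<zeta> ^ N:] * (\<Prod>k<M. pcompose F [:0, \<zeta> ^ Suc k:])"
    unfolding M by (simp add: mult.commute)
  also have "\<zeta> ^ N = \<zeta> ^ 0"
    using \<zeta>[of N] by simp
  also have "pcompose F [:0, \<zeta> ^ 0:] * (\<Prod>k<M. pcompose F [:0, \<zeta> ^ Suc k:]) = P"
    unfolding P_def M prod.lessThan_Suc_shift by simp
  finally have "pcompose P [:0, \<zeta>:] = P" .
  then obtain H where "\<And>x. poly H (x ^ N) = poly P x"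
    using poly_eq_poly_power[OF N \<zeta>] by blast
  then show ?thesis
    by (intro that[of H]) (simp add: P_def poly_prod poly_pcompose mult.commute)
qed

lemma pcompose_constant: "pcompose P [:x:] = [:poly P x:]"
  by (induction P) (simp_all add: pcompose_pCons mult.commute)

text \<open>The inner variable of a polynomial in \<open>complex poly poly\<close> is the cosine \<open>c\<close>, the outer one the ratio \<open>x\<close>
  to be eliminated.\<close>

definition poly2 :: "complex poly poly \<Rightarrow> complex \<Rightarrow> complex \<Rightarrow> complex" where
  "poly2 E x c = poly (poly E [:x:]) c"

lemma poly2_norm:
  assumes "N > 0"
  obtains H where "\<And>x c. poly2 H (x ^ N) c = (\<Prod>k<N. poly2 E (exp (2 * of_real pi * \<i> / of_nat N) ^ k * x) c)"
proof -
  define \<zeta> where "\<zeta> = exp (2 * of_real pi * \<i> / of_nat N)"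
  have "[:\<zeta>:] ^ i = 1 \<longleftrightarrow> N dvd i" for i
  proof -
    have "\<zeta> ^ i = exp (2 * of_real pi * \<i> * of_nat i / of_nat N)"
      unfolding \<zeta>_def by (simp add: exp_of_nat_mult[symmetric] mult_ac)
    then show ?thesis
      using complex_root_unity_eq_1[of N i] assms by (simp add: poly_const_pow one_pCons)
  qed
  then obtain H where H: "\<And>x. poly H (x ^ N) = (\<Prod>k<N. poly E ([:\<zeta>:] ^ k * x))"
    using poly_prod_over_roots_of_unity[OF assms, of "[:\<zeta>:]" E] by blast
  show ?thesis
  proof (rule that[of H])
    fix x c
    show "poly2 H (x ^ N) c = (\<Prod>k<N. poly2 E (exp (2 * of_real pi * \<i> / of_nat N) ^ k * x) c)"
      using arg_cong[OF H[of "[:x:]"], of "\<lambda>P. poly P c"]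
      by (simp add: poly2_def poly_const_pow poly_prod \<zeta>_def mult.commute)
  qed
qed

definition homogenize :: "complex poly poly \<Rightarrow> complex \<Rightarrow> complex \<Rightarrow> complex \<Rightarrow> complex" where
  "homogenize H c X Y = (\<Sum>j\<le>degree H. poly (coeff H j) c * X ^ j * Y ^ (degree H - j))"

lemma homogenize_ratio: "homogenize H c (x * Y) Y = Y ^ degree H * poly2 H x c"
proof -
  have "poly2 H x c = (\<Sum>j\<le>degree H. poly (coeff H j) c * x ^ j)"
    by (simp add: poly2_def poly_altdef[of H] poly_sum poly_const_pow mult.commute)
  moreover have "homogenize H c (x * Y) Y = (\<Sum>j\<le>degree H. Y ^ degree H * (poly (coeff H j) c * x ^ j))"
    unfolding homogenize_def
  proof (rule sum.cong[OF refl])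
    fix j assume "j \<in> {..degree H}"
    then have "Y ^ degree H = Y ^ j * Y ^ (degree H - j)"
      by (simp flip: power_add)
    then show "poly (coeff H j) c * (x * Y) ^ j * Y ^ (degree H - j) = Y ^ degree H * (poly (coeff H j) c * x ^ j)"
      by (simp add: power_mult_distrib)
  qed
  ultimately show ?thesis
    by (simp add: sum_distrib_left)
qed

text \<open>Clears the denominators of \<open>(c - s t)\<^sup>2 = (1 - s\<^sup>2) (1 - t\<^sup>2)\<close> for \<open>s = S (1 / x)\<close> and \<open>t = T x\<close>, which relates the
  real parts \<open>s\<close>, \<open>t\<close> of two complex numbers of modulus 1 to the cosine \<open>c\<close> of their angle.\<close>

definition elimination_poly :: "complex poly \<Rightarrow> complex poly \<Rightarrow> complex poly poly" where
  "elimination_poly S T = (let lift = map_poly (\<lambda>a. [:a:]); s = lift (reflect_poly S); t = lift T; d = degree S in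
     (smult [:0, 1:] (monom 1 d) - s * t)\<^sup>2 - (monom 1 (2 * d) - s\<^sup>2) * (1 - t\<^sup>2))"

lemma poly2_elimination_poly:
  "poly2 (elimination_poly S T) x c = (c * x ^ degree S - poly (reflect_poly S) x * poly T x)\<^sup>2
     - (x ^ (2 * degree S) - (poly (reflect_poly S) x)\<^sup>2) * (1 - (poly T x)\<^sup>2)"
  by (simp add: poly2_def elimination_poly_def Let_def poly_monom poly_const_pow pcompose_constant mult.commute
      flip: pcompose_altdef)

lemma poly2_elimination_poly_eq_0:
  assumes "x \<noteq> 0" "(c - poly S (inverse x) * poly T x)\<^sup>2 = (1 - (poly S (inverse x))\<^sup>2) * (1 - (poly T x)\<^sup>2)"
  shows "poly2 (elimination_poly S T) x c = 0"
proof -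
  define s t where "s = poly S (inverse x)" and "t = poly T x"
  have "x ^ (2 * degree S) = (x ^ degree S)\<^sup>2"
    by (simp add: power_mult mult.commute flip: power_mult)
  then have "poly2 (elimination_poly S T) x c
      = (c * x ^ degree S - x ^ degree S * s * t)\<^sup>2 - ((x ^ degree S)\<^sup>2 - (x ^ degree S * s)\<^sup>2) * (1 - t\<^sup>2)"
    by (simp only: poly2_elimination_poly poly_reflect_poly_nz[OF assms(1)] s_def t_def)
  also have "\<dots> = (x ^ degree S)\<^sup>2 * ((c - s * t)\<^sup>2 - (1 - s\<^sup>2) * (1 - t\<^sup>2))"
    by algebra
  finally have "poly2 (elimination_poly S T) x c = (x ^ degree S)\<^sup>2 * ((c - s * t)\<^sup>2 - (1 - s\<^sup>2) * (1 - t\<^sup>2))" .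
  then show ?thesis
    using assms(2) by (simp add: s_def t_def)
qed

lemma poly2_elimination_poly_0: "degree S > 0 \<Longrightarrow> poly2 (elimination_poly S T) 0 c = (lead_coeff S)\<^sup>2"
  by (simp add: poly2_elimination_poly power_0_left algebra_simps)

lemma cosine_of_difference:
  assumes "cmod x = 1" "cmod y = 1"
  shows "(Re (x * cnj y) - Re x * Re y)\<^sup>2 = (1 - (Re x)\<^sup>2) * (1 - (Re y)\<^sup>2)"
proof -
  have "1 - (Re u)\<^sup>2 = (Im u)\<^sup>2" if "cmod u = 1" for u
    using that cmod_power2[of u] by simp
  then show ?thesis
    using assms by (simp add: power_mult_distrib)
qed

section \<open>The degenerate parameters\<close>

lemma degenerate_value_moduli:
  assumes "Re Z + Re W = 0" "\<mu> * Im Z + \<nu> * Im W = 0"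
  shows "(\<nu>\<^sup>2 - \<mu>\<^sup>2) * Re (Z\<^sup>2) = 2 * \<nu>\<^sup>2 * (cmod W)\<^sup>2 - (\<mu>\<^sup>2 + \<nu>\<^sup>2) * (cmod Z)\<^sup>2"
proof -
  have "\<nu> * Im W = - (\<mu> * Im Z)" "Re W = - Re Z"
    using assms by simp_all
  then have "\<nu>\<^sup>2 * (Im W)\<^sup>2 = \<mu>\<^sup>2 * (Im Z)\<^sup>2" "(Re W)\<^sup>2 = (Re Z)\<^sup>2"
    by (simp_all flip: power_mult_distrib)
  then have "\<nu>\<^sup>2 * (cmod W)\<^sup>2 = \<nu>\<^sup>2 * (Re Z)\<^sup>2 + \<mu>\<^sup>2 * (Im Z)\<^sup>2"
    by (simp add: cmod_power2 distrib_left)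
  moreover have "(cmod Z)\<^sup>2 = (Re Z)\<^sup>2 + (Im Z)\<^sup>2" "Re (Z\<^sup>2) = (Re Z)\<^sup>2 - (Im Z)\<^sup>2"
    by (simp_all add: cmod_power2 Re_power2)
  ultimately show ?thesis
    by algebra
qed

definition modulus_const :: "nat \<Rightarrow> real" where
  "modulus_const p = (real p / (real p - 1)) ^ (p - 1) / real p ^ p"

lemma cmod_hessian_value_power:
  assumes "conormal p a c z" "cmod c = 1" "p \<ge> 2"
  shows "cmod (hessian_value p (c * z ^ p)) ^ (p - 1) = modulus_const p * cmod a ^ p"
proof -
  have "cmod (c * of_nat p * z ^ (p - 1)) = cmod (- cnj (c * a))"
    using assms(1) by (simp only: conormal_def)
  then have "cmod z ^ (p - 1) = cmod a / real p"
    using assms by (simp add: norm_mult norm_power field_simps)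
  then have "(cmod z ^ p) ^ (p - 1) = (cmod a / real p) ^ p"
    by (metis power_mult mult.commute)
  then have "(real p / (real p - 1) * cmod z ^ p) ^ (p - 1) = modulus_const p * cmod a ^ p"
    by (simp add: modulus_const_def power_mult_distrib power_divide)
  moreover have "cmod (hessian_value p (c * z ^ p)) = real p / (real p - 1) * cmod z ^ p"
    using assms(2,3) by (simp add: hessian_value_def norm_mult norm_power del: of_real_divide)
  ultimately show ?thesis by simp
qed

lemma sgn_hessian_value_power:
  assumes con: "conormal p a c z" and c: "cmod c = 1" and p: "p \<ge> 2"
  shows "((sgn (hessian_value p (c * z ^ p)))\<^sup>2) ^ (p - 1) = cnj c ^ (2 * (p + 1)) * cnj (sgn a) ^ (2 * p)"
proof -
  have sgn_power: "sgn (x ^ n) = sgn x ^ n" for x :: complex and n by (induction n) (auto simp: sgn_mult)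
  have c1: "c * cnj c = 1" using c by (metis complex_norm_square of_real_1 one_power2)
  have sgn_c: "sgn c = c" "sgn (cnj c) = cnj c" using c by (simp_all add: sgn_eq)
  have "sgn (of_nat p :: complex) = 1" "sgn (complex_of_real (real p / (real p - 1))) = 1"
    using p by (simp_all add: sgn_of_real sgn_eq del: of_real_divide)
  then have "sgn (hessian_value p (c * z ^ p)) = c * sgn z ^ p"
    and "c * sgn z ^ (p - 1) = - (cnj c * cnj (sgn a))"
    using arg_cong[OF con[unfolded conormal_def], of sgn]
    by (simp_all add: hessian_value_def sgn_mult sgn_power sgn_minus sgn_c sgn_eq[of "cnj a"] sgn_eq[of a]
        del: of_real_divide)
  note sgn_value = this(1) and sgn_con = this(2)
  have "sgn z ^ (p - 1) = cnj c * (c * sgn z ^ (p - 1))"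
    using c1 by (simp flip: mult.assoc add: mult.commute[of "cnj c"])
  also have "\<dots> = - ((cnj c)\<^sup>2 * cnj (sgn a))"
    unfolding sgn_con by (simp add: power2_eq_square)
  finally have sgn_z: "sgn z ^ (p - 1) = - ((cnj c)\<^sup>2 * cnj (sgn a))" .
  have "((c * sgn z ^ p)\<^sup>2) ^ (p - 1) = (c\<^sup>2) ^ (p - 1) * ((sgn z ^ (p - 1))\<^sup>2) ^ p"
    by (simp add: power_mult_distrib flip: power_mult) (simp add: mult_ac)
  also have "\<dots> = (c ^ (2 * (p - 1)) * cnj c ^ (4 * p)) * cnj (sgn a) ^ (2 * p)"
    unfolding sgn_z power2_minus by (simp add: power_mult_distrib flip: power_mult)
  also have "4 * p = 2 * (p - 1) + 2 * (p + 1)"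
    using p by simp
  also have "c ^ (2 * (p - 1)) * cnj c ^ (2 * (p - 1) + 2 * (p + 1))
      = (c * cnj c) ^ (2 * (p - 1)) * cnj c ^ (2 * (p + 1))"
    by (simp only: power_add power_mult_distrib mult.assoc)
  finally show ?thesis
    by (simp add: sgn_value c1)
qed

definition phase_difference :: "nat \<Rightarrow> nat \<Rightarrow> real \<Rightarrow> real \<Rightarrow> real" where
  "phase_difference p q \<alpha> \<beta> = real (2 * (q * (p + 1))) * \<beta> - real (2 * (p * (q + 1))) * \<alpha>"

lemma degenerate_phase:
  assumes "conormal p a c z" "conormal q b c w" "cmod c = 1" "p \<ge> 2" "q \<ge> 2" "a \<noteq> 0" "b \<noteq> 0"
  defines "\<zeta> \<equiv> (sgn (hessian_value p (c * z ^ p)))\<^sup>2" and "\<omega> \<equiv> (sgn (hessian_value q (c * w ^ q)))\<^sup>2"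
  shows "\<zeta> ^ ((p - 1) * (q + 1)) * cnj (\<omega> ^ ((q - 1) * (p + 1))) = cis (phase_difference p q (Arg a) (Arg b))"
proof -
  have c1: "c * cnj c = 1" using assms(3) by (metis complex_norm_square of_real_1 one_power2)
  have "\<zeta> ^ ((p - 1) * (q + 1)) = cnj c ^ (2 * ((p + 1) * (q + 1))) * cnj (sgn a) ^ (2 * (p * (q + 1)))"
    unfolding power_mult[of \<zeta>] unfolding \<zeta>_def sgn_hessian_value_power[OF assms(1,3,4)]
    by (simp only: power_mult_distrib power_mult[symmetric] mult.assoc)
  moreover have "\<omega> ^ ((q - 1) * (p + 1)) = cnj c ^ (2 * ((p + 1) * (q + 1))) * cnj (sgn b) ^ (2 * (q * (p + 1)))"
    unfolding power_mult[of \<omega>] unfolding \<omega>_def sgn_hessian_value_power[OF assms(2,3,5)]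
    by (simp only: power_mult_distrib power_mult[symmetric] mult.assoc mult.commute[of "q + 1" "p + 1"])
  ultimately have "\<zeta> ^ ((p - 1) * (q + 1)) * cnj (\<omega> ^ ((q - 1) * (p + 1)))
      = (c * cnj c) ^ (2 * ((p + 1) * (q + 1))) * (cnj (sgn a) ^ (2 * (p * (q + 1))) * sgn b ^ (2 * (q * (p + 1))))"
    by (simp add: power_mult_distrib mult_ac)
  also have "\<dots> = cnj (cis (Arg a)) ^ (2 * (p * (q + 1))) * cis (Arg b) ^ (2 * (q * (p + 1)))"
    using assms(6,7) by (simp add: c1 cis_Arg)
  also have "\<dots> = cis (phase_difference p q (Arg a) (Arg b))"
    unfolding phase_difference_def
    by (simp only: cis_cnj Complex.DeMoivre cis_mult mult_minus_right) (simp only: diff_conv_add_uminus add.commute)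
  finally show ?thesis .
qed

definition resonance_poly :: "real \<Rightarrow> real \<Rightarrow> nat \<Rightarrow> complex poly" where
  "resonance_poly \<mu> \<nu> m = pcompose (chebyshev m)
     [:of_real (- (\<mu>\<^sup>2 + \<nu>\<^sup>2) / (\<nu>\<^sup>2 - \<mu>\<^sup>2)), of_real (2 * \<nu>\<^sup>2 / (\<nu>\<^sup>2 - \<mu>\<^sup>2)):]"

lemma degree_resonance_poly: "\<nu>\<^sup>2 \<noteq> \<mu>\<^sup>2 \<Longrightarrow> \<nu> \<noteq> 0 \<Longrightarrow> degree (resonance_poly \<mu> \<nu> m) = m"
  by (simp add: resonance_poly_def degree_pcompose degree_chebyshev del: of_real_divide)

lemma poly_resonance_poly:
  assumes "Re Z + Re W = 0" "\<mu> * Im Z + \<nu> * Im W = 0" "Z \<noteq> 0" "\<nu>\<^sup>2 \<noteq> \<mu>\<^sup>2"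
  shows "poly (resonance_poly \<mu> \<nu> m) (of_real ((cmod W)\<^sup>2 / (cmod Z)\<^sup>2)) = of_real (Re (((sgn Z)\<^sup>2) ^ m))"
proof -
  have "Re (Z\<^sup>2) = (cmod Z)\<^sup>2 * Re ((sgn Z)\<^sup>2)"
    by (simp add: sgn_eq power_divide flip: of_real_power)
  then have "(\<nu>\<^sup>2 - \<mu>\<^sup>2) * ((cmod Z)\<^sup>2 * Re ((sgn Z)\<^sup>2)) = 2 * \<nu>\<^sup>2 * (cmod W)\<^sup>2 - (\<mu>\<^sup>2 + \<nu>\<^sup>2) * (cmod Z)\<^sup>2"
    using degenerate_value_moduli[OF assms(1,2)] by simp
  then have "Re ((sgn Z)\<^sup>2)
      = (2 * \<nu>\<^sup>2 * (cmod W)\<^sup>2 - (\<mu>\<^sup>2 + \<nu>\<^sup>2) * (cmod Z)\<^sup>2) / ((\<nu>\<^sup>2 - \<mu>\<^sup>2) * (cmod Z)\<^sup>2)"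
    using assms(3,4) by (simp add: nonzero_eq_divide_eq mult_ac)
  also have "\<dots> = - (\<mu>\<^sup>2 + \<nu>\<^sup>2) / (\<nu>\<^sup>2 - \<mu>\<^sup>2) + 2 * \<nu>\<^sup>2 / (\<nu>\<^sup>2 - \<mu>\<^sup>2) * ((cmod W)\<^sup>2 / (cmod Z)\<^sup>2)"
    using assms(3) by (simp add: diff_divide_distrib add_divide_distrib)
  finally have "Re ((sgn Z)\<^sup>2) = \<dots>" .
  then have "poly (resonance_poly \<mu> \<nu> m) (of_real ((cmod W)\<^sup>2 / (cmod Z)\<^sup>2))
      = poly (chebyshev m) (of_real (Re ((sgn Z)\<^sup>2)))"
    by (simp add: resonance_poly_def poly_pcompose mult.commute)
  also have "\<dots> = of_real (Re (((sgn Z)\<^sup>2) ^ m))"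
    by (rule poly_chebyshev_Re) (use assms(3) in \<open>simp add: norm_power norm_sgn\<close>)
  finally show ?thesis .
qed

lemma degenerate_point_values:
  assumes "degenerate_point p q a b c z w" "cmod c = 1" "p \<ge> 2" "q \<ge> 2" "a \<noteq> 0" "b \<noteq> 0"
  obtains Z W where "Z \<noteq> 0" "W \<noteq> 0" "Re Z + Re W = 0" "cusp_weight p * Im Z + cusp_weight q * Im W = 0"
    "cmod Z ^ (p - 1) = modulus_const p * cmod a ^ p" "cmod W ^ (q - 1) = modulus_const q * cmod b ^ q"
    "((sgn Z)\<^sup>2) ^ ((p - 1) * (q + 1)) * cnj (((sgn W)\<^sup>2) ^ ((q - 1) * (p + 1)))
      = cis (phase_difference p q (Arg a) (Arg b))"
proof -
  have con: "conormal p a c z" "conormal q b c w"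
    using assms(1) by (auto simp: degenerate_point_def)
  have c: "c \<noteq> 0" using assms(2) by auto
  then have "z \<noteq> 0" "w \<noteq> 0"
    using conormal_nonzero con assms by blast+
  then have "hessian_value p (c * z ^ p) \<noteq> 0" "hessian_value q (c * w ^ q) \<noteq> 0"
    using c assms(3,4) by (auto simp: hessian_value_def simp del: of_real_divide)
  then show ?thesis
    by (rule that)
       (use assms(1) cmod_hessian_value_power degenerate_phase con assms in \<open>auto simp: degenerate_point_def\<close>)
qed

lemma degenerate_equal_exponents:
  assumes "degenerate p p a b" "p \<ge> 2" "a \<noteq> 0" "b \<noteq> 0"
  shows "cmod a = cmod b"
proof -
  obtain c z w where c: "cmod c = 1" and dg: "degenerate_point p p a b c z w"
    using assms(1) unfolding degenerate_def by blast
  obtain Z W where ZW: "Re Z + Re W = 0" "cusp_weight p * Im Z + cusp_weight p * Im W = 0"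
    and mod: "cmod Z ^ (p - 1) = modulus_const p * cmod a ^ p" "cmod W ^ (p - 1) = modulus_const p * cmod b ^ p"
    by (rule degenerate_point_values[OF dg c assms(2,2,3,4)])
  have "cusp_weight p \<noteq> 0" "modulus_const p \<noteq> 0"
    using assms(2) by (auto simp: cusp_weight_def modulus_const_def)
  moreover from this(1) have "cmod Z = cmod W"
    using degenerate_value_moduli[OF ZW] by simp
  ultimately have "cmod a ^ p = cmod b ^ p"
    using mod by simp
  then show ?thesis
    by (rule power_eq_imp_eq_base) (use assms(2) in auto)
qed

definition resonance_equation :: "nat \<Rightarrow> nat \<Rightarrow> complex poly poly" where
  "resonance_equation p q = elimination_poly
     (resonance_poly (cusp_weight p) (cusp_weight q) ((p - 1) * (q + 1)))
     (resonance_poly (cusp_weight q) (cusp_weight p) ((q - 1) * (p + 1)))"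

lemma cusp_weight_power2_neq:
  assumes "p \<ge> 2" "q \<ge> 2" "p \<noteq> q"
  shows "(cusp_weight q)\<^sup>2 \<noteq> (cusp_weight p)\<^sup>2"
proof -
  have "cusp_weight p > 0" "cusp_weight q > 0" "cusp_weight q \<noteq> cusp_weight p"
    using assms by (auto simp: cusp_weight_def field_simps)
  then show ?thesis
    by (simp add: power2_eq_iff_nonneg)
qed

lemma poly2_resonance_equation_0:
  assumes "p \<ge> 2" "q \<ge> 2" "p \<noteq> q"
  shows "poly2 (resonance_equation p q) 0 c \<noteq> 0"
proof -
  let ?S = "resonance_poly (cusp_weight p) (cusp_weight q) ((p - 1) * (q + 1))"
  have "cusp_weight q \<noteq> 0"
    using assms(2) by (simp add: cusp_weight_def)
  then have S: "degree ?S > 0"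
    using degree_resonance_poly[OF cusp_weight_power2_neq[OF assms]] assms(1) by simp
  then have "lead_coeff ?S \<noteq> 0" by auto
  then show ?thesis
    unfolding resonance_equation_def poly2_elimination_poly_0[OF S] by (rule power_not_zero)
qed

lemma poly2_resonance_equation_eq_0:
  assumes exponents: "p \<ge> 2" "q \<ge> 2" "p \<noteq> q" and nz: "Z \<noteq> 0" "W \<noteq> 0"
    and re: "Re Z + Re W = 0" and im: "cusp_weight p * Im Z + cusp_weight q * Im W = 0"
    and phase: "((sgn Z)\<^sup>2) ^ ((p - 1) * (q + 1)) * cnj (((sgn W)\<^sup>2) ^ ((q - 1) * (p + 1))) = cis \<theta>"
  shows "poly2 (resonance_equation p q) (of_real ((cmod Z)\<^sup>2 / (cmod W)\<^sup>2)) (of_real (cos \<theta>)) = 0"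
proof -
  define s t where "s = ((sgn Z)\<^sup>2) ^ ((p - 1) * (q + 1))" and "t = ((sgn W)\<^sup>2) ^ ((q - 1) * (p + 1))"
  have "cmod s = 1" "cmod t = 1"
    using nz by (simp_all add: s_def t_def norm_power norm_sgn)
  moreover have "cos \<theta> = Re (s * cnj t)"
    unfolding s_def t_def phase by simp
  ultimately have "(cos \<theta> - Re s * Re t)\<^sup>2 = (1 - (Re s)\<^sup>2) * (1 - (Re t)\<^sup>2)"
    using cosine_of_difference by simp
  from arg_cong[OF this, of complex_of_real]
  have cosine: "(of_real (cos \<theta>) - of_real (Re s) * of_real (Re t))\<^sup>2
      = (1 - (of_real (Re s))\<^sup>2) * (1 - (of_real (Re t))\<^sup>2 :: complex)"
    by (simp only: of_real_1 of_real_diff of_real_mult of_real_power)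
  have ratio: "inverse (complex_of_real ((cmod Z)\<^sup>2 / (cmod W)\<^sup>2)) = of_real ((cmod W)\<^sup>2 / (cmod Z)\<^sup>2)"
    by simp
  note neq = cusp_weight_power2_neq[OF exponents]
  let ?S = "resonance_poly (cusp_weight p) (cusp_weight q) ((p - 1) * (q + 1))"
  let ?T = "resonance_poly (cusp_weight q) (cusp_weight p) ((q - 1) * (p + 1))"
  have poly_S: "poly ?S (of_real ((cmod W)\<^sup>2 / (cmod Z)\<^sup>2)) = of_real (Re s)"
    unfolding s_def by (rule poly_resonance_poly[OF re im nz(1) neq])
  have poly_T: "poly ?T (of_real ((cmod Z)\<^sup>2 / (cmod W)\<^sup>2)) = of_real (Re t)"
    unfolding t_def by (rule poly_resonance_poly) (use re im nz neq in \<open>simp_all add: add.commute\<close>)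
  show ?thesis
    unfolding resonance_equation_def
  proof (rule poly2_elimination_poly_eq_0)
    show "complex_of_real ((cmod Z)\<^sup>2 / (cmod W)\<^sup>2) \<noteq> 0"
      using nz by simp
  qed (use cosine in \<open>simp only: ratio poly_S poly_T\<close>)
qed

locale unequal_exponents =
  fixes p q :: nat and H :: "complex poly poly"
  assumes p: "p \<ge> 2" and q: "q \<ge> 2" and unequal: "p \<noteq> q"
    and H: "\<And>x c. poly2 H (x ^ ((p - 1) * (q - 1))) c = (\<Prod>k<(p - 1) * (q - 1).
      poly2 (resonance_equation p q) (exp (2 * of_real pi * \<i> / of_nat ((p - 1) * (q - 1))) ^ k * x) c)"
begin

definition resonance :: "real ^ 4 \<Rightarrow> complex" where
  "resonance y = homogenize H (of_real (cos (phase_difference p q (y $ 2) (y $ 4))))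
     (of_real ((modulus_const p ^ (q - 1) * (y $ 1) ^ (p * (q - 1)))\<^sup>2))
     (of_real ((modulus_const q ^ (p - 1) * (y $ 3) ^ (q * (p - 1)))\<^sup>2))"

lemma analytic_resonance: "real_analytic_multi_on UNIV (\<lambda>y. (cmod (resonance y))\<^sup>2)"
  unfolding resonance_def homogenize_def phase_difference_def cos_diff
  by (intro real_analytic_multi_on_cmod_square complex_analytic_multi_on_sum complex_analytic_multi_on_mult
      complex_analytic_multi_on_poly complex_analytic_multi_on_power complex_analytic_multi_on_of_real
      real_analytic_intros)

lemma resonance_nonzero: "resonance (polar_coords 0 1) \<noteq> 0"
proof -
  have "(0::complex) ^ ((p - 1) * (q - 1)) = 0"
    using p q by simp
  then have "poly2 H 0 c = poly2 (resonance_equation p q) 0 c ^ ((p - 1) * (q - 1))" for c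
    using H[of 0 c] by (simp only: mult_zero_right prod_constant card_lessThan)
  then have "poly2 H 0 c \<noteq> 0" for c
    by (simp add: poly2_resonance_equation_0[OF p q unequal])
  moreover have "modulus_const q \<noteq> 0" "p * (q - 1) \<noteq> 0"
    using p q by (simp_all add: modulus_const_def)
  ultimately show ?thesis
    using homogenize_ratio[of H _ 0] by (simp add: resonance_def polar_coords_def vector_4 power_0_left)
qed

lemma resonance_degenerate:
  assumes "degenerate p q a b" "a \<noteq> 0" "b \<noteq> 0"
  shows "resonance (polar_coords a b) = 0"
proof -
  obtain c z w where c: "cmod c = 1" and dg: "degenerate_point p q a b c z w"
    using assms(1) unfolding degenerate_def by blast
  define C where "C = cos (phase_difference p q (Arg a) (Arg b))"
  obtain Z W where nz: "Z \<noteq> 0" "W \<noteq> 0"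
    and re: "Re Z + Re W = 0" and im: "cusp_weight p * Im Z + cusp_weight q * Im W = 0"
    and mod: "cmod Z ^ (p - 1) = modulus_const p * cmod a ^ p" "cmod W ^ (q - 1) = modulus_const q * cmod b ^ q"
    and phase: "((sgn Z)\<^sup>2) ^ ((p - 1) * (q + 1)) * cnj (((sgn W)\<^sup>2) ^ ((q - 1) * (p + 1)))
      = cis (phase_difference p q (Arg a) (Arg b))"
    by (rule degenerate_point_values[OF dg c p q assms(2,3)])
  define N where "N = (p - 1) * (q - 1)"
  define R where "R = (cmod Z)\<^sup>2 / (cmod W)\<^sup>2"
  have "poly2 (resonance_equation p q) (of_real R) (of_real C) = 0"
    unfolding R_def C_def by (rule poly2_resonance_equation_eq_0[OF p q unequal nz re im phase])
  then have "poly2 H (of_real R ^ N) (of_real C) = 0"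
    unfolding N_def H using p q by (intro prod_zero) (auto intro!: bexI[of _ 0])
  moreover have "modulus_const p ^ (q - 1) * cmod a ^ (p * (q - 1)) = cmod Z ^ N"
    "modulus_const q ^ (p - 1) * cmod b ^ (q * (p - 1)) = cmod W ^ N"
    using arg_cong[OF mod(1), of "\<lambda>x. x ^ (q - 1)"] arg_cong[OF mod(2), of "\<lambda>x. x ^ (p - 1)"]
    by (simp_all only: N_def power_mult_distrib power_mult[symmetric] mult.commute)
  moreover have "(cmod Z ^ N)\<^sup>2 = R ^ N * (cmod W ^ N)\<^sup>2"
    using nz by (simp add: R_def power_divide mult.commute flip: power_mult)
  ultimately show ?thesis
    using homogenize_ratio[of H "of_real C" "of_real R ^ N" "of_real ((cmod W ^ N)\<^sup>2)"]
    by (simp add: resonance_def polar_coords_def vector_4 C_def)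
qed

end

theorem degenerate_locus:
  assumes p: "p \<ge> 2" and q: "q \<ge> 2"
  obtains g :: "real ^ 4 \<Rightarrow> real" where "real_analytic_multi_on UNIV g" "\<exists>a b. g (polar_coords a b) \<noteq> 0"
    "\<And>a b. a \<noteq> 0 \<Longrightarrow> b \<noteq> 0 \<Longrightarrow> degenerate p q a b \<Longrightarrow> g (polar_coords a b) = 0"
proof (cases "p = q")
  case False
  have "(p - 1) * (q - 1) > 0" using p q by simp
  then obtain H where "unequal_exponents p q H"
    using poly2_norm unequal_exponents.intro p q False by metis
  then interpret unequal_exponents p q H .
  show ?thesis
    by (rule that[OF analytic_resonance]) (use resonance_nonzero resonance_degenerate in auto)
next
  case True
  show ?thesis
  proof (rule that[of "\<lambda>y :: real ^ 4. y $ 1 - y $ 3"])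
    show "real_analytic_multi_on UNIV (\<lambda>y :: real ^ 4. y $ 1 - y $ 3)" by (intro real_analytic_intros)
    show "\<exists>a b. polar_coords a b $ 1 - polar_coords a b $ 3 \<noteq> 0"
      by (rule exI[of _ 1], rule exI[of _ 0]) (simp add: polar_coords_def vector_4)
    show "polar_coords a b $ 1 - polar_coords a b $ 3 = 0" if "a \<noteq> 0" "b \<noteq> 0" "degenerate p q a b" for a b
      using degenerate_equal_exponents[of p a b] p that True by (simp add: polar_coords_def vector_4)
  qed
qed

lemma excellent_linear_deformation:
  fixes p q :: nat
  assumes "p \<ge> 2" "q \<ge> 2" and ab: "a \<noteq> 0" "b \<noteq> 0" "\<not> degenerate p q a b"
  defines "f \<equiv> (\<lambda>(z, w). z ^ p + w ^ q :: complex)"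
  shows "\<exists>a1 b1 a2 b2.
             is_linear_deformation_coeffs a1 \<and> is_linear_deformation_coeffs b1
           \<and> is_linear_deformation_coeffs a2 \<and> is_linear_deformation_coeffs b2
           \<and> lin_deform f a1 b1 a2 b2 1 = (\<lambda>(z, w). f (z, w) + a * cnj z + b * cnj w)
           \<and> (\<forall>t\<in>{0<..1}. excellent_map (lin_deform f a1 b1 a2 b2 t)
                 \<and> (\<forall>x. singular_point (lin_deform f a1 b1 a2 b2 t) x \<longrightarrow>
                        has_local_form (lin_deform f a1 b1 a2 b2 t) indefinite_fold_form x
                        \<or> is_cusp (lin_deform f a1 b1 a2 b2 t) x))"
proof -
  define a2 b2 where "a2 = (\<lambda>t. of_real (t ^ (q * (p - 1))) * a)" and "b2 = (\<lambda>t. of_real (t ^ (p * (q - 1))) * b)"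
  let ?F = "lin_deform f (\<lambda>t. 0) (\<lambda>t. 0) a2 b2"
  have F: "?F t = mixed_map p q (a2 t) (b2 t)" for t
    by (auto simp: lin_deform_def mixed_map_def harmonic_power_def f_def)
  have coeffs: "is_linear_deformation_coeffs a2" "is_linear_deformation_coeffs b2" "is_linear_deformation_coeffs (\<lambda>t. 0)"
    using is_linear_deformation_coeffs_monomial[of "q * (p - 1)" a]
      is_linear_deformation_coeffs_monomial[of "p * (q - 1)" b] is_linear_deformation_coeffs_monomial[of 1 0] assms(1,2) by (simp_all add: a2_def b2_def)
  have "?F 1 = (\<lambda>(z, w). f (z, w) + a * cnj z + b * cnj w)"
    by (auto simp: lin_deform_def a2_def b2_def)
  moreover have "excellent_map (?F t) \<and> (\<forall>x. singular_point (?F t) x \<longrightarrow>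
      has_local_form (?F t) indefinite_fold_form x \<or> is_cusp (?F t) x)" if t: "t \<in> {0<..1}" for t
  proof -
    have "a2 t \<noteq> 0" "b2 t \<noteq> 0" using ab t by (auto simp: a2_def b2_def)
    moreover have "\<not> degenerate p q (a2 t) (b2 t)"
      using degenerate_scale[of t p q a b] ab(3) t by (auto simp: a2_def b2_def simp flip: power_mult)
    ultimately show ?thesis
      unfolding F using excellent_mixed_map singular_point_mixed_map_normal_form assms(1,2) by blast
  qed
  ultimately show ?thesis using coeffs by blast
qed

theorem theorem1p1:
  fixes p q :: nat
  assumes "p \<ge> 2" and "q \<ge> 2"
  defines "f \<equiv> (\<lambda>(z, w). z ^ p + w ^ q :: complex)"
  shows "\<exists>B :: (complex \<times> complex) set. \<exists>gs :: (real ^ 4 \<Rightarrow> real) set.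
     finite gs
     \<and> (\<forall>g\<in>gs. real_analytic_multi_on UNIV g \<and> (\<exists>a b. g (polar_coords a b) \<noteq> 0))
     \<and> B \<subseteq> {(a, b). \<exists>g\<in>gs. g (polar_coords a b) = 0}
     \<and> (\<forall>a b. (a, b) \<notin> B \<longrightarrow>
          (\<exists>a1 b1 a2 b2.
             is_linear_deformation_coeffs a1 \<and> is_linear_deformation_coeffs b1
           \<and> is_linear_deformation_coeffs a2 \<and> is_linear_deformation_coeffs b2
           \<and> lin_deform f a1 b1 a2 b2 1 = (\<lambda>(z, w). f (z, w) + a * cnj z + b * cnj w)
           \<and> (\<forall>t\<in>{0<..1}. excellent_map (lin_deform f a1 b1 a2 b2 t)
                 \<and> (\<forall>x. singular_point (lin_deform f a1 b1 a2 b2 t) x \<longrightarrow>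
                        has_local_form (lin_deform f a1 b1 a2 b2 t) indefinite_fold_form x
                        \<or> is_cusp (lin_deform f a1 b1 a2 b2 t) x))))"
proof -
  obtain g :: "real ^ 4 \<Rightarrow> real" where g: "real_analytic_multi_on UNIV g" "\<exists>a b. g (polar_coords a b) \<noteq> 0"
    and g_degenerate: "\<And>a b. a \<noteq> 0 \<Longrightarrow> b \<noteq> 0 \<Longrightarrow> degenerate p q a b \<Longrightarrow> g (polar_coords a b) = 0"
    by (rule degenerate_locus[OF assms(1,2)]) blast
  define B where "B = {(a, b). a = 0 \<or> b = 0 \<or> degenerate p q a b}"
  define gs :: "(real ^ 4 \<Rightarrow> real) set" where "gs = {g, \<lambda>y. y $ 1, \<lambda>y. y $ 3}"
  have polar: "polar_coords a b $ 1 = cmod a" "polar_coords a b $ 3 = cmod b" for a b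
    by (simp_all add: polar_coords_def vector_4)
  have "finite gs"
    by (simp add: gs_def)
  moreover have "real_analytic_multi_on UNIV g' \<and> (\<exists>a b. g' (polar_coords a b) \<noteq> 0)" if "g' \<in> gs" for g'
    using that g real_analytic_multi_on_nth polar[of 1 1] unfolding gs_def
    by (metis insertE norm_one singletonD zero_neq_one)
  moreover have "B \<subseteq> {(a, b). \<exists>g\<in>gs. g (polar_coords a b) = 0}"
    using g_degenerate by (auto simp: B_def gs_def polar)
  ultimately show ?thesis
    unfolding f_def using excellent_linear_deformation[OF assms(1,2)]
    by (intro exI[of _ B] exI[of _ gs]) (auto simp: B_def)
qed

end
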